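(* Let $p$ be a prime and $n$ a positive integer, and let $M_p(n)$ denote the maximum of $\operatorname{rdim}(G)$ as $G$ ranges over all groups of order $p^n$. Define \[ f_p(n) := \max_{r \in \mathbb{N},\ r\ge 1} \left( r\, p^{\lfloor (n-r)/2 \rfloor} \right). \] If $(p,n)$ is not one of the pairs $(2,5)$, $(2,7)$, or $(p,4)$ with $p$ odd, then $M_p(n) = f_p(n)$. In the exceptional cases: $M_2(5) = 5$, $M_2(7) = 10$, and $M_p(4) = p+1$ for every odd prime $p$.
   Context: For a finite group $G$, the representation dimension $\operatorname{rdim}(G)$ is the smallest positive integer $m$ such that there is an injective group homomorphism $G \hookrightarrow \mathrm{GL}_m(\mathbb{C})$, i.e. the minimal dimension of a faithful complex linear representation of $G$.
   Formalization: The maximum defining f_p(n) is taken over 1 ≤ r ≤ n; with all r ≥ 1 the term r = 3 gives f_2(1) = 3/2 although M_2(1) = 1 (no other value changes). M_p(n) ranges over groups whose underlying set consists of natural numbers, which covers all finite groups up to isomorphism. *)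

theory Defs
  imports "HOL-Algebra.Group" "Jordan_Normal_Form.Matrix"
begin

definition GL :: "nat \<Rightarrow> complex mat monoid" where
  "GL m = \<lparr> carrier = {A. A \<in> carrier_mat m m \<and> invertible_mat A},
            monoid.mult = (\<lambda>A B. A * B),
            one = 1\<^sub>m m \<rparr>"

definition rdim :: "('a, 'b) monoid_scheme \<Rightarrow> nat" where
  "rdim G = (LEAST m. m \<ge> 1 \<and> (\<exists>\<rho>. \<rho> \<in> hom G (GL m) \<and> inj_on \<rho> (carrier G)))"

text \<open>M_p(n): maximum of rdim over all groups of order p^n (represented, up to
  isomorphism, with carrier contained in nat).\<close>
definition M :: "nat \<Rightarrow> nat \<Rightarrow> nat" where
  "M p n = Max {rdim G | G :: nat monoid. group G \<and> finite (carrier G) \<and> card (carrier G) = p ^ n}"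

definition f :: "nat \<Rightarrow> nat \<Rightarrow> nat" where
  "f p n = Max {r * p ^ ((n - r) div 2) | r. 1 \<le> r \<and> r \<le> n}"

end

theory Submission
  imports Defs "HOL-Algebra.Group_Action" "HOL-Algebra.Multiplicative_Group"
    "Jordan_Normal_Form.Determinant" "HOL-Number_Theory.Cong"
begin

text \<open>
  Let \<open>G\<close> have order \<open>p^n\<close> and let \<open>\<Omega>\<close> be the group of central elements of order dividing \<open>p\<close>, of
  order \<open>p^r\<close>. A representation of \<open>G\<close> is faithful as soon as it is faithful on \<open>\<Omega>\<close>, because a nontrivial
  normal subgroup of a \<open>p\<close>-group meets \<open>\<Omega>\<close>. A character of \<open>\<Omega>\<close> extends to a linear character of
  some subgroup \<open>H\<close> with \<open>|G| |\<Omega>| \<le> |H|\<^sup>2\<close>, so it lies under an induced representation of degree at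
  most \<open>p^((n-r)/2)\<close>, and \<open>r\<close> characters separate \<open>\<Omega>\<close>. This gives the upper bound \<open>f\<close>. In the exceptional
  cases some nontrivial character of \<open>\<Omega>\<close> has a degenerate commutator form and needs a smaller degree.

  Conversely, a faithful representation of a central extension of elementary abelian groups must involve
  at least \<open>r\<close> nontrivial characters of the central factor. If \<open>A\<close> is an abelian subgroup whose characters
  over such a character have \<open>p^k\<close> conjugates, these contribute \<open>p^k\<close> linearly independent eigenvectors.
  Commutator pairings all of whose nontrivial combinations are nondegenerate come from powers of the
  companion matrix of a polynomial of degree \<open>k\<close> without small factors.
\<close>

section \<open>Fixed points of p-groups\<close>

text \<open>Write n = 2k + r for the r that maximises \<open>r * p ^ ((n - r) div 2)\<close>: 1 or 2
  for odd p, 2 or 3 for p = 2 (1 if n = 1). A nonzero combination of 1, C, ..., C^(r-1), with C a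
  companion matrix of size k, is a polynomial of degree below r in C; all of them are invertible iff
  the characteristic polynomial has no irreducible factor of degree below r. For r = 2, 3 and k
  \<ge> 1 this is possible iff k \<ge> r. If k = 0, or p = 2 and n = 4, elementary abelian groups
  reach the bound. The leftover is exactly the list of exceptions: k = 1 for (p,4) and (2,5), k = 2
  for (2,7). There the failure is forced: on a space of dimension 2k the Pfaffian of a combination
  of r > k alternating forms is a polynomial of degree k in r variables and so has a nontrivial zero
  modulo p. A character with degenerate form loses a factor p, which explains p + 1 and 4 + 4 + 2 =
  10; for (2,5), r = 3 leaves only 2 + 1 + 1, and the elementary abelian group of rank 5 wins. As
  the quotient by \<Omega> need not be elementary abelian, the upper bounds are proved with
  commutators in G itself.\<close>

lemma (in group) inv_mult_cancel_left:
  "\<lbrakk>x \<in> carrier G; y \<in> carrier G\<rbrakk> \<Longrightarrow> inv x \<otimes> (x \<otimes> y) = y"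
  by (simp flip: m_assoc)

lemma (in group) mult_inv_cancel_left:
  "\<lbrakk>x \<in> carrier G; y \<in> carrier G\<rbrakk> \<Longrightarrow> x \<otimes> (inv x \<otimes> y) = y"
  by (simp flip: m_assoc)

lemmas (in group) word_simps = m_assoc inv_mult_group inv_mult_cancel_left mult_inv_cancel_left

lemma (in group) subgroup_nat_pow_closed:
  fixes k :: nat
  assumes "subgroup H G" "x \<in> H" shows "x [^] k \<in> H"
  by (induction k) (simp_all add: assms subgroup.one_closed subgroup.m_closed)

lemma (in group) conj_pow:
  fixes k :: nat
  assumes "g \<in> carrier G" "x \<in> carrier G"
  shows "g \<otimes> x [^] k \<otimes> inv g = (g \<otimes> x \<otimes> inv g) [^] k"
proof (induction k)
  case 0 then show ?case using assms by simp
next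
  case (Suc k)
  have "(g \<otimes> x \<otimes> inv g) [^] Suc k = (g \<otimes> x [^] k \<otimes> inv g) \<otimes> (g \<otimes> x \<otimes> inv g)"
    using Suc by simp
  then show ?case using assms by (simp add: word_simps)
qed

text \<open>\<open>BijGroup\<close> consists of functions that are \<open>undefined\<close> outside
  the set, hence the \<open>restrict\<close>; the map of the inverse element supplies the inverse
  bijection.\<close>

lemma group_action_restrictI:
  assumes "group G"
    and cl: "\<And>g x. g \<in> carrier G \<Longrightarrow> x \<in> E \<Longrightarrow> act g x \<in> E"
    and one: "\<And>x. x \<in> E \<Longrightarrow> act \<one>\<^bsub>G\<^esub> x = x"
    and mult: "\<And>g h x. g \<in> carrier G \<Longrightarrow> h \<in> carrier G \<Longrightarrow> x \<in> E \<Longrightarrow> act (g \<otimes>\<^bsub>G\<^esub> h) x = act g (act h x)"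
  shows "group_action G E (\<lambda>g. restrict (act g) E)"
proof -
  interpret group G by fact
  have inv: "act (inv\<^bsub>G\<^esub> g) (act g x) = x" "act g (act (inv\<^bsub>G\<^esub> g) x) = x" if "g \<in> carrier G" "x \<in> E" for g x
    using that mult[of "inv\<^bsub>G\<^esub> g" g x] mult[of g "inv\<^bsub>G\<^esub> g" x] one by simp_all
  have bij: "restrict (act g) E \<in> Bij E" if g: "g \<in> carrier G" for g
  proof -
    have "bij_betw (act g) E E"
      by (rule bij_betw_byWitness[where f' = "act (inv\<^bsub>G\<^esub> g)"]) (use g inv cl in auto)
    then show ?thesis by (simp add: Bij_def)
  qed
  show ?thesis
    unfolding group_action_def group_hom_def group_hom_axioms_def
  proof (intro conjI homI)
    fix g h assume gh: "g \<in> carrier G" "h \<in> carrier G"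
    show "restrict (act (g \<otimes>\<^bsub>G\<^esub> h)) E = restrict (act g) E \<otimes>\<^bsub>BijGroup E\<^esub> restrict (act h) E"
      using gh bij by (auto simp: BijGroup_def compose_def mult cl fun_eq_iff)
  qed (use bij in \<open>auto simp: BijGroup_def group_BijGroup[unfolded BijGroup_def] assms\<close>)
qed

text \<open>Orbits have p-power size, so the number of fixed points is congruent to
  \<open>card E\<close> modulo p; one fixed point together with \<open>p dvd card E\<close> forces
  another.\<close>

lemma (in group_action) p_group_second_fixed_point:
  assumes "prime p" "Coset.order G = p ^ k" "finite E" "p dvd card E"
    and x0: "x0 \<in> E" "\<And>g. g \<in> carrier G \<Longrightarrow> \<phi> g x0 = x0"
  obtains x where "x \<in> E" "x \<noteq> x0" "\<And>g. g \<in> carrier G \<Longrightarrow> \<phi> g x = x"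
proof (rule ccontr)
  assume "\<not> thesis"
  with that have nt: "x = x0" if "x \<in> E" "\<And>g. g \<in> carrier G \<Longrightarrow> \<phi> g x = x" for x
    using that by metis
  interpret GH: group_hom G "BijGroup E" \<phi> by (rule group_hom)
  have one: "\<one> \<in> carrier G" by simp
  have orb0: "orbit G \<phi> x0 = {x0}"
  proof (intro equalityI subsetI)
    fix y assume "y \<in> {x0}"
    then have "y = \<phi> \<one> x0" using x0(2)[OF one] by simp
    then show "y \<in> orbit G \<phi> x0" using one unfolding orbit_def by blast
  next
    fix y assume "y \<in> orbit G \<phi> x0"
    then show "y \<in> {x0}" using x0(2) unfolding orbit_def by blast
  qed
  have inOrb: "{x0} \<in> orbits G E \<phi>" using orb0 x0(1) unfolding orbits_def by force
  have fin: "finite (orbits G E \<phi>)"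
    using orbits_coverture assms(3) by (metis finite_UnionD)
  have dvd: "p dvd card b" if b: "b \<in> orbits G E \<phi> - {{x0}}" for b
  proof -
    obtain x where x: "x \<in> E" "b = orbit G \<phi> x" using b unfolding orbits_def by auto
    have "card b dvd p ^ k"
      using orbit_stabilizer_theorem[OF x(1)] x(2) assms(2) by (metis dvd_triv_left)
    then obtain i where i: "card b = p ^ i" using assms(1) divides_primepow_nat by blast
    have "i \<noteq> 0"
    proof
      assume "i = 0"
      then have "card b = 1" using i by simp
      moreover have "x \<in> b" using x orbit_refl by simp
      ultimately have bx: "b = {x}" by (metis card_1_singletonE singletonD)
      then have "\<phi> g x = x" if "g \<in> carrier G" for g
        using that x(2) unfolding orbit_def by auto
      moreover have "x \<noteq> x0" using bx b by auto
      ultimately show False using nt[OF x(1)] by simp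
    qed
    then show ?thesis using i by (simp add: dvd_power)
  qed
  have "card E = (\<Sum>b\<in>orbits G E \<phi>. card b)"
    using disjoint_sum[OF assms(3), of "\<lambda>_. 1::nat"] by simp
  also have "\<dots> = 1 + (\<Sum>b\<in>orbits G E \<phi> - {{x0}}. card b)"
    using fin inOrb by (simp add: sum.remove)
  finally have "card E = 1 + (\<Sum>b\<in>orbits G E \<phi> - {{x0}}. card b)" .
  moreover have "p dvd (\<Sum>b\<in>orbits G E \<phi> - {{x0}}. card b)" using dvd by (rule dvd_sum)
  ultimately have "p dvd 1" using assms(4) by (metis dvd_add_left_iff)
  then show False using assms(1) by simp
qed

locale p_group = group G for G (structure) +
  fixes p n :: nat
  assumes p: "prime p" and order_eq: "card (carrier G) = p ^ n"
begin

lemma finite_carrier: "finite (carrier G)"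
  using order_eq p by (metis card.infinite power_not_zero not_prime_0)

lemma subgroup_finite: "subgroup H G \<Longrightarrow> finite H"
  using finite_carrier by (meson finite_subset subgroup.subset)

lemma subgroup_card_dvd:
  assumes "subgroup N G" "subgroup K G" "N \<subseteq> K"
  shows "card (rcosets\<^bsub>G\<lparr>carrier := K\<rparr>\<^esub> N) * card N = card K"
proof -
  interpret K: group "G\<lparr>carrier := K\<rparr>" using assms(2) subgroup_imp_group by blast
  have "subgroup N (G\<lparr>carrier := K\<rparr>)" using assms subgroup_incl by blast
  then show ?thesis using K.lagrange by (simp add: Coset.order_def)
qed

lemma subgroup_card:
  assumes "subgroup H G" obtains h where "card H = p ^ h" "h \<le> n"
proof -
  have "card H dvd p ^ n"
    using subgroup_card_dvd[OF assms subgroup_self subgroup.subset[OF assms]] order_eq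
    by (metis dvd_triv_right)
  then show ?thesis using that p divides_primepow_nat by blast
qed

lemma pow_order: "x \<in> carrier G \<Longrightarrow> x [^] (p ^ n) = \<one>"
  using pow_order_eq_1 order_eq by (simp add: Coset.order_def)

text \<open>Serves as the nontrivial centre of a quotient without forming quotients. Conjugation by
  C permutes the cosets of N in K, whose number is a nontrivial power of p, and fixes N itself; a
  second fixed coset N x makes x central modulo N. The last \<open>x [^] (p ^ i)\<close> outside N
  is still central modulo N and has its p-th power in N.\<close>

lemma exists_central_mod:
  assumes C: "subgroup C G" and N: "subgroup N G" and K: "subgroup K G"
    and sub: "N \<subseteq> K" "K \<subseteq> C" "N \<noteq> K"
    and nN: "\<And>g x. g \<in> C \<Longrightarrow> x \<in> N \<Longrightarrow> g \<otimes> x \<otimes> inv g \<in> N"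
    and nK: "\<And>g x. g \<in> C \<Longrightarrow> x \<in> K \<Longrightarrow> g \<otimes> x \<otimes> inv g \<in> K"
  obtains x where "x \<in> K" "x \<notin> N" "\<And>g. g \<in> C \<Longrightarrow> g \<otimes> x \<otimes> inv g \<otimes> inv x \<in> N" "x [^] p \<in> N"
proof -
  have car[simp]: "x \<in> C \<Longrightarrow> x \<in> carrier G" "x \<in> K \<Longrightarrow> x \<in> carrier G" "x \<in> N \<Longrightarrow> x \<in> carrier G" for x
    using subgroup.mem_carrier[OF C] subgroup.mem_carrier[OF K] subgroup.mem_carrier[OF N] by auto
  define E where "E = (\<lambda>x. (\<lambda>u. u \<otimes> x) ` N) ` K"
  define act where "act g U = (\<lambda>u. g \<otimes> u \<otimes> inv g) ` U" for g U
  have actE: "act g ((\<lambda>u. u \<otimes> x) ` N) = (\<lambda>u. u \<otimes> (g \<otimes> x \<otimes> inv g)) ` N" if "g \<in> C" "x \<in> K" for g x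
  proof (intro equalityI subsetI)
    fix y assume "y \<in> act g ((\<lambda>u. u \<otimes> x) ` N)"
    then obtain u where u: "u \<in> N" "y = g \<otimes> (u \<otimes> x) \<otimes> inv g" unfolding act_def by auto
    have "y = (g \<otimes> u \<otimes> inv g) \<otimes> (g \<otimes> x \<otimes> inv g)" using u that by (simp add: word_simps)
    then show "y \<in> (\<lambda>u. u \<otimes> (g \<otimes> x \<otimes> inv g)) ` N" using nN[OF that(1) u(1)] by blast
  next
    fix y assume "y \<in> (\<lambda>u. u \<otimes> (g \<otimes> x \<otimes> inv g)) ` N"
    then obtain u where u: "u \<in> N" "y = u \<otimes> (g \<otimes> x \<otimes> inv g)" by auto
    have "y = g \<otimes> ((inv g \<otimes> u \<otimes> inv (inv g)) \<otimes> x) \<otimes> inv g" using u that by (simp add: word_simps)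
    moreover have "inv g \<otimes> u \<otimes> inv (inv g) \<in> N" by (rule nN[OF subgroup.m_inv_closed[OF C that(1)] u(1)])
    ultimately show "y \<in> act g ((\<lambda>u. u \<otimes> x) ` N)" unfolding act_def by blast
  qed
  have ga: "group_action (G\<lparr>carrier := C\<rparr>) E (\<lambda>g. restrict (act g) E)"
  proof (rule group_action_restrictI)
    show "group (G\<lparr>carrier := C\<rparr>)" using C subgroup_imp_group by blast
    show "act g U \<in> E" if "g \<in> carrier (G\<lparr>carrier := C\<rparr>)" "U \<in> E" for g U
      using that actE nK unfolding E_def by auto
    have sub: "U \<subseteq> carrier G" if "U \<in> E" for U using that unfolding E_def by auto
    show "act \<one>\<^bsub>G\<lparr>carrier := C\<rparr>\<^esub> U = U" if "U \<in> E" for U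
      using sub[OF that] unfolding act_def by (force simp: image_iff)
    show "act (g \<otimes>\<^bsub>G\<lparr>carrier := C\<rparr>\<^esub> h) U = act g (act h U)"
      if "g \<in> carrier (G\<lparr>carrier := C\<rparr>)" "h \<in> carrier (G\<lparr>carrier := C\<rparr>)" "U \<in> E" for g h U
      unfolding act_def image_image
      by (rule image_cong) (use that sub in \<open>auto simp: word_simps subset_iff\<close>)
  qed
  interpret A: group_action "G\<lparr>carrier := C\<rparr>" E "\<lambda>g. restrict (act g) E" by (rule ga)
  obtain k where k: "card C = p ^ k" using subgroup_card C by blast
  have "E = rcosets\<^bsub>G\<lparr>carrier := K\<rparr>\<^esub> N" unfolding E_def RCOSETS_def r_coset_def by auto
  then have cE: "card E * card N = card K" using subgroup_card_dvd[OF N K sub(1)] by simp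
  have finK: "finite K" and finE: "finite E" using subgroup_finite K unfolding E_def by auto
  have "card N < card K" using sub finK by (simp add: psubset_card_mono psubset_eq)
  then have "card E \<noteq> 1" using cE by auto
  moreover obtain i where i: "card K = p ^ i" using subgroup_card K by blast
  then obtain j where "card E = p ^ j" using cE p divides_primepow_nat by (metis dvd_triv_left)
  ultimately have pE: "p dvd card E" by (cases j) auto
  have one: "(\<lambda>u. u \<otimes> \<one>) ` N = N" by (force simp: image_iff)
  have oK: "\<one> \<in> K" by (rule subgroup.one_closed[OF K])
  have NE: "N \<in> E" using one oK unfolding E_def by blast
  obtain U where U: "U \<in> E" "U \<noteq> N" "\<And>g. g \<in> C \<Longrightarrow> act g U = U"
  proof (rule A.p_group_second_fixed_point[OF p _ finE pE NE])
    show "Coset.order (G\<lparr>carrier := C\<rparr>) = p ^ k" using k by (simp add: Coset.order_def)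
    show "restrict (act g) E N = N" if "g \<in> carrier (G\<lparr>carrier := C\<rparr>)" for g
    proof -
      have g: "g \<in> C" using that by simp
      have "act g N = act g ((\<lambda>u. u \<otimes> \<one>) ` N)" using one by simp
      also have "\<dots> = (\<lambda>u. u \<otimes> \<one>) ` N" using actE[OF g oK] g by simp
      finally show ?thesis using one NE by simp
    qed
  qed (use that in auto)
  obtain x where x: "x \<in> K" "U = (\<lambda>u. u \<otimes> x) ` N" using U(1) unfolding E_def by auto
  have xN: "x \<notin> N"
  proof
    assume xN: "x \<in> N"
    have "(\<lambda>u. u \<otimes> x) ` N = N"
    proof (intro equalityI subsetI)
      fix y assume "y \<in> N"
      then have "y = (y \<otimes> inv x) \<otimes> x" "y \<otimes> inv x \<in> N"
        using xN subgroup.m_closed[OF N] subgroup.m_inv_closed[OF N] by (simp_all add: word_simps)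
      then show "y \<in> (\<lambda>u. u \<otimes> x) ` N" by blast
    qed (use xN subgroup.m_closed[OF N] in auto)
    then show False using U x by simp
  qed
  have xc: "g \<otimes> x \<otimes> inv g \<otimes> inv x \<in> N" if g: "g \<in> C" for g
  proof -
    have "\<one> \<otimes> (g \<otimes> x \<otimes> inv g) \<in> (\<lambda>u. u \<otimes> (g \<otimes> x \<otimes> inv g)) ` N" by (rule imageI[OF subgroup.one_closed[OF N]])
    also have "\<dots> = (\<lambda>u. u \<otimes> x) ` N" using actE[OF g x(1)] U(3)[OF g] x(2) by simp
    finally obtain u where "u \<in> N" "g \<otimes> x \<otimes> inv g = u \<otimes> x" using x g by auto
    then show ?thesis using x by (simp add: word_simps)
  qed
  define Pw where "Pw i \<longleftrightarrow> x [^] (p ^ i) \<in> N" for i :: nat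
  have "Pw n" unfolding Pw_def using pow_order x(1) subgroup.one_closed[OF N] by simp
  moreover have "\<not> Pw 0" unfolding Pw_def using xN x by simp
  ultimately have "\<exists>i. \<not> Pw i \<and> Pw (Suc i)"
    using nat_induct[of "\<lambda>i. \<not> Pw i" n] by blast
  then obtain i where i: "\<not> Pw i" "Pw (Suc i)" by blast
  have powc: "g \<otimes> x [^] j \<otimes> inv g \<otimes> inv (x [^] j) \<in> N" if g: "g \<in> C" for g and j :: nat
  proof (induction j)
    case 0 then show ?case using g subgroup.one_closed[OF N] by simp
  next
    case (Suc j)
    have xjC: "x [^] j \<in> C" using subgroup_nat_pow_closed[OF C] x(1) sub(2) by blast
    have "g \<otimes> x [^] Suc j \<otimes> inv g \<otimes> inv (x [^] Suc j)
       = (g \<otimes> x [^] j \<otimes> inv g \<otimes> inv (x [^] j)) \<otimes> (x [^] j \<otimes> (g \<otimes> x \<otimes> inv g \<otimes> inv x) \<otimes> inv (x [^] j))"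
      using g x by (simp add: word_simps)
    then show ?case using Suc nN[OF xjC xc[OF g]] subgroup.m_closed[OF N] by simp
  qed
  show ?thesis
  proof (rule that[of "x [^] (p ^ i)"])
    show "x [^] (p ^ i) \<in> K" by (rule subgroup_nat_pow_closed[OF K x(1)])
    show "x [^] (p ^ i) \<notin> N" using i unfolding Pw_def by simp
    show "(x [^] (p ^ i)) [^] p \<in> N" using i x unfolding Pw_def by (simp add: nat_pow_pow mult.commute)
  qed (rule powc)
qed

end

section \<open>Extending linear characters\<close>

text \<open>A total function of which only the values on H count, so restricting a character changes
  nothing but the set.\<close>

definition lin_char :: "('a, 'b) monoid_scheme \<Rightarrow> 'a set \<Rightarrow> ('a \<Rightarrow> complex) \<Rightarrow> bool" where
  "lin_char G H \<chi> \<longleftrightarrow> (\<forall>x\<in>H. \<chi> x \<noteq> 0) \<and> (\<forall>x\<in>H. \<forall>y\<in>H. \<chi> (x \<otimes>\<^bsub>G\<^esub> y) = \<chi> x * \<chi> y)"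

lemma lin_char_mult: "lin_char G H \<chi> \<Longrightarrow> x \<in> H \<Longrightarrow> y \<in> H \<Longrightarrow> \<chi> (x \<otimes>\<^bsub>G\<^esub> y) = \<chi> x * \<chi> y"
  by (simp add: lin_char_def)

lemma lin_char_nonzero: "lin_char G H \<chi> \<Longrightarrow> x \<in> H \<Longrightarrow> \<chi> x \<noteq> 0"
  by (simp add: lin_char_def)

lemma lin_char_subset: "lin_char G H \<chi> \<Longrightarrow> K \<subseteq> H \<Longrightarrow> lin_char G K \<chi>"
  by (auto simp: lin_char_def)

context group
begin

lemma lin_char_one:
  assumes "lin_char G H \<chi>" "subgroup H G" shows "\<chi> \<one> = 1"
proof -
  have o: "\<one> \<in> H" by (rule subgroup.one_closed[OF assms(2)])
  have "\<chi> \<one> * \<chi> \<one> = \<chi> \<one>" using lin_char_mult[OF assms(1) o o] by simp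
  then show ?thesis using lin_char_nonzero[OF assms(1) o] by simp
qed

lemma lin_char_inv:
  assumes "lin_char G H \<chi>" "subgroup H G" "x \<in> H" shows "\<chi> (inv x) = inverse (\<chi> x)"
proof -
  have "\<chi> x * \<chi> (inv x) = \<chi> (x \<otimes> inv x)"
    using lin_char_mult[OF assms(1,3)] subgroup.m_inv_closed[OF assms(2,3)] by simp
  also have "\<dots> = 1" using lin_char_one[OF assms(1,2)] subgroup.mem_carrier[OF assms(2,3)] by simp
  finally show ?thesis by (simp add: inverse_unique)
qed

lemma lin_char_pow:
  fixes k :: nat
  assumes "lin_char G H \<chi>" "subgroup H G" "x \<in> H" shows "\<chi> (x [^] k) = \<chi> x ^ k"
proof (induction k)
  case 0 show ?case using lin_char_one[OF assms(1,2)] by simp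
next
  case (Suc k)
  then show ?case using lin_char_mult[OF assms(1) subgroup_nat_pow_closed[OF assms(2,3)] assms(3)]
    by (simp add: mult.commute)
qed

lemma lin_char_kernel_subgroup:
  assumes "lin_char G H \<chi>" "subgroup H G" shows "subgroup {x \<in> H. \<chi> x = 1} G"
proof (rule subgroupI)
  show "{x \<in> H. \<chi> x = 1} \<subseteq> carrier G" using subgroup.subset[OF assms(2)] by auto
  show "{x \<in> H. \<chi> x = 1} \<noteq> {}" using subgroup.one_closed[OF assms(2)] lin_char_one[OF assms] by auto
next
  fix a assume "a \<in> {x \<in> H. \<chi> x = 1}"
  then show "inv a \<in> {x \<in> H. \<chi> x = 1}"
    using lin_char_inv[OF assms] subgroup.m_inv_closed[OF assms(2)] by simp
next
  fix a b assume "a \<in> {x \<in> H. \<chi> x = 1}" "b \<in> {x \<in> H. \<chi> x = 1}"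
  then show "a \<otimes> b \<in> {x \<in> H. \<chi> x = 1}"
    using lin_char_mult[OF assms(1)] subgroup.m_closed[OF assms(2)] by simp
qed

text \<open>The fibres over the p complex p-th roots of unity are translated injectively into the
  kernel.\<close>

lemma card_le_lin_char_kernel:
  assumes "lin_char G C \<theta>" "subgroup C G" "finite C" "p > 0" "\<And>g. g \<in> C \<Longrightarrow> \<theta> g ^ p = 1"
  shows "card C \<le> p * card {x \<in> C. \<theta> x = 1}"
proof -
  have car: "x \<in> C \<Longrightarrow> x \<in> carrier G" for x using subgroup.mem_carrier[OF assms(2)] .
  let ?R = "{z::complex. z ^ p = 1}"
  have cR: "card ?R = p" using card_roots_unity_eq assms(4) by auto
  then have fR: "finite ?R" using assms(4) card_ge_0_finite by force
  have "C = (\<Union>z\<in>?R. {x \<in> C. \<theta> x = z})" using assms(5) by auto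
  then have "card C \<le> (\<Sum>z\<in>?R. card {x \<in> C. \<theta> x = z})" using card_UN_le[OF fR] by metis
  also have "\<dots> \<le> (\<Sum>z\<in>?R. card {x \<in> C. \<theta> x = 1})"
  proof (rule sum_mono)
    fix z
    show "card {x \<in> C. \<theta> x = z} \<le> card {x \<in> C. \<theta> x = 1}"
    proof (cases "\<exists>g0\<in>C. \<theta> g0 = z")
      case True
      then obtain g0 where g0: "g0 \<in> C" "\<theta> g0 = z" by auto
      have nz: "z \<noteq> 0" using lin_char_nonzero[OF assms(1)] g0 by auto
      have ig0: "inv g0 \<in> C" "\<theta> (inv g0) = inverse z"
        using subgroup.m_inv_closed[OF assms(2)] lin_char_inv[OF assms(1,2)] g0 by auto
      show ?thesis
      proof (rule card_inj_on_le[of "\<lambda>x. inv g0 \<otimes> x"])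
        show "inj_on (\<lambda>x. inv g0 \<otimes> x) {x \<in> C. \<theta> x = z}"
          using car ig0 by (auto simp: inj_on_def)
        show "(\<lambda>x. inv g0 \<otimes> x) ` {x \<in> C. \<theta> x = z} \<subseteq> {x \<in> C. \<theta> x = 1}"
          using ig0 nz lin_char_mult[OF assms(1)] subgroup.m_closed[OF assms(2)] by auto
        show "finite {x \<in> C. \<theta> x = 1}" using assms(3) by simp
      qed
    next
      case False
      then have "{x \<in> C. \<theta> x = z} = {}" by auto
      then show ?thesis by (simp only: card.empty le0)
    qed
  qed
  also have "\<dots> = p * card {x \<in> C. \<theta> x = 1}" using cR by simp
  finally show ?thesis .
qed

text \<open>The subgroup generated by N and x, provided that x normalises N and the group is finite;
  finiteness is what lets natural exponents suffice.\<close>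

definition cyclic_ext :: "'a set \<Rightarrow> 'a \<Rightarrow> 'a set" where
  "cyclic_ext N x = {n \<otimes> x [^] (i::nat) | n i. n \<in> N}"

lemma cyclic_extI: "n \<in> N \<Longrightarrow> n \<otimes> x [^] (i::nat) \<in> cyclic_ext N x"
  by (auto simp: cyclic_ext_def)

lemma cyclic_ext_supset: "subgroup N G \<Longrightarrow> N \<subseteq> cyclic_ext N x"
  using cyclic_extI[of _ N x 0] by (auto simp: subgroup.mem_carrier)

lemma cyclic_ext_self: "subgroup N G \<Longrightarrow> x \<in> carrier G \<Longrightarrow> x \<in> cyclic_ext N x"
  using cyclic_extI[of \<one> N x 1] by (auto dest: subgroup.one_closed)

lemma cyclic_ext_subset: "subgroup N G \<Longrightarrow> subgroup H G \<Longrightarrow> N \<subseteq> H \<Longrightarrow> x \<in> H \<Longrightarrow> cyclic_ext N x \<subseteq> H"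
  by (auto simp: cyclic_ext_def intro!: subgroup.m_closed subgroup_nat_pow_closed)

text \<open>Here c is the prescribed value at x. Compatibility on the powers of x inside N makes the
  rule u x^i \<mapsto> \<chi>(u) c^i well defined, and invariance of \<chi> under x makes it
  multiplicative.\<close>

lemma extend_to_cyclic_ext:
  assumes fin: "finite (carrier G)" and N: "subgroup N G" and x: "x \<in> carrier G"
    and norm: "\<And>u. u \<in> N \<Longrightarrow> x \<otimes> u \<otimes> inv x \<in> N"
    and \<chi>: "lin_char G N \<chi>" and inv\<chi>: "\<And>u. u \<in> N \<Longrightarrow> \<chi> (x \<otimes> u \<otimes> inv x) = \<chi> u"
    and c: "c \<noteq> 0" "\<And>d::nat. x [^] d \<in> N \<Longrightarrow> \<chi> (x [^] d) = c ^ d"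
  obtains \<chi>' where "subgroup (cyclic_ext N x) G" "lin_char G (cyclic_ext N x) \<chi>'"
    "\<And>u. u \<in> N \<Longrightarrow> \<chi>' u = \<chi> u" "\<chi>' x = c"
proof -
  note car[simp] = subgroup.mem_carrier[OF N]
  note [simp] = x subgroup.m_closed[OF N] subgroup.m_inv_closed[OF N] subgroup.one_closed[OF N]
  have pn: "x [^] i \<otimes> u \<otimes> inv (x [^] i) \<in> N \<and> \<chi> (x [^] i \<otimes> u \<otimes> inv (x [^] i)) = \<chi> u"
    if "u \<in> N" for u and i :: nat
  proof (induction i)
    case 0 then show ?case using that by simp
  next
    case (Suc i)
    have "x [^] Suc i \<otimes> u \<otimes> inv (x [^] Suc i) = x \<otimes> (x [^] i \<otimes> u \<otimes> inv (x [^] i)) \<otimes> inv x"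
      using that unfolding nat_pow_Suc2[OF x] by (simp add: word_simps)
    then show ?case using Suc norm inv\<chi> by simp
  qed
  have ml: "(u \<otimes> x [^] i) \<otimes> (v \<otimes> x [^] j) = (u \<otimes> (x [^] i \<otimes> v \<otimes> inv (x [^] i))) \<otimes> x [^] (i + j)"
    if "u \<in> N" "v \<in> N" for u v and i j :: nat
    using that by (simp add: word_simps flip: nat_pow_mult)
  define e where "e = Coset.order G"
  have e: "e > 0" "x [^] e = \<one>" using fin pow_order_eq_1[OF x] order_gt_0_iff_finite e_def by auto
  have sub: "subgroup (cyclic_ext N x) G"
  proof (rule subgroupI)
    show "cyclic_ext N x \<subseteq> carrier G" by (auto simp: cyclic_ext_def)
    show "cyclic_ext N x \<noteq> {}" using cyclic_ext_self[OF N x] by auto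
  next
    fix a assume "a \<in> cyclic_ext N x"
    then obtain u i where u: "u \<in> N" "a = u \<otimes> x [^] (i::nat)" by (auto simp: cyclic_ext_def)
    \<comment> \<open>A natural exponent for the inverse of \<open>x [^] i\<close>, because
      \<open>k + i = e * i\<close>.\<close>
    define k where "k = i * (e - 1)"
    have "x [^] k \<otimes> x [^] i = x [^] (e * i)"
    proof -
      have "k + i = i * (e - 1 + 1)" unfolding k_def by (simp only: distrib_left mult_1_right)
      then have "k + i = e * i" using e(1) by simp
      then show ?thesis by (simp add: nat_pow_mult)
    qed
    also have "\<dots> = \<one>" using e by (simp flip: nat_pow_pow)
    finally have "inv (x [^] i) = x [^] k" by (intro inv_equality) auto
    then have "inv a = (x [^] k \<otimes> inv u \<otimes> inv (x [^] k)) \<otimes> x [^] k" using u by (simp add: word_simps)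
    then show "inv a \<in> cyclic_ext N x" using pn[of "inv u" k] u by (auto intro!: cyclic_extI)
  next
    fix a b assume "a \<in> cyclic_ext N x" "b \<in> cyclic_ext N x"
    then obtain u i v j where u: "u \<in> N" "a = u \<otimes> x [^] (i::nat)" "v \<in> N" "b = v \<otimes> x [^] (j::nat)"
      by (auto simp: cyclic_ext_def)
    have "u \<otimes> (x [^] i \<otimes> v \<otimes> inv (x [^] i)) \<in> N"
      using pn[OF u(3)] u(1) subgroup.m_closed[OF N] by blast
    then show "a \<otimes> b \<in> cyclic_ext N x" unfolding u(2,4) ml[OF u(1,3)] by (rule cyclic_extI)
  qed
  have wd: "\<chi> u * c ^ i = \<chi> v * c ^ j" if "u \<in> N" "v \<in> N" "u \<otimes> x [^] i = v \<otimes> x [^] j" "i \<le> j" for u v and i j :: nat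
  proof -
    have "x [^] j = x [^] (j - i) \<otimes> x [^] i" using that(4) by (simp add: nat_pow_mult)
    then have "u \<otimes> x [^] i = (v \<otimes> x [^] (j - i)) \<otimes> x [^] i" using that by (simp add: m_assoc)
    then have uv: "u = v \<otimes> x [^] (j - i)" using that by simp
    then have "x [^] (j - i) = inv v \<otimes> u" using that by (simp add: word_simps)
    then have xN: "x [^] (j - i) \<in> N" using that by simp
    have "\<chi> u = \<chi> v * c ^ (j - i)" using uv lin_char_mult[OF \<chi> that(2) xN] c(2)[OF xN] by simp
    then show ?thesis using that(4) by (simp flip: power_add)
  qed
  have wd': "\<chi> u * c ^ i = \<chi> v * c ^ j" if "u \<in> N" "v \<in> N" "u \<otimes> x [^] i = v \<otimes> x [^] j" for u v and i j :: nat
    using wd[OF that] wd[OF that(2,1) that(3)[symmetric]] by (cases "i \<le> j") auto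
  define \<chi>' where "\<chi>' a = (THE v. \<exists>u\<in>N. \<exists>i::nat. a = u \<otimes> x [^] i \<and> v = \<chi> u * c ^ i)" for a
  have \<chi>': "\<chi>' (u \<otimes> x [^] i) = \<chi> u * c ^ i" if "u \<in> N" for u and i :: nat
    unfolding \<chi>'_def
  proof (rule the_equality)
    show "\<exists>w\<in>N. \<exists>j::nat. u \<otimes> x [^] i = w \<otimes> x [^] j \<and> \<chi> u * c ^ i = \<chi> w * c ^ j" using that by blast
  next
    fix v assume "\<exists>w\<in>N. \<exists>j::nat. u \<otimes> x [^] i = w \<otimes> x [^] j \<and> v = \<chi> w * c ^ j"
    then obtain w and j :: nat where w: "w \<in> N" "u \<otimes> x [^] i = w \<otimes> x [^] j" "v = \<chi> w * c ^ j" by blast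
    show "v = \<chi> u * c ^ i" using wd'[OF \<open>u \<in> N\<close> w(1,2)] w(3) by simp
  qed
  have lc: "lin_char G (cyclic_ext N x) \<chi>'"
    unfolding lin_char_def
  proof (intro conjI ballI)
    fix a assume "a \<in> cyclic_ext N x"
    then obtain u and i :: nat where u: "u \<in> N" "a = u \<otimes> x [^] i" by (auto simp: cyclic_ext_def)
    then show "\<chi>' a \<noteq> 0" using \<chi>'[OF u(1)] c(1) lin_char_nonzero[OF \<chi> u(1)] by simp
  next
    fix a b assume "a \<in> cyclic_ext N x" "b \<in> cyclic_ext N x"
    then obtain u i v j where u: "u \<in> N" "a = u \<otimes> x [^] (i::nat)" "v \<in> N" "b = v \<otimes> x [^] (j::nat)"
      by (auto simp: cyclic_ext_def)
    have "\<chi>' (a \<otimes> b) = \<chi> (u \<otimes> (x [^] i \<otimes> v \<otimes> inv (x [^] i))) * c ^ (i + j)"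
      unfolding u(2,4) ml[OF u(1,3)]
      by (rule \<chi>') (use pn[OF u(3)] u(1) subgroup.m_closed[OF N] in blast)
    also have "\<dots> = \<chi> u * \<chi> v * c ^ (i + j)" using u(1) pn[OF u(3), of i] lin_char_mult[OF \<chi>] by simp
    also have "\<dots> = \<chi>' a * \<chi>' b" unfolding u(2,4) \<chi>'[OF u(1)] \<chi>'[OF u(3)] by (simp add: power_add)
    finally show "\<chi>' (a \<otimes> b) = \<chi>' a * \<chi>' b" .
  qed
  show ?thesis
  proof (rule that[OF sub lc])
    show "\<chi>' u = \<chi> u" if "u \<in> N" for u using \<chi>'[OF that, of 0] that by simp
    show "\<chi>' x = c" using \<chi>'[of \<one> 1] lin_char_one[OF \<chi> N] by simp
  qed
qed

text \<open>Conjugation by g multiplies x by its commutator with g, which lies in N; the extended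
  character is therefore preserved as soon as \<chi> is 1 on that commutator.\<close>

lemma cyclic_ext_invariant:
  assumes N: "subgroup N G" and C: "subgroup C G" and "N \<subseteq> C" and x: "x \<in> C"
    and norm: "\<And>g u. g \<in> C \<Longrightarrow> u \<in> N \<Longrightarrow> g \<otimes> u \<otimes> inv g \<in> N"
    and inv\<chi>: "\<And>g u. g \<in> C \<Longrightarrow> u \<in> N \<Longrightarrow> \<chi> (g \<otimes> u \<otimes> inv g) = \<chi> u"
    and sub: "subgroup (cyclic_ext N x) G" and \<chi>': "lin_char G (cyclic_ext N x) \<chi>'"
    and eq: "\<And>u. u \<in> N \<Longrightarrow> \<chi>' u = \<chi> u"
    and g: "g \<in> C" and cN: "g \<otimes> x \<otimes> inv g \<otimes> inv x \<in> N" and a: "a \<in> cyclic_ext N x"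
  shows "g \<otimes> a \<otimes> inv g \<in> cyclic_ext N x"
    and "\<chi> (g \<otimes> x \<otimes> inv g \<otimes> inv x) = 1 \<Longrightarrow> \<chi>' (g \<otimes> a \<otimes> inv g) = \<chi>' a"
proof -
  note [simp] = subgroup.mem_carrier[OF N] subgroup.mem_carrier[OF C] g x
  obtain u i where u: "u \<in> N" "a = u \<otimes> x [^] (i::nat)" using a by (auto simp: cyclic_ext_def)
  have xE: "x \<in> cyclic_ext N x" using cyclic_ext_self[OF N] by simp
  have NE: "N \<subseteq> cyclic_ext N x" by (rule cyclic_ext_supset[OF N])
  define w where "w = g \<otimes> x \<otimes> inv g"
  have weq: "w = (g \<otimes> x \<otimes> inv g \<otimes> inv x) \<otimes> x" unfolding w_def by (simp add: word_simps)
  have wE: "w \<in> cyclic_ext N x" using weq subgroup.m_closed[OF sub _ xE] cN NE by auto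
  have ga: "g \<otimes> a \<otimes> inv g = (g \<otimes> u \<otimes> inv g) \<otimes> w [^] i"
    unfolding w_def conj_pow[symmetric, OF subgroup.mem_carrier[OF C g] subgroup.mem_carrier[OF C x]]
    using u by (simp add: word_simps)
  have gu: "g \<otimes> u \<otimes> inv g \<in> cyclic_ext N x" using norm[OF g u(1)] NE by auto
  have wi: "w [^] i \<in> cyclic_ext N x" by (rule subgroup_nat_pow_closed[OF sub wE])
  show "g \<otimes> a \<otimes> inv g \<in> cyclic_ext N x" using ga subgroup.m_closed[OF sub gu wi] by simp
  assume "\<chi> (g \<otimes> x \<otimes> inv g \<otimes> inv x) = 1"
  then have "\<chi>' w = \<chi>' x" using weq lin_char_mult[OF \<chi>' _ xE] cN NE eq by auto
  moreover have "\<chi>' (w [^] i) = \<chi>' w ^ i" "\<chi>' (x [^] i) = \<chi>' x ^ i"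
    using lin_char_pow[OF \<chi>' sub] wE xE by auto
  moreover have "\<chi>' a = \<chi>' u * \<chi>' (x [^] i)"
    using u lin_char_mult[OF \<chi>'] NE subgroup_nat_pow_closed[OF sub xE] by auto
  moreover have "\<chi>' (g \<otimes> u \<otimes> inv g) = \<chi>' u" using eq norm[OF g u(1)] inv\<chi>[OF g u(1)] u by simp
  ultimately show "\<chi>' (g \<otimes> a \<otimes> inv g) = \<chi>' a" using ga lin_char_mult[OF \<chi>' gu wi] by simp
qed

text \<open>From [gh,x] = g[h,x]g^-1 [g,x], where invariance of \<chi> removes the conjugation by g.
  The kernel of this character is the stabiliser of an extension of \<chi> to x.\<close>

lemma commutator_lin_char:
  assumes C: "subgroup C G" and N: "subgroup N G" and x: "x \<in> carrier G"
    and inv\<chi>: "\<And>g u. g \<in> C \<Longrightarrow> u \<in> N \<Longrightarrow> g \<otimes> u \<otimes> inv g \<in> N \<and> \<chi> (g \<otimes> u \<otimes> inv g) = \<chi> u"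
    and \<chi>: "lin_char G N \<chi>" and xN: "\<And>g. g \<in> C \<Longrightarrow> g \<otimes> x \<otimes> inv g \<otimes> inv x \<in> N"
  shows "lin_char G C (\<lambda>g. \<chi> (g \<otimes> x \<otimes> inv g \<otimes> inv x))"
  unfolding lin_char_def
proof (intro conjI ballI)
  fix g assume "g \<in> C" then show "\<chi> (g \<otimes> x \<otimes> inv g \<otimes> inv x) \<noteq> 0" using lin_char_nonzero[OF \<chi>] xN by simp
next
  fix g h assume gh: "g \<in> C" "h \<in> C"
  have [simp]: "g \<in> carrier G" "h \<in> carrier G" using gh subgroup.mem_carrier[OF C] by auto
  have "(g \<otimes> h) \<otimes> x \<otimes> inv (g \<otimes> h) \<otimes> inv x
     = (g \<otimes> (h \<otimes> x \<otimes> inv h \<otimes> inv x) \<otimes> inv g) \<otimes> (g \<otimes> x \<otimes> inv g \<otimes> inv x)"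
    using x by (simp add: word_simps)
  then show "\<chi> (g \<otimes> h \<otimes> x \<otimes> inv (g \<otimes> h) \<otimes> inv x) = \<chi> (g \<otimes> x \<otimes> inv g \<otimes> inv x) * \<chi> (h \<otimes> x \<otimes> inv h \<otimes> inv x)"
    using lin_char_mult[OF \<chi>] inv\<chi>[OF gh(1) xN[OF gh(2)]] xN[OF gh(1)] by simp
qed

end

lemma complex_nth_root_exists: "p > 0 \<Longrightarrow> \<exists>c::complex. c ^ p = z"
proof (cases "z = 0")
  case True assume "p > 0" then show ?thesis using True by (intro exI[of _ 0]) simp
next
  case False assume "p > 0"
  then have "card {w. w ^ p = z} = p" using card_nth_roots[OF False] by simp
  then show ?thesis using \<open>p > 0\<close> by (metis (mono_tags, lifting) card.empty empty_Collect_eq less_irrefl)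
qed

context p_group
begin

lemma proper_subgroup_card:
  assumes "subgroup N G" "subgroup K G" "N \<subseteq> K" "N \<noteq> K"
  shows "p * card N \<le> card K"
proof -
  let ?i = "card (rcosets\<^bsub>G\<lparr>carrier := K\<rparr>\<^esub> N)"
  have e: "?i * card N = card K" by (rule subgroup_card_dvd[OF assms(1-3)])
  obtain k where "card K = p ^ k" using subgroup_card[OF assms(2)] by auto
  then obtain j where j: "?i = p ^ j" using e p divides_primepow_nat by (metis dvd_triv_left)
  have "card N < card K" using assms(3,4) subgroup_finite[OF assms(2)] by (simp add: psubset_card_mono psubset_eq)
  then have "j \<noteq> 0" using e j by (intro notI) simp
  then have "p \<le> p ^ j" using self_le_power[of p j] prime_ge_1_nat[OF p] by simp
  then show ?thesis using e j by (metis mult_le_mono1)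
qed

text \<open>By Bezout, if p did not divide d then x would be a product of powers of x^p and x^d, up
  to inverses.\<close>

lemma pow_mem_iff:
  fixes d :: nat
  assumes N: "subgroup N G" and x: "x \<in> carrier G" "x \<notin> N" "x [^] p \<in> N" and d: "x [^] d \<in> N"
  shows "p dvd d"
proof (rule ccontr)
  assume nd: "\<not> p dvd d"
  then have "d \<noteq> 0" by (intro notI) simp
  then obtain a b where "d * a = p * b + gcd d p" using bezout_nat by blast
  moreover have "gcd d p = 1" using nd p by (metis coprime_iff_gcd_eq_1 coprime_commute prime_imp_coprime)
  ultimately have ab: "d * a = p * b + 1" by simp
  have "(x [^] d) [^] a = x [^] (p * b + 1)" using x(1) ab by (simp add: nat_pow_pow)
  also have "\<dots> = (x [^] p) [^] b \<otimes> x" using x(1) by (simp add: nat_pow_pow)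
  finally have eq: "x = inv ((x [^] p) [^] b) \<otimes> (x [^] d) [^] a" using x(1) by (simp add: word_simps)
  have "inv ((x [^] p) [^] b) \<otimes> (x [^] d) [^] a \<in> N"
    by (intro subgroup.m_closed[OF N subgroup.m_inv_closed[OF N subgroup_nat_pow_closed[OF N x(3)]]
      subgroup_nat_pow_closed[OF N d]])
  then show False using eq x(2) by simp
qed

text \<open>The bound \<open>|C| |N| \<le> |H|\<^sup>2\<close> says that the representation of \<open>C\<close> induced from \<open>\<mu>\<close> has degree
  at most the square root of the index of \<open>N\<close>.\<close>
theorem extend_invariant_char:
  assumes "subgroup C G" "subgroup N G" "N \<subseteq> C" "lin_char G N \<chi>"
    and "\<And>g u. g \<in> C \<Longrightarrow> u \<in> N \<Longrightarrow> g \<otimes> u \<otimes> inv g \<in> N \<and> \<chi> (g \<otimes> u \<otimes> inv g) = \<chi> u"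
  shows "\<exists>H \<mu>. subgroup H G \<and> N \<subseteq> H \<and> H \<subseteq> C \<and> lin_char G H \<mu> \<and> (\<forall>u\<in>N. \<mu> u = \<chi> u)
      \<and> card C * card N \<le> card H ^ 2"
  using assms
proof (induction "card C - card N" arbitrary: C N \<chi> rule: less_induct)
  case less
  note C = less.prems(1) and N = less.prems(2) and NC = less.prems(3) and \<chi> = less.prems(4)
    and inv\<chi> = less.prems(5)
  show ?case
  proof (cases "N = C")
    case True
    then show ?thesis using C \<chi> by (intro exI[of _ C] exI[of _ \<chi>]) (simp add: power2_eq_square)
  next
    case False
    have nC: "g \<otimes> x \<otimes> inv g \<in> C" if "g \<in> C" "x \<in> C" for g x
      using that by (intro subgroup.m_closed[OF C] subgroup.m_inv_closed[OF C])
    obtain x where x: "x \<in> C" "x \<notin> N" "\<And>g. g \<in> C \<Longrightarrow> g \<otimes> x \<otimes> inv g \<otimes> inv x \<in> N" "x [^] p \<in> N"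
      using exists_central_mod[OF C N C NC order_refl False] inv\<chi> nC by metis
    have xc[simp]: "x \<in> carrier G" using subgroup.mem_carrier[OF C x(1)] .
    have p0: "p > 0" using p prime_gt_0_nat by simp
    \<comment> \<open>Any p-th root of the value at \<open>x [^] p\<close> is an admissible value at
      x: only multiples of p give powers of x in N.\<close>
    obtain c where c: "c ^ p = \<chi> (x [^] p)" using complex_nth_root_exists[OF p0] by blast
    have c0: "c \<noteq> 0" using c lin_char_nonzero[OF \<chi> x(4)] p0 by (metis power_eq_0_iff)
    have cd: "\<chi> (x [^] d) = c ^ d" if "x [^] d \<in> N" for d :: nat
    proof -
      obtain k where k: "d = p * k" using pow_mem_iff[OF N xc x(2) x(4) \<open>x [^] d \<in> N\<close>] by blast
      have "\<chi> (x [^] d) = \<chi> ((x [^] p) [^] k)" using k by (simp add: nat_pow_pow)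
      also have "\<dots> = \<chi> (x [^] p) ^ k" by (rule lin_char_pow[OF \<chi> N x(4)])
      finally show ?thesis using c k by (simp add: power_mult)
    qed
    obtain \<chi>' where M: "subgroup (cyclic_ext N x) G" and \<chi>': "lin_char G (cyclic_ext N x) \<chi>'"
        and eq: "\<And>u. u \<in> N \<Longrightarrow> \<chi>' u = \<chi> u" and xc': "\<chi>' x = c"
      using extend_to_cyclic_ext[OF finite_carrier N xc _ \<chi> _ c0 cd] inv\<chi>[OF x(1)] by metis
    let ?M = "cyclic_ext N x"
    have NM: "N \<subseteq> ?M" by (rule cyclic_ext_supset[OF N])
    have xM: "x \<in> ?M" by (rule cyclic_ext_self[OF N xc])
    have MC: "?M \<subseteq> C" by (rule cyclic_ext_subset[OF N C NC x(1)])
    define \<theta> where "\<theta> g = \<chi> (g \<otimes> x \<otimes> inv g \<otimes> inv x)" for g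
    have \<theta>: "lin_char G C \<theta>" unfolding \<theta>_def by (rule commutator_lin_char[OF C N xc inv\<chi> \<chi> x(3)])
    \<comment> \<open>\<open>C'\<close> is the stabiliser of the extended character in C. Passing to
      it divides the order of C by at most p, while adjoining x multiplies the order of N by at
      least p, so the product of the two orders does not drop and the bound survives the
      induction.\<close>
    define C' where "C' = {g \<in> C. \<theta> g = 1}"
    have C': "subgroup C' G" unfolding C'_def by (rule lin_char_kernel_subgroup[OF \<theta> C])
    \<comment> \<open>The conjugate of x has value \<open>\<theta> g * c\<close>, and its p-th power
      is a conjugate of \<open>x [^] p\<close>, on which \<chi> is invariant.\<close>
    have \<theta>p: "\<theta> g ^ p = 1" if g: "g \<in> C" for g
    proof -
      have gc[simp]: "g \<in> carrier G" using subgroup.mem_carrier[OF C g] .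
      have "g \<otimes> x \<otimes> inv g = (g \<otimes> x \<otimes> inv g \<otimes> inv x) \<otimes> x" by (simp add: word_simps)
      moreover have cM: "g \<otimes> x \<otimes> inv g \<otimes> inv x \<in> ?M" using x(3)[OF g] NM by blast
      ultimately have gM: "g \<otimes> x \<otimes> inv g \<in> ?M" and e1: "\<chi>' (g \<otimes> x \<otimes> inv g) = \<theta> g * c"
        using subgroup.m_closed[OF M cM xM] lin_char_mult[OF \<chi>' cM xM] eq[OF x(3)[OF g]] xc' \<theta>_def by simp_all
      have "\<chi>' (g \<otimes> x \<otimes> inv g) ^ p = \<chi>' (g \<otimes> x [^] p \<otimes> inv g)"
        using lin_char_pow[OF \<chi>' M gM] conj_pow[OF gc xc] by simp
      also have "\<dots> = c ^ p" using inv\<chi>[OF g x(4)] eq c by simp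
      finally show ?thesis using e1 c0 by (simp add: power_mult_distrib)
    qed
    have cC: "card C \<le> p * card C'"
      unfolding C'_def by (rule card_le_lin_char_kernel[OF \<theta> C subgroup_finite[OF C] p0 \<theta>p])
    \<comment> \<open>For u in N the commutator is u times an x-conjugate of its inverse, and \<chi>
      does not see the conjugation.\<close>
    have NC': "N \<subseteq> C'"
    proof
      fix u assume u: "u \<in> N"
      have [simp]: "u \<in> carrier G" using subgroup.mem_carrier[OF N u] .
      have iu: "inv u \<in> N" by (rule subgroup.m_inv_closed[OF N u])
      have "u \<otimes> x \<otimes> inv u \<otimes> inv x = u \<otimes> (x \<otimes> inv u \<otimes> inv x)" by (simp add: word_simps)
      then have "\<theta> u = \<chi> u * \<chi> (inv u)"
        unfolding \<theta>_def using lin_char_mult[OF \<chi> u] inv\<chi>[OF x(1) iu] by simp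
      then have "\<theta> u = 1" using lin_char_inv[OF \<chi> N u] lin_char_nonzero[OF \<chi> u] by simp
      then show "u \<in> C'" using u NC unfolding C'_def by auto
    qed
    have "\<theta> x = 1" unfolding \<theta>_def using lin_char_one[OF \<chi> N] by (simp add: word_simps)
    then have MC': "?M \<subseteq> C'" using x(1) C'_def by (intro cyclic_ext_subset[OF N C' NC']) auto
    have inv': "g \<otimes> u \<otimes> inv g \<in> ?M \<and> \<chi>' (g \<otimes> u \<otimes> inv g) = \<chi>' u" if g: "g \<in> C'" and u: "u \<in> ?M" for g u
    proof -
      have gC: "g \<in> C" and g1: "\<chi> (g \<otimes> x \<otimes> inv g \<otimes> inv x) = 1" using g C'_def \<theta>_def by auto
      show ?thesis
        using cyclic_ext_invariant[OF N C NC x(1) _ _ M \<chi>' eq gC x(3)[OF gC] u] inv\<chi> g1 by blast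
    qed
    have pN: "p * card N \<le> card ?M" using x(2) xM by (intro proper_subgroup_card[OF N M NM]) auto
    have "card ?M \<le> card C'" "card C' \<le> card C"
      using MC' subgroup_finite[OF C] subgroup_finite[OF C'] by (auto intro!: card_mono simp: C'_def)
    moreover have "card N > 0" using subgroup_finite[OF N] subgroup.one_closed[OF N] by (metis card_gt_0_iff empty_iff)
    then have "card N < p * card N" using p prime_gt_1_nat by simp
    ultimately have "card C' - card ?M < card C - card N" using pN by linarith
    from less.hyps[OF this C' M MC' \<chi>' inv'] obtain H \<mu> where H: "subgroup H G" "?M \<subseteq> H" "H \<subseteq> C'" "lin_char G H \<mu>"
      "\<forall>u\<in>?M. \<mu> u = \<chi>' u" "card C' * card ?M \<le> card H ^ 2" by blast
    have "card C * card N \<le> p * card C' * card N" using cC by simp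
    also have "\<dots> = card C' * (p * card N)" by simp
    also have "\<dots> \<le> card C' * card ?M" using pN by simp
    finally have "card C * card N \<le> card H ^ 2" using H(6) by linarith
    then show ?thesis using H NM eq C'_def by (intro exI[of _ H] exI[of _ \<mu>]) auto
  qed
qed

end

section \<open>Induced representations and direct sums\<close>

lemma GL_simps [simp]:
  "carrier (GL m) = {A. A \<in> carrier_mat m m \<and> invertible_mat A}" "A \<otimes>\<^bsub>GL m\<^esub> B = A * B" "\<one>\<^bsub>GL m\<^esub> = 1\<^sub>m m"
  by (simp_all add: GL_def)

lemma (in group) hom_GLI:
  assumes "\<And>g. g \<in> carrier G \<Longrightarrow> \<rho> g \<in> carrier_mat m m"
    and "\<And>g h. g \<in> carrier G \<Longrightarrow> h \<in> carrier G \<Longrightarrow> \<rho> (g \<otimes> h) = \<rho> g * \<rho> h"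
    and "\<rho> \<one> = 1\<^sub>m m"
  shows "\<rho> \<in> hom G (GL m)"
proof (rule homI)
  fix g assume g: "g \<in> carrier G"
  have "\<rho> g * \<rho> (inv g) = 1\<^sub>m m" "\<rho> (inv g) * \<rho> g = 1\<^sub>m m"
    using g assms(2)[of g "inv g"] assms(2)[of "inv g" g] assms(3) by simp_all
  then show "\<rho> g \<in> carrier (GL m)"
    using assms(1)[OF g] assms(1)[of "inv g"] g
    by (auto simp: invertible_mat_def inverts_mat_def intro!: exI[of _ "\<rho> (inv g)"])
qed (use assms in simp)

text \<open>An invertible idempotent matrix is the identity; this spares a proof that
  \<open>GL m\<close> is a group.\<close>

lemma (in group) hom_GL_one:
  assumes "\<rho> \<in> hom G (GL m)" shows "\<rho> \<one> = 1\<^sub>m m"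
proof -
  define A where "A = \<rho> \<one>"
  have A: "A * A = A" "A \<in> carrier_mat m m" "invertible_mat A"
    using hom_mult[OF assms, of \<one> \<one>] hom_in_carrier[OF assms, of \<one>] by (auto simp: A_def)
  obtain B where B: "A * B = 1\<^sub>m m" "B * A = 1\<^sub>m (dim_row B)"
    using A unfolding invertible_mat_def inverts_mat_def by auto
  have "dim_col (A * B) = dim_col (1\<^sub>m m :: complex mat)" "dim_col (B * A) = dim_col (1\<^sub>m (dim_row B) :: complex mat)"
    using B by simp_all
  then have Bc: "B \<in> carrier_mat m m" using A(2) by auto
  have "A = (B * A) * A" using B Bc A(2) by simp
  also have "\<dots> = B * (A * A)" using Bc A(2) by simp
  also have "\<dots> = 1\<^sub>m m" using A(1) B(2) Bc by simp
  finally show ?thesis by (simp add: A_def)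
qed

lemma (in group) hom_GL_kernel:
  assumes "\<rho> \<in> hom G (GL m)"
  shows "subgroup {g \<in> carrier G. \<rho> g = 1\<^sub>m m} G"
    and "\<And>g x. g \<in> carrier G \<Longrightarrow> x \<in> {g \<in> carrier G. \<rho> g = 1\<^sub>m m} \<Longrightarrow> g \<otimes> x \<otimes> inv g \<in> {g \<in> carrier G. \<rho> g = 1\<^sub>m m}"
    and "{g \<in> carrier G. \<rho> g = 1\<^sub>m m} = {\<one>} \<Longrightarrow> inj_on \<rho> (carrier G)"
proof -
  have c: "\<rho> g \<in> carrier_mat m m" if "g \<in> carrier G" for g using hom_in_carrier[OF assms that] by simp
  have mlt: "\<rho> (g \<otimes> h) = \<rho> g * \<rho> h" if "g \<in> carrier G" "h \<in> carrier G" for g h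
    using hom_mult[OF assms that] by simp
  have inv: "\<rho> g * \<rho> (inv g) = 1\<^sub>m m" if "g \<in> carrier G" for g
    using mlt[of g "inv g"] hom_GL_one[OF assms] that by simp
  show "subgroup {g \<in> carrier G. \<rho> g = 1\<^sub>m m} G"
  proof (rule subgroupI)
    show "{g \<in> carrier G. \<rho> g = 1\<^sub>m m} \<noteq> {}" using hom_GL_one[OF assms] by auto
    show "inv a \<in> {g \<in> carrier G. \<rho> g = 1\<^sub>m m}" if "a \<in> {g \<in> carrier G. \<rho> g = 1\<^sub>m m}" for a
      using that inv[of a] c[of "inv a"] by simp
    show "a \<otimes> b \<in> {g \<in> carrier G. \<rho> g = 1\<^sub>m m}" if "a \<in> {g \<in> carrier G. \<rho> g = 1\<^sub>m m}" "b \<in> {g \<in> carrier G. \<rho> g = 1\<^sub>m m}" for a b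
      using that mlt[of a b] by simp
  qed auto
  show "g \<otimes> x \<otimes> inv g \<in> {g \<in> carrier G. \<rho> g = 1\<^sub>m m}" if "g \<in> carrier G" "x \<in> {g \<in> carrier G. \<rho> g = 1\<^sub>m m}" for g x
    using that inv[of g] c[of g] by (simp add: mlt)
  assume ker: "{g \<in> carrier G. \<rho> g = 1\<^sub>m m} = {\<one>}"
  show "inj_on \<rho> (carrier G)"
  proof (rule inj_onI)
    fix g h assume gh: "g \<in> carrier G" "h \<in> carrier G" "\<rho> g = \<rho> h"
    have "\<rho> (g \<otimes> inv h) = 1\<^sub>m m" using gh inv[of h] by (simp add: mlt)
    then have "g \<otimes> inv h = \<one>" using ker gh by (metis (mono_tags, lifting) inv_closed m_closed mem_Collect_eq singletonD)
    then show "g = h" using gh by (simp add: inv_solve_right')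
  qed
qed

text \<open>A representation of degree m lying over \<chi>. Positivity of m makes \<chi> readable
  from the scalar matrices and makes sums of degrees positive.\<close>

definition scalar_rep :: "('a, 'b) monoid_scheme \<Rightarrow> 'a set \<Rightarrow> ('a \<Rightarrow> complex) \<Rightarrow> nat \<Rightarrow> bool" where
  "scalar_rep G E \<chi> m \<longleftrightarrow> m > 0 \<and> (\<exists>\<rho>. \<rho> \<in> hom G (GL m) \<and> (\<forall>z\<in>E. \<rho> z = \<chi> z \<cdot>\<^sub>m 1\<^sub>m m))"

text \<open>The inverse of x lies in exactly one right coset of H. Stated for
  \<open>t i \<otimes> x\<close> this says that each column of an induced matrix has exactly one
  nonzero entry.\<close>

lemma (in group) transversal:
  assumes fin: "finite (carrier G)" and H: "subgroup H G"
  obtains t where "\<And>i. i < card (rcosets H) \<Longrightarrow> t i \<in> carrier G"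
    "\<And>x. x \<in> carrier G \<Longrightarrow> \<exists>!i. i < card (rcosets H) \<and> t i \<otimes> x \<in> H"
proof -
  let ?m = "card (rcosets H)"
  have finR: "finite (rcosets H)" using fin by (simp add: RCOSETS_def)
  then obtain b where b: "bij_betw b {..<?m} (rcosets H)"
    using ex_bij_betw_nat_finite by (metis atLeast0LessThan)
  have "\<forall>i<?m. \<exists>u. u \<in> carrier G \<and> b i = H #> u"
  proof (intro allI impI)
    fix i assume "i < ?m"
    then have "b i \<in> rcosets H" using bij_betwE[OF b] by simp
    then show "\<exists>u. u \<in> carrier G \<and> b i = H #> u" unfolding RCOSETS_def by blast
  qed
  then obtain t where t: "\<And>i. i < ?m \<Longrightarrow> t i \<in> carrier G \<and> b i = H #> t i" by metis
  have iff: "t i \<otimes> x \<in> H \<longleftrightarrow> inv x \<in> b i" if "i < ?m" "x \<in> carrier G" for i x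
  proof -
    have ti: "t i \<in> carrier G" "b i = H #> t i" using t that by auto
    show ?thesis
    proof
      assume h: "t i \<otimes> x \<in> H"
      have "inv x = inv (t i \<otimes> x) \<otimes> t i" using ti that by (simp add: word_simps)
      then show "inv x \<in> b i" using subgroup.m_inv_closed[OF H h] ti by (auto simp: r_coset_def)
    next
      assume "inv x \<in> b i"
      then obtain h where h: "h \<in> H" "inv x = h \<otimes> t i" using ti by (auto simp: r_coset_def)
      have hc: "h \<in> carrier G" using subgroup.mem_carrier[OF H h(1)] .
      have "x = inv (h \<otimes> t i)" using h(2) that by (metis inv_inv)
      then have "t i \<otimes> x = inv h" using hc ti by (simp add: word_simps)
      then show "t i \<otimes> x \<in> H" using subgroup.m_inv_closed[OF H h(1)] by simp
    qed
  qed
  show ?thesis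
  proof (rule that[of t])
    show "t i \<in> carrier G" if "i < ?m" for i using t that by simp
    fix x assume x: "x \<in> carrier G"
    have "inv x \<in> H #> inv x" using rcos_self[OF _ H] x by simp
    moreover have HR: "H #> inv x \<in> rcosets H" using rcosetsI[OF subgroup.subset[OF H]] x by simp
    moreover obtain i where i: "i < ?m" "b i = H #> inv x"
      using HR bij_betw_imp_surj_on[OF b] by (metis imageE lessThan_iff)
    ultimately have ex: "i < ?m \<and> t i \<otimes> x \<in> H" using iff x by auto
    show "\<exists>!i. i < ?m \<and> t i \<otimes> x \<in> H"
    proof (rule ex1I[of _ i])
      show "i < ?m \<and> t i \<otimes> x \<in> H" by (rule ex)
    next
      fix j assume j: "j < ?m \<and> t j \<otimes> x \<in> H"
      have "b j \<inter> b i \<noteq> {}" using iff x j ex by blast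
      moreover have "b j \<in> rcosets H" "b i \<in> rcosets H" using j ex bij_betwE[OF b] by auto
      ultimately have "b j = b i" using rcos_disjoint[OF H] by (auto simp: pairwise_def disjnt_def)
      then show "j = i" using j ex bij_betw_imp_inj_on[OF b] by (auto dest: inj_onD)
    qed
  qed
qed

text \<open>The monomial matrices with entries
  \<open>l (t i \<otimes> g \<otimes> inv (t j))\<close>, where l is \<mu> extended by zero outside
  H. In a matrix product a single middle index contributes, and there l is multiplicative. A central
  z moves past the representatives and leaves its scalar on the diagonal.\<close>

lemma (in group) induced_scalar_rep:
  assumes fin: "finite (carrier G)" and H: "subgroup H G" and \<mu>: "lin_char G H \<mu>"
    and E: "E \<subseteq> H" and cent: "\<And>z g. z \<in> E \<Longrightarrow> g \<in> carrier G \<Longrightarrow> g \<otimes> z = z \<otimes> g"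
  shows "scalar_rep G E \<mu> (card (rcosets H))"
proof -
  let ?m = "card (rcosets H)"
  obtain t where t: "\<And>i. i < ?m \<Longrightarrow> t i \<in> carrier G"
    and ex1: "\<And>x. x \<in> carrier G \<Longrightarrow> \<exists>!i. i < ?m \<and> t i \<otimes> x \<in> H"
    using transversal[OF fin H] by metis
  note [simp] = t subgroup.mem_carrier[OF H]
  define l where "l x = (if x \<in> H then \<mu> x else 0)" for x
  define \<rho> where "\<rho> g = mat ?m ?m (\<lambda>(i,j). l (t i \<otimes> g \<otimes> inv (t j)))" for g
  have lmult: "l (a \<otimes> b) = l a * l b" if "a \<in> carrier G" "b \<in> H" for a b
  proof (cases "a \<in> H")
    case True then show ?thesis using that lin_char_mult[OF \<mu>] subgroup.m_closed[OF H] by (simp add: l_def)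
  next
    case False
    have "a \<otimes> b \<notin> H"
    proof
      assume "a \<otimes> b \<in> H"
      then have "(a \<otimes> b) \<otimes> inv b \<in> H" using that subgroup.m_closed[OF H] subgroup.m_inv_closed[OF H] by blast
      then show False using False that by (simp add: word_simps)
    qed
    then show ?thesis using False by (simp add: l_def)
  qed
  have tij: "t i \<otimes> inv (t j) \<in> H \<longleftrightarrow> i = j" if "i < ?m" "j < ?m" for i j
    using ex1[of "inv (t j)"] that subgroup.one_closed[OF H] by (auto simp: r_inv)
  have m0: "?m > 0" using ex1[of \<one>] by auto
  have hom: "\<rho> \<in> hom G (GL ?m)"
  proof (rule hom_GLI)
    show "\<rho> g \<in> carrier_mat ?m ?m" for g by (simp add: \<rho>_def)
    show "\<rho> \<one> = 1\<^sub>m ?m"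
      by (rule eq_matI) (auto simp: \<rho>_def l_def tij lin_char_one[OF \<mu> H] subgroup.one_closed[OF H])
    fix g h assume g: "g \<in> carrier G" and h: "h \<in> carrier G"
    show "\<rho> (g \<otimes> h) = \<rho> g * \<rho> h"
    proof (rule eq_matI)
      fix i k assume "i < dim_row (\<rho> g * \<rho> h)" "k < dim_col (\<rho> g * \<rho> h)"
      then have i: "i < ?m" and k: "k < ?m" by (auto simp: \<rho>_def)
      obtain j0 where j0: "j0 < ?m" "t j0 \<otimes> (h \<otimes> inv (t k)) \<in> H"
        and uniq: "\<And>j. j < ?m \<Longrightarrow> t j \<otimes> (h \<otimes> inv (t k)) \<in> H \<Longrightarrow> j = j0"
        using ex1[of "h \<otimes> inv (t k)"] h k by auto
      have "(\<rho> g * \<rho> h) $$ (i,k) = (\<Sum>j<?m. l (t i \<otimes> g \<otimes> inv (t j)) * l (t j \<otimes> h \<otimes> inv (t k)))"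
        using i k by (simp add: \<rho>_def scalar_prod_def atLeast0LessThan)
      also have "\<dots> = (\<Sum>j<?m. if j = j0 then l (t i \<otimes> g \<otimes> inv (t j0)) * l (t j0 \<otimes> h \<otimes> inv (t k)) else 0)"
      proof (intro sum.cong refl)
        fix j assume j: "j \<in> {..<?m}"
        have "l (t j \<otimes> h \<otimes> inv (t k)) = 0" if "j \<noteq> j0"
        proof -
          have "t j \<otimes> (h \<otimes> inv (t k)) \<notin> H" using uniq[of j] j that by blast
          then show ?thesis using j h k by (simp add: l_def m_assoc)
        qed
        then show "l (t i \<otimes> g \<otimes> inv (t j)) * l (t j \<otimes> h \<otimes> inv (t k))
          = (if j = j0 then l (t i \<otimes> g \<otimes> inv (t j0)) * l (t j0 \<otimes> h \<otimes> inv (t k)) else 0)" by simp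
      qed
      also have "\<dots> = l (t i \<otimes> g \<otimes> inv (t j0)) * l (t j0 \<otimes> h \<otimes> inv (t k))" using j0 by simp
      also have "\<dots> = l ((t i \<otimes> g \<otimes> inv (t j0)) \<otimes> (t j0 \<otimes> h \<otimes> inv (t k)))"
        by (rule lmult[symmetric]) (use j0 g h i k in \<open>simp_all add: m_assoc\<close>)
      also have "\<dots> = l (t i \<otimes> (g \<otimes> h) \<otimes> inv (t k))" using j0(1) g h i k by (simp add: word_simps)
      finally show "\<rho> (g \<otimes> h) $$ (i,k) = (\<rho> g * \<rho> h) $$ (i,k)" using i k by (simp add: \<rho>_def)
    qed (simp_all add: \<rho>_def)
  qed
  have "\<rho> z = \<mu> z \<cdot>\<^sub>m 1\<^sub>m ?m" if z: "z \<in> E" for z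
  proof (rule eq_matI)
    fix i j assume "i < dim_row (\<mu> z \<cdot>\<^sub>m 1\<^sub>m ?m)" "j < dim_col (\<mu> z \<cdot>\<^sub>m 1\<^sub>m ?m)"
    then have i: "i < ?m" and j: "j < ?m" by auto
    have zH: "z \<in> H" using z E by auto
    have "t i \<otimes> z \<otimes> inv (t j) = z \<otimes> (t i \<otimes> inv (t j))" using cent[OF z t[OF i]] i j zH by (simp add: m_assoc)
    also have "\<dots> = (t i \<otimes> inv (t j)) \<otimes> z" using cent[OF z, of "t i \<otimes> inv (t j)"] i j by simp
    finally have "l (t i \<otimes> z \<otimes> inv (t j)) = l (t i \<otimes> inv (t j)) * l z" using lmult[of "t i \<otimes> inv (t j)" z] i j zH by simp
    then show "\<rho> z $$ (i,j) = (\<mu> z \<cdot>\<^sub>m 1\<^sub>m ?m) $$ (i,j)"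
      using i j zH lin_char_one[OF \<mu> H] by (auto simp: \<rho>_def l_def tij subgroup.one_closed[OF H])
  qed (simp_all add: \<rho>_def)
  then show ?thesis using hom m0 unfolding scalar_rep_def by blast
qed

lemma (in group) direct_sum_rep:
  assumes r1: "\<rho>\<^sub>1 \<in> hom G (GL a)" and r2: "\<rho>\<^sub>2 \<in> hom G (GL b)"
  obtains \<rho> where "\<rho> \<in> hom G (GL (a + b))"
    "\<And>g. g \<in> carrier G \<Longrightarrow> \<rho> g = 1\<^sub>m (a + b) \<Longrightarrow> \<rho>\<^sub>1 g = 1\<^sub>m a \<and> \<rho>\<^sub>2 g = 1\<^sub>m b"
proof -
  have c1: "\<rho>\<^sub>1 g \<in> carrier_mat a a" and c2: "\<rho>\<^sub>2 g \<in> carrier_mat b b" if "g \<in> carrier G" for g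
    using hom_in_carrier[OF r1 that] hom_in_carrier[OF r2 that] by auto
  note one1 = hom_GL_one[OF r1] and one2 = hom_GL_one[OF r2]
  define \<rho> where "\<rho> g = four_block_mat (\<rho>\<^sub>1 g) (0\<^sub>m a b) (0\<^sub>m b a) (\<rho>\<^sub>2 g)" for g
  show ?thesis
  proof (rule that[of \<rho>])
    show "\<rho> \<in> hom G (GL (a + b))"
    proof (rule hom_GLI)
      show "\<rho> g \<in> carrier_mat (a + b) (a + b)" if "g \<in> carrier G" for g
        using c1[OF that] c2[OF that] by (simp add: \<rho>_def)
      show "\<rho> \<one> = 1\<^sub>m (a + b)" by (simp add: \<rho>_def one1 one2)
      fix g h assume gh: "g \<in> carrier G" "h \<in> carrier G"
      show "\<rho> (g \<otimes> h) = \<rho> g * \<rho> h"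
        unfolding \<rho>_def
        by (subst mult_four_block_mat[of _ a a _ b _ b _ _ a _ b])
          (use c1[OF gh(1)] c1[OF gh(2)] c2[OF gh(1)] c2[OF gh(2)] hom_mult[OF r1 gh] hom_mult[OF r2 gh] in
            \<open>auto simp: left_mult_zero_mat right_mult_zero_mat\<close>)
    qed
    fix g assume g: "g \<in> carrier G" and e: "\<rho> g = 1\<^sub>m (a + b)"
    have d: "dim_row (\<rho>\<^sub>1 g) = a" "dim_col (\<rho>\<^sub>1 g) = a" "dim_row (\<rho>\<^sub>2 g) = b" "dim_col (\<rho>\<^sub>2 g) = b"
      using c1[OF g] c2[OF g] by auto
    have ent: "\<rho> g $$ (i,j) = (1\<^sub>m (a + b)) $$ (i,j)" for i j using e by simp
    have "\<rho>\<^sub>1 g = 1\<^sub>m a"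
    proof (rule eq_matI)
      fix i j assume "i < dim_row (1\<^sub>m a :: complex mat)" "j < dim_col (1\<^sub>m a :: complex mat)"
      then show "\<rho>\<^sub>1 g $$ (i,j) = 1\<^sub>m a $$ (i,j)" using ent[of i j] d by (simp add: \<rho>_def)
    qed (use d in auto)
    moreover have "\<rho>\<^sub>2 g = 1\<^sub>m b"
    proof (rule eq_matI)
      fix i j assume "i < dim_row (1\<^sub>m b :: complex mat)" "j < dim_col (1\<^sub>m b :: complex mat)"
      then show "\<rho>\<^sub>2 g $$ (i,j) = 1\<^sub>m b $$ (i,j)" using ent[of "a + i" "a + j"] d by (simp add: \<rho>_def)
    qed (use d in auto)
    ultimately show "\<rho>\<^sub>1 g = 1\<^sub>m a \<and> \<rho>\<^sub>2 g = 1\<^sub>m b" ..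
  qed
qed

lemma (in group) sum_scalar_reps:
  assumes "\<And>\<chi> m. (\<chi>, m) \<in> set xs \<Longrightarrow> scalar_rep G E \<chi> m" "E \<subseteq> carrier G"
  shows "\<exists>\<rho>. \<rho> \<in> hom G (GL (sum_list (map snd xs)))
    \<and> (\<forall>z\<in>E. \<rho> z = 1\<^sub>m (sum_list (map snd xs)) \<longrightarrow> (\<forall>\<chi>\<in>fst ` set xs. \<chi> z = 1))"
  using assms(1)
proof (induction xs)
  case Nil
  have "(\<lambda>_. 1\<^sub>m 0) \<in> hom G (GL 0)" by (rule hom_GLI) auto
  then show ?case by auto
next
  case (Cons a xs)
  obtain \<chi> m where a: "a = (\<chi>, m)" by (cases a)
  let ?k = "sum_list (map snd xs)"
  have "scalar_rep G E \<chi> m" using Cons.prems a by simp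
  then obtain \<rho>\<^sub>1 where r1: "\<rho>\<^sub>1 \<in> hom G (GL m)" "\<And>z. z \<in> E \<Longrightarrow> \<rho>\<^sub>1 z = \<chi> z \<cdot>\<^sub>m 1\<^sub>m m" and m: "m > 0"
    by (auto simp: scalar_rep_def)
  obtain \<rho>\<^sub>2 where r2: "\<rho>\<^sub>2 \<in> hom G (GL ?k)"
    "\<And>z. z \<in> E \<Longrightarrow> \<rho>\<^sub>2 z = 1\<^sub>m ?k \<Longrightarrow> \<forall>\<chi>\<in>fst ` set xs. \<chi> z = 1"
    using Cons by fastforce
  obtain \<rho> where r: "\<rho> \<in> hom G (GL (m + ?k))"
    "\<And>g. g \<in> carrier G \<Longrightarrow> \<rho> g = 1\<^sub>m (m + ?k) \<Longrightarrow> \<rho>\<^sub>1 g = 1\<^sub>m m \<and> \<rho>\<^sub>2 g = 1\<^sub>m ?k"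
    using direct_sum_rep[OF r1(1) r2(1)] by metis
  have "\<chi> z = 1" if "z \<in> E" "\<rho>\<^sub>1 z = 1\<^sub>m m" for z
  proof -
    have "(\<chi> z \<cdot>\<^sub>m 1\<^sub>m m) $$ (0,0) = (1\<^sub>m m :: complex mat) $$ (0,0)" using r1(2)[OF that(1)] that(2) by simp
    then show ?thesis using m by simp
  qed
  then show ?case using a r r2(2) assms(2) by (intro exI[of _ \<rho>]) auto
qed

section \<open>The socle and faithfulness of sums of representations\<close>

context p_group
begin

text \<open>The classical \<Omega>_1(Z(G)), which for a p-group is the socle.\<close>

definition omega :: "'a set" where
  "omega = {z \<in> carrier G. (\<forall>g\<in>carrier G. g \<otimes> z = z \<otimes> g) \<and> z [^] p = \<one>}"

lemma omega_subgroup: "subgroup omega G"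
proof (rule subgroupI)
  show "omega \<subseteq> carrier G" by (auto simp: omega_def)
  show "omega \<noteq> {}" by (auto simp: omega_def intro!: exI[of _ \<one>])
next
  fix a assume a: "a \<in> omega"
  then have "g \<otimes> inv a = inv a \<otimes> g" if "g \<in> carrier G" for g
    using that a by (auto simp: omega_def) (metis inv_closed inv_mult_group inv_inv)
  then show "inv a \<in> omega" using a by (auto simp: omega_def nat_pow_inv)
next
  fix a b assume ab: "a \<in> omega" "b \<in> omega"
  then have [simp]: "a \<in> carrier G" "b \<in> carrier G" by (auto simp: omega_def)
  have "g \<otimes> (a \<otimes> b) = (a \<otimes> b) \<otimes> g" if g: "g \<in> carrier G" for g
  proof -
    have ga: "g \<otimes> a = a \<otimes> g" and gb: "g \<otimes> b = b \<otimes> g" using ab g by (auto simp: omega_def)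
    have "g \<otimes> (a \<otimes> b) = (g \<otimes> a) \<otimes> b" using g by (simp add: m_assoc)
    also have "\<dots> = a \<otimes> (g \<otimes> b)" unfolding ga using g by (simp add: m_assoc)
    also have "\<dots> = a \<otimes> (b \<otimes> g)" unfolding gb ..
    finally show ?thesis using g by (simp add: m_assoc)
  qed
  moreover have "a \<otimes> b = b \<otimes> a" using ab unfolding omega_def by blast
  then have "(a \<otimes> b) [^] p = a [^] p \<otimes> b [^] p" by (intro pow_mult_distrib) simp_all
  moreover have "a [^] p = \<one>" "b [^] p = \<one>" using ab unfolding omega_def by blast+
  ultimately show "a \<otimes> b \<in> omega" unfolding omega_def by simp
qed

lemma omega_carrier: "z \<in> omega \<Longrightarrow> z \<in> carrier G" by (simp add: omega_def)
lemma omega_central: "z \<in> omega \<Longrightarrow> g \<in> carrier G \<Longrightarrow> g \<otimes> z = z \<otimes> g" by (simp add: omega_def)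
lemma omega_pow: "z \<in> omega \<Longrightarrow> z [^] p = \<one>" by (simp add: omega_def)

lemma omega_conj: "z \<in> omega \<Longrightarrow> g \<in> carrier G \<Longrightarrow> g \<otimes> z \<otimes> inv g = z"
  by (simp add: omega_central[of z g] omega_carrier[of z] m_assoc[of z g "inv g"])

text \<open>With trivial N, centrality modulo N is centrality, and the p-th power is
  trivial.\<close>

lemma normal_subgroup_meets_omega:
  assumes K: "subgroup K G" and nK: "\<And>g x. g \<in> carrier G \<Longrightarrow> x \<in> K \<Longrightarrow> g \<otimes> x \<otimes> inv g \<in> K"
    and "K \<noteq> {\<one>}"
  obtains z where "z \<in> K" "z \<in> omega" "z \<noteq> \<one>"
proof -
  have one: "subgroup {\<one>} G" by (rule triv_subgroup)
  obtain x where x: "x \<in> K" "x \<notin> {\<one>}" "\<And>g. g \<in> carrier G \<Longrightarrow> g \<otimes> x \<otimes> inv g \<otimes> inv x \<in> {\<one>}" "x [^] p \<in> {\<one>}"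
  proof (rule exists_central_mod[OF subgroup_self one K])
    show "{\<one>} \<subseteq> K" "{\<one>} \<noteq> K" using subgroup.one_closed[OF K] assms(3) by auto
    show "K \<subseteq> carrier G" by (rule subgroup.subset[OF K])
    show "g \<otimes> x \<otimes> inv g \<in> {\<one>}" if "g \<in> carrier G" "x \<in> {\<one>}" for g x using that by simp
  qed (use nK that in auto)
  have xc: "x \<in> carrier G" using subgroup.mem_carrier[OF K x(1)] .
  have "g \<otimes> x = x \<otimes> g" if g: "g \<in> carrier G" for g
  proof -
    have "g \<otimes> x = (g \<otimes> x \<otimes> inv g \<otimes> inv x) \<otimes> (x \<otimes> g)" using g xc by (simp add: word_simps)
    then show ?thesis using x(3)[OF g] g xc by simp
  qed
  then show ?thesis using that x xc by (auto simp: omega_def)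
qed

lemma omega_nontrivial: "n \<ge> 1 \<Longrightarrow> omega \<noteq> {\<one>}"
proof
  assume n: "n \<ge> 1" and o: "omega = {\<one>}"
  have "card (carrier G) \<noteq> 1" using order_eq n prime_gt_1_nat[OF p] by simp
  then have "carrier G \<noteq> {\<one>}" by auto
  then obtain z where "z \<in> omega" "z \<noteq> \<one>" using normal_subgroup_meets_omega[OF subgroup_self] by auto
  then show False using o by auto
qed

lemma faithful_sum_scalar_reps:
  assumes "n \<ge> 1" and reps: "\<And>\<chi> m. (\<chi>, m) \<in> set xs \<Longrightarrow> scalar_rep G omega \<chi> m"
    and sep: "\<And>z. z \<in> omega \<Longrightarrow> \<forall>\<chi>\<in>fst ` set xs. \<chi> z = 1 \<Longrightarrow> z = \<one>"
  shows "sum_list (map snd xs) \<ge> 1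
    \<and> (\<exists>\<rho>. \<rho> \<in> hom G (GL (sum_list (map snd xs))) \<and> inj_on \<rho> (carrier G))"
proof -
  let ?m = "sum_list (map snd xs)"
  obtain \<rho> where \<rho>: "\<rho> \<in> hom G (GL ?m)"
    and ker: "\<And>z. z \<in> omega \<Longrightarrow> \<rho> z = 1\<^sub>m ?m \<Longrightarrow> \<forall>\<chi>\<in>fst ` set xs. \<chi> z = 1"
    using sum_scalar_reps[OF reps subgroup.subset[OF omega_subgroup]] by metis
  have "xs \<noteq> []"
  proof
    assume "xs = []"
    then have "omega \<subseteq> {\<one>}" using sep by auto
    then show False using omega_nontrivial[OF assms(1)] subgroup.one_closed[OF omega_subgroup] by auto
  qed
  then obtain \<chi> m ys where "xs = (\<chi>, m) # ys" by (metis list.exhaust surj_pair)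
  then have m1: "?m \<ge> 1" using reps[of \<chi> m] by (auto simp: scalar_rep_def)
  have "{g \<in> carrier G. \<rho> g = 1\<^sub>m ?m} = {\<one>}"
  proof (rule ccontr)
    assume "{g \<in> carrier G. \<rho> g = 1\<^sub>m ?m} \<noteq> {\<one>}"
    then obtain z where z: "z \<in> {g \<in> carrier G. \<rho> g = 1\<^sub>m ?m}" "z \<in> omega" "z \<noteq> \<one>"
      using normal_subgroup_meets_omega[OF hom_GL_kernel(1,2)[OF \<rho>]] by blast
    then show False using ker[OF z(2)] sep[OF z(2)] by simp
  qed
  then have "inj_on \<rho> (carrier G)" by (rule hom_GL_kernel(3)[OF \<rho>])
  then show ?thesis using m1 \<rho> by blast
qed

lemma rdim_le_sum_scalar_reps:
  assumes "n \<ge> 1" and "\<And>\<chi> m. (\<chi>, m) \<in> set xs \<Longrightarrow> scalar_rep G omega \<chi> m"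
    and "\<And>z. z \<in> omega \<Longrightarrow> \<forall>\<chi>\<in>fst ` set xs. \<chi> z = 1 \<Longrightarrow> z = \<one>"
  shows "rdim G \<le> sum_list (map snd xs)"
  unfolding rdim_def by (rule Least_le) (rule faithful_sum_scalar_reps[OF assms])

end

section \<open>Upper bounds\<close>

text \<open>A by-product of extending the trivial character with value 1 at x.\<close>

lemma (in p_group) cyclic_ext_subgroup:
  assumes "subgroup N G" "x \<in> carrier G" "\<And>u. u \<in> N \<Longrightarrow> x \<otimes> u \<otimes> inv x \<in> N"
  shows "subgroup (cyclic_ext N x) G"
  using extend_to_cyclic_ext[OF finite_carrier assms, of "\<lambda>_. 1" 1] by (simp add: lin_char_def)

lemma exists_nontrivial_root_of_unity:
  assumes "p \<ge> 2" obtains c :: complex where "c ^ p = 1" "c \<noteq> 1"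
proof (rule ccontr)
  assume "\<not> thesis"
  then have "{z::complex. z ^ p = 1} \<subseteq> {1}" using that by auto
  then have "card {z::complex. z ^ p = 1} \<le> card {1::complex}" by (intro card_mono) auto
  then show False using card_roots_unity_eq[of p] assms by simp
qed

lemma scalar_rep_cong:
  assumes "scalar_rep G E \<mu> m" "\<And>z. z \<in> E \<Longrightarrow> \<chi> z = \<mu> z"
  shows "scalar_rep G E \<chi> m"
  using assms by (auto simp: scalar_rep_def)

section \<open>Characters of elementary abelian subgroups and the degrees over them\<close>

context p_group
begin

text \<open>In exponent p the compatibility condition on the value c shrinks to
  \<open>c ^ p = 1\<close>, so any p-th root of unity may be prescribed at a new element.\<close>

lemma elementary_char_step:
  assumes E: "subgroup E G" and comm: "\<And>x y. x \<in> E \<Longrightarrow> y \<in> E \<Longrightarrow> x \<otimes> y = y \<otimes> x"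
    and expn: "\<And>x. x \<in> E \<Longrightarrow> x [^] p = \<one>"
    and D: "subgroup D G" "D \<subseteq> E" and \<chi>: "lin_char G D \<chi>" and x: "x \<in> E" "x \<notin> D" and c: "c ^ p = 1"
  obtains \<chi>' where "subgroup (cyclic_ext D x) G" "cyclic_ext D x \<subseteq> E" "lin_char G (cyclic_ext D x) \<chi>'"
    "\<And>u. u \<in> D \<Longrightarrow> \<chi>' u = \<chi> u" "\<chi>' x = c"
proof -
  have xc: "x \<in> carrier G" using subgroup.mem_carrier[OF E x(1)] .
  have cj: "x \<otimes> u \<otimes> inv x = u" if "u \<in> D" for u
  proof -
    have "u \<in> E" using that D by auto
    then have "x \<otimes> u \<otimes> inv x = u \<otimes> x \<otimes> inv x" using comm[OF x(1), of u] by simp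
    also have "\<dots> = u" using subgroup.mem_carrier[OF D(1) that] xc by (simp add: m_assoc)
    finally show ?thesis .
  qed
  have p0: "p > 0" using p prime_gt_0_nat by simp
  have c0: "c \<noteq> 0" using c p0 by (metis power_0_left zero_neq_one less_irrefl)
  have cd: "\<chi> (x [^] d) = c ^ d" if d: "x [^] d \<in> D" for d :: nat
  proof -
    have "x [^] p \<in> D" using expn[OF x(1)] subgroup.one_closed[OF D(1)] by simp
    then obtain k where k: "d = p * k" using pow_mem_iff[OF D(1) xc x(2) _ d] by blast
    have "x [^] d = \<one>" using k expn[OF x(1)] xc by (simp flip: nat_pow_pow)
    then show ?thesis using lin_char_one[OF \<chi> D(1)] c k by (simp add: power_mult)
  qed
  show ?thesis
    using extend_to_cyclic_ext[OF finite_carrier D(1) xc _ \<chi> _ c0 cd] cj that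
      cyclic_ext_subset[OF D(1) E D(2) x(1)] by metis
qed

lemma extend_elementary_char:
  assumes E: "subgroup E G" and comm: "\<And>x y. x \<in> E \<Longrightarrow> y \<in> E \<Longrightarrow> x \<otimes> y = y \<otimes> x"
    and expn: "\<And>x. x \<in> E \<Longrightarrow> x [^] p = \<one>"
    and "subgroup D G" "D \<subseteq> E" "lin_char G D \<chi>"
  shows "\<exists>\<chi>'. lin_char G E \<chi>' \<and> (\<forall>u\<in>D. \<chi>' u = \<chi> u)"
  using assms(4-6)
proof (induction "card E - card D" arbitrary: D \<chi> rule: less_induct)
  case less
  show ?case
  proof (cases "D = E")
    case True then show ?thesis using less.prems by auto
  next
    case False
    then obtain x where x: "x \<in> E" "x \<notin> D" using less.prems by auto
    obtain \<chi>' where M: "subgroup (cyclic_ext D x) G" "cyclic_ext D x \<subseteq> E" "lin_char G (cyclic_ext D x) \<chi>'"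
      "\<And>u. u \<in> D \<Longrightarrow> \<chi>' u = \<chi> u"
      using elementary_char_step[OF E comm expn less.prems x, of 1] by (metis power_one)
    have DM: "D \<subseteq> cyclic_ext D x" by (rule cyclic_ext_supset[OF less.prems(1)])
    have "x \<in> cyclic_ext D x" using cyclic_ext_self[OF less.prems(1)] subgroup.mem_carrier[OF E x(1)] by blast
    then have "D \<subset> cyclic_ext D x" using DM x by auto
    then have "card D < card (cyclic_ext D x)" using subgroup_finite[OF M(1)] by (simp add: psubset_card_mono)
    moreover have "card (cyclic_ext D x) \<le> card E" using M(2) subgroup_finite[OF E] by (simp add: card_mono)
    ultimately have "card E - card (cyclic_ext D x) < card E - card D" by linarith
    from less.hyps[OF this M(1-3)] show ?thesis using M(4) DM by fastforce
  qed
qed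

text \<open>A greedy choice: a character trivial on D and nontrivial on some element of K outside D
  cuts K down by a factor of at least p. The characters are kept on the fixed group E, although the
  recursion descends through K; this lets the list be used on all of \<Omega>.\<close>

lemma separating_chars:
  assumes E: "subgroup E G" and comm: "\<And>x y. x \<in> E \<Longrightarrow> y \<in> E \<Longrightarrow> x \<otimes> y = y \<otimes> x"
    and expn: "\<And>x. x \<in> E \<Longrightarrow> x [^] p = \<one>"
    and D: "subgroup D G" and "subgroup K G" "D \<subseteq> K" "K \<subseteq> E"
  shows "\<exists>cs. (\<forall>\<chi>\<in>set cs. lin_char G E \<chi> \<and> (\<forall>z\<in>D. \<chi> z = 1)) \<and> {z \<in> K. \<forall>\<chi>\<in>set cs. \<chi> z = 1} = D
     \<and> p ^ length cs * card D \<le> card K"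
  using assms(5-7)
proof (induction "card K" arbitrary: K rule: less_induct)
  case less
  show ?case
  proof (cases "K = D")
    case True then show ?thesis by (intro exI[of _ "[]"]) auto
  next
    case False
    then obtain x where x: "x \<in> K" "x \<notin> D" using less.prems by auto
    have xE: "x \<in> E" and DE: "D \<subseteq> E" using x less.prems by auto
    obtain c :: complex where c: "c ^ p = 1" "c \<noteq> 1"
      using exists_nontrivial_root_of_unity[OF prime_ge_2_nat[OF p]] by metis
    have triv: "lin_char G D (\<lambda>_. 1)" by (simp add: lin_char_def)
    obtain \<chi>' where M: "subgroup (cyclic_ext D x) G" "cyclic_ext D x \<subseteq> E" "lin_char G (cyclic_ext D x) \<chi>'"
      "\<And>u. u \<in> D \<Longrightarrow> \<chi>' u = 1" "\<chi>' x = c"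
      using elementary_char_step[OF E comm expn D DE triv xE x(2) c(1)] by metis
    obtain \<chi> where \<chi>: "lin_char G E \<chi>" "\<And>u. u \<in> cyclic_ext D x \<Longrightarrow> \<chi> u = \<chi>' u"
      using extend_elementary_char[OF E comm expn M(1-3)] by blast
    have \<chi>D: "\<chi> u = 1" if "u \<in> D" for u using that \<chi>(2) M(4) cyclic_ext_supset[OF D, of x] by auto
    have \<chi>x: "\<chi> x \<noteq> 1" using \<chi>(2) M(5) c(2) cyclic_ext_self[OF D] subgroup.mem_carrier[OF E xE] by auto
    define K' where "K' = {z \<in> K. \<chi> z = 1}"
    have K': "subgroup K' G" unfolding K'_def
      by (rule lin_char_kernel_subgroup[OF lin_char_subset[OF \<chi>(1) less.prems(3)] less.prems(1)])
    have sub: "D \<subseteq> K'" "K' \<subseteq> E" "K' \<subseteq> K" using \<chi>D less.prems K'_def by auto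
    have "K' \<noteq> K" using x \<chi>x K'_def by auto
    then have pK: "p * card K' \<le> card K" by (rule proper_subgroup_card[OF K' less.prems(1) sub(3)])
    have "card K' < card K" using \<open>K' \<noteq> K\<close> sub(3) subgroup_finite[OF less.prems(1)]
      by (simp add: psubset_card_mono psubset_eq)
    from less.hyps[OF this K' sub(1,2)] obtain cs where cs: "\<forall>\<chi>\<in>set cs. lin_char G E \<chi> \<and> (\<forall>z\<in>D. \<chi> z = 1)"
      "{z \<in> K'. \<forall>\<chi>\<in>set cs. \<chi> z = 1} = D" "p ^ length cs * card D \<le> card K'" by blast
    have "p ^ length (\<chi> # cs) * card D \<le> p * card K'" using cs(3) by (simp add: mult.assoc)
    then have "p ^ length (\<chi> # cs) * card D \<le> card K" using pK by linarith
    moreover have "{z \<in> K. \<forall>\<chi>\<in>set (\<chi> # cs). \<chi> z = 1} = D" using cs(2) K'_def by auto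
    ultimately show ?thesis using cs(1) \<chi>(1) \<chi>D by (intro exI[of _ "\<chi> # cs"]) auto
  qed
qed

lemma omega_comm: "x \<in> omega \<Longrightarrow> y \<in> omega \<Longrightarrow> x \<otimes> y = y \<otimes> x"
  using omega_central omega_carrier by blast

lemma omega_separating_chars:
  assumes "subgroup D G" "subgroup K G" "D \<subseteq> K" "K \<subseteq> omega"
  obtains cs where "\<And>\<chi>. \<chi> \<in> set cs \<Longrightarrow> lin_char G omega \<chi>" "\<And>\<chi> z. \<chi> \<in> set cs \<Longrightarrow> z \<in> D \<Longrightarrow> \<chi> z = 1"
    "\<And>z. z \<in> K \<Longrightarrow> \<forall>\<chi>\<in>set cs. \<chi> z = 1 \<Longrightarrow> z \<in> D" "p ^ length cs * card D \<le> card K"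
  using separating_chars[OF omega_subgroup omega_comm omega_pow assms] that by blast

lemma scalar_rep_extended_char:
  assumes H: "subgroup H G" "omega \<subseteq> H" "lin_char G H \<mu>" and h: "card H = p ^ h" "h \<le> n"
    and "\<And>z. z \<in> omega \<Longrightarrow> \<chi> z = \<mu> z"
  shows "scalar_rep G omega \<chi> (p ^ (n - h))"
proof -
  have "card (rcosets H) * p ^ h = p ^ n" using lagrange[OF H(1)] h order_eq by (simp add: Coset.order_def)
  also have "\<dots> = p ^ (n - h) * p ^ h" using h by (simp flip: power_add)
  finally have "card (rcosets H) = p ^ (n - h)" using prime_gt_0_nat[OF p] by simp
  then have "scalar_rep G omega \<mu> (p ^ (n - h))"
    using induced_scalar_rep[OF finite_carrier H(1,3,2) omega_central] by simp
  then show ?thesis using assms(6) by (rule scalar_rep_cong)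
qed

text \<open>In exponents, \<open>card C * card N \<le> card H ^ 2\<close> reads n + k \<le> 2h; the
  index of H is p^j with j = n - h. Enlarging N beyond \<Omega> therefore lowers the degree.\<close>

lemma scalar_rep_exists:
  assumes N: "subgroup N G" "omega \<subseteq> N" "lin_char G N \<chi>'" "card N = p ^ k"
    and inv: "\<And>g u. g \<in> carrier G \<Longrightarrow> u \<in> N \<Longrightarrow> g \<otimes> u \<otimes> inv g \<in> N \<and> \<chi>' (g \<otimes> u \<otimes> inv g) = \<chi>' u"
    and eq: "\<And>z. z \<in> omega \<Longrightarrow> \<chi> z = \<chi>' z"
  obtains j where "2 * j + k \<le> n" "scalar_rep G omega \<chi> (p ^ j)"
proof -
  obtain H \<mu> where H: "subgroup H G" "N \<subseteq> H" "lin_char G H \<mu>" "\<forall>u\<in>N. \<mu> u = \<chi>' u"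
      "card (carrier G) * card N \<le> card H ^ 2"
    using extend_invariant_char[OF subgroup_self N(1) subgroup.subset[OF N(1)] N(3) inv] by blast
  obtain h where h: "card H = p ^ h" "h \<le> n" using subgroup_card[OF H(1)] by blast
  have "p ^ (n + k) \<le> p ^ (2 * h)" using H(5) order_eq N(4) h
    by (simp add: power_add mult.commute flip: power_mult)
  then have "n + k \<le> 2 * h" using prime_gt_1_nat[OF p] by simp
  then have "2 * (n - h) + k \<le> n" using h by linarith
  moreover have "scalar_rep G omega \<chi> (p ^ (n - h))"
    by (rule scalar_rep_extended_char[OF H(1) _ H(3) h]) (use N H eq in auto)
  ultimately show ?thesis using that by blast
qed

lemma scalar_rep_omega_char:
  assumes "lin_char G omega \<chi>" "card omega = p ^ r"
  obtains j where "2 * j + r \<le> n" "scalar_rep G omega \<chi> (p ^ j)"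
  using scalar_rep_exists[OF omega_subgroup order_refl assms, of \<chi>] omega_conj by metis

lemma scalar_rep_le:
  assumes "lin_char G omega \<chi>" "card omega = p ^ r"
  obtains m where "m \<le> p ^ ((n - r) div 2)" "scalar_rep G omega \<chi> m"
proof -
  obtain j where j: "2 * j + r \<le> n" "scalar_rep G omega \<chi> (p ^ j)" using scalar_rep_omega_char[OF assms] .
  have "p ^ j \<le> p ^ ((n - r) div 2)" using j(1) prime_ge_1_nat[OF p] by (intro power_increasing) auto
  then show ?thesis using that j(2) by blast
qed

lemma scalar_reps_list:
  assumes "\<And>\<chi>. \<chi> \<in> set cs \<Longrightarrow> \<exists>m\<le>B. scalar_rep G omega \<chi> m"
  obtains xs where "map fst xs = cs" "\<And>\<chi> m. (\<chi>, m) \<in> set xs \<Longrightarrow> scalar_rep G omega \<chi> m"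
    "sum_list (map snd xs) \<le> length cs * B"
proof -
  obtain d where d: "\<And>\<chi>. \<chi> \<in> set cs \<Longrightarrow> d \<chi> \<le> B \<and> scalar_rep G omega \<chi> (d \<chi>)" using assms by metis
  have "sum_list (map d cs) \<le> length cs * B" using d by (induction cs) fastforce+
  then show ?thesis using d by (intro that[of "map (\<lambda>\<chi>. (\<chi>, d \<chi>)) cs"]) (auto simp: comp_def)
qed

lemma card_omega:
  assumes "n \<ge> 1" obtains r where "card omega = p ^ r" "1 \<le> r" "r \<le> n"
proof -
  obtain r where r: "card omega = p ^ r" "r \<le> n" using subgroup_card[OF omega_subgroup] .
  have "r \<noteq> 0"
  proof
    assume "r = 0"
    then have "card omega = 1" using r by simp
    then obtain z where "omega = {z}" by (metis card_1_singletonE)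
    then show False using omega_nontrivial[OF assms] subgroup.one_closed[OF omega_subgroup] by auto
  qed
  then show ?thesis using that r by simp
qed

lemma separating_scalar_reps:
  assumes "card omega = p ^ r"
  obtains xs where "\<And>\<chi> m. (\<chi>, m) \<in> set xs \<Longrightarrow> scalar_rep G omega \<chi> m"
    "\<And>z. z \<in> omega \<Longrightarrow> \<forall>\<chi>\<in>fst ` set xs. \<chi> z = 1 \<Longrightarrow> z = \<one>"
    "sum_list (map snd xs) \<le> r * p ^ ((n - r) div 2)"
proof -
  have one: "subgroup {\<one>} G" by (rule triv_subgroup)
  have oo: "{\<one>} \<subseteq> omega" using subgroup.one_closed[OF omega_subgroup] by simp
  obtain cs where cs: "\<And>\<chi>. \<chi> \<in> set cs \<Longrightarrow> lin_char G omega \<chi>"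
    "\<And>z. z \<in> omega \<Longrightarrow> \<forall>\<chi>\<in>set cs. \<chi> z = 1 \<Longrightarrow> z \<in> {\<one>}" "p ^ length cs * card {\<one>} \<le> card omega"
    using omega_separating_chars[OF one omega_subgroup oo order_refl] by metis
  have len: "length cs \<le> r" using cs(3) assms prime_gt_1_nat[OF p] by simp
  obtain xs where xs: "map fst xs = cs" "\<And>\<chi> m. (\<chi>, m) \<in> set xs \<Longrightarrow> scalar_rep G omega \<chi> m"
    "sum_list (map snd xs) \<le> length cs * p ^ ((n - r) div 2)"
    using scalar_reps_list[of cs "p ^ ((n - r) div 2)"] cs(1) scalar_rep_le[OF _ assms] by metis
  have "fst ` set xs = set cs" using xs(1) by (metis set_map)
  then have sep: "z = \<one>" if "z \<in> omega" "\<forall>\<chi>\<in>fst ` set xs. \<chi> z = 1" for z using cs(2) that by auto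
  have "sum_list (map snd xs) \<le> r * p ^ ((n - r) div 2)" using xs(3) len by (meson le_trans mult_le_mono1)
  then show ?thesis using that xs(2) sep by blast
qed

theorem rdim_le:
  assumes "n \<ge> 1" "card omega = p ^ r"
  shows "rdim G \<le> r * p ^ ((n - r) div 2)"
proof -
  obtain xs where xs: "\<And>\<chi> m. (\<chi>, m) \<in> set xs \<Longrightarrow> scalar_rep G omega \<chi> m"
    "\<And>z. z \<in> omega \<Longrightarrow> \<forall>\<chi>\<in>fst ` set xs. \<chi> z = 1 \<Longrightarrow> z = \<one>"
    "sum_list (map snd xs) \<le> r * p ^ ((n - r) div 2)"
    using separating_scalar_reps[OF assms(2)] by blast
  have "rdim G \<le> sum_list (map snd xs)"
    by (rule rdim_le_sum_scalar_reps[OF assms(1)]) (erule xs(1), erule (1) xs(2))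
  then show ?thesis using xs(3) by linarith
qed

text \<open>\<open>rdim\<close> is a \<open>LEAST\<close>, so a lower bound for it requires that the
  minimum is attained.\<close>

lemma faithful_rep_exists:
  assumes "n \<ge> 1"
  shows "\<exists>m\<ge>1. \<exists>\<rho>. \<rho> \<in> hom G (GL m) \<and> inj_on \<rho> (carrier G)"
proof -
  obtain r where r: "card omega = p ^ r" using subgroup_card[OF omega_subgroup] by blast
  obtain xs where xs: "\<And>\<chi> m. (\<chi>, m) \<in> set xs \<Longrightarrow> scalar_rep G omega \<chi> m"
    "\<And>z. z \<in> omega \<Longrightarrow> \<forall>\<chi>\<in>fst ` set xs. \<chi> z = 1 \<Longrightarrow> z = \<one>"
    "sum_list (map snd xs) \<le> r * p ^ ((n - r) div 2)"
    using separating_scalar_reps[OF r] by blast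
  have "sum_list (map snd xs) \<ge> 1
    \<and> (\<exists>\<rho>. \<rho> \<in> hom G (GL (sum_list (map snd xs))) \<and> inj_on \<rho> (carrier G))"
    by (rule faithful_sum_scalar_reps[OF assms]) (erule xs(1), erule (1) xs(2))
  then show ?thesis by blast
qed

text \<open>Such an x lies in the radical of the commutator form of \<chi>. Then \<chi> extends
  invariantly to the group generated by \<Omega> and x, which is at least p times larger, and the
  degree estimate becomes strict.\<close>

lemma scalar_rep_degenerate:
  assumes x: "x \<in> carrier G" "x \<notin> omega" "\<And>g. g \<in> carrier G \<Longrightarrow> g \<otimes> x \<otimes> inv g \<otimes> inv x \<in> omega" "x [^] p \<in> omega"
    and \<chi>: "lin_char G omega \<chi>" and triv: "\<And>g. g \<in> carrier G \<Longrightarrow> \<chi> (g \<otimes> x \<otimes> inv g \<otimes> inv x) = 1"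
    and r: "card omega = p ^ r"
  obtains j where "2 * j + r < n" "scalar_rep G omega \<chi> (p ^ j)"
proof -
  let ?M = "cyclic_ext omega x"
  have p0: "p > 0" using p prime_gt_0_nat by simp
  obtain c where c: "c ^ p = \<chi> (x [^] p)" using complex_nth_root_exists[OF p0] by blast
  have c0: "c \<noteq> 0" using c lin_char_nonzero[OF \<chi> x(4)] p0 by (metis power_eq_0_iff)
  have cd: "\<chi> (x [^] d) = c ^ d" if "x [^] d \<in> omega" for d :: nat
  proof -
    obtain k where k: "d = p * k" using pow_mem_iff[OF omega_subgroup x(1,2,4) \<open>x [^] d \<in> omega\<close>] by blast
    have "\<chi> (x [^] d) = \<chi> ((x [^] p) [^] k)" using k x(1) by (simp add: nat_pow_pow)
    also have "\<dots> = \<chi> (x [^] p) ^ k" by (rule lin_char_pow[OF \<chi> omega_subgroup x(4)])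
    finally show ?thesis using c k by (simp add: power_mult)
  qed
  have norm: "g \<otimes> u \<otimes> inv g \<in> omega" "\<chi> (g \<otimes> u \<otimes> inv g) = \<chi> u" if "g \<in> carrier G" "u \<in> omega" for g u
    using that by (simp_all add: omega_conj)
  obtain \<chi>' where M: "subgroup ?M G" and \<chi>': "lin_char G ?M \<chi>'" and eq: "\<And>u. u \<in> omega \<Longrightarrow> \<chi>' u = \<chi> u"
    using extend_to_cyclic_ext[OF finite_carrier omega_subgroup x(1) norm(1)[OF x(1)] \<chi> norm(2)[OF x(1)] c0 cd] by metis
  have inv: "g \<otimes> u \<otimes> inv g \<in> ?M \<and> \<chi>' (g \<otimes> u \<otimes> inv g) = \<chi>' u" if "g \<in> carrier G" "u \<in> ?M" for g u
    using cyclic_ext_invariant[OF omega_subgroup subgroup_self subgroup.subset[OF omega_subgroup] x(1) norm M \<chi>' eq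
        that(1) x(3)[OF that(1)] that(2)] triv[OF that(1)] by blast
  obtain k where k: "card ?M = p ^ k" using subgroup_card[OF M] by blast
  have oM: "omega \<subseteq> ?M" by (rule cyclic_ext_supset[OF omega_subgroup])
  have "omega \<noteq> ?M" using cyclic_ext_self[OF omega_subgroup x(1)] x(2) by auto
  then have "p * card omega \<le> card ?M" by (rule proper_subgroup_card[OF omega_subgroup M oM])
  then have "p ^ Suc r \<le> p ^ k" using k r by simp
  then have "r < k" using prime_gt_1_nat[OF p] by (simp del: power_Suc)
  obtain j where j: "2 * j + k \<le> n" "scalar_rep G omega \<chi> (p ^ j)"
    using scalar_rep_exists[OF M oM \<chi>' k inv, of \<chi>] eq by metis
  then show ?thesis using that \<open>r < k\<close> by (metis add_less_cancel_left order_less_le_trans)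
qed

lemma exists_central_mod_omega:
  assumes "card omega = p ^ r" "r < n"
  obtains x where "x \<in> carrier G" "x \<notin> omega" "\<And>g. g \<in> carrier G \<Longrightarrow> g \<otimes> x \<otimes> inv g \<otimes> inv x \<in> omega" "x [^] p \<in> omega"
proof -
  have "omega \<noteq> carrier G" using assms order_eq prime_gt_1_nat[OF p] by auto
  then show ?thesis
    using exists_central_mod[OF subgroup_self omega_subgroup subgroup_self subgroup.subset[OF omega_subgroup] order_refl]
      omega_conj that by (metis inv_closed m_closed)
qed

text \<open>If \<open>omega\<close> has index \<open>p\<^sup>2\<close>, the commutators of \<open>G\<close> are generated by a single \<open>c\<close>, so every
  character killing \<open>c\<close> is the restriction of a linear character of \<open>G\<close>.\<close>
theorem rdim_le_index_p2:
  assumes r: "card omega = p ^ r" "1 \<le> r" "n = r + 2"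
  shows "rdim G \<le> p + (r - 1)"
proof -
  obtain x where x: "x \<in> carrier G" "x \<notin> omega"
      "\<And>g. g \<in> carrier G \<Longrightarrow> g \<otimes> x \<otimes> inv g \<otimes> inv x \<in> omega" "x [^] p \<in> omega"
    using exists_central_mod_omega[OF r(1)] r(3) by auto
  define cm where "cm g = g \<otimes> x \<otimes> inv g \<otimes> inv x" for g
  have norm: "x \<otimes> u \<otimes> inv x \<in> omega" if "u \<in> omega" for u using that x(1) by (simp add: omega_conj)
  let ?M = "cyclic_ext omega x"
  have triv: "lin_char G N (\<lambda>_. 1)" for N by (simp add: lin_char_def)
  have M: "subgroup ?M G" by (rule cyclic_ext_subgroup[OF omega_subgroup x(1) norm])
  have oM: "omega \<subseteq> ?M" by (rule cyclic_ext_supset[OF omega_subgroup])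
  have xM: "x \<in> ?M" by (rule cyclic_ext_self[OF omega_subgroup x(1)])
  have "p * card omega \<le> card ?M" using x(2) xM by (intro proper_subgroup_card[OF omega_subgroup M oM]) auto
  then have cM: "p ^ Suc r \<le> card ?M" using r by simp
  have ker: "subgroup {g \<in> carrier G. \<chi> (cm g) = 1} G" "?M \<subseteq> {g \<in> carrier G. \<chi> (cm g) = 1}"
    if \<chi>: "lin_char G omega \<chi>" for \<chi>
  proof -
    have lc: "lin_char G (carrier G) (\<lambda>g. \<chi> (cm g))" unfolding cm_def
      by (rule commutator_lin_char[OF subgroup_self omega_subgroup x(1) _ \<chi> x(3)]) (auto simp: omega_conj)
    show C: "subgroup {g \<in> carrier G. \<chi> (cm g) = 1} G" by (rule lin_char_kernel_subgroup[OF lc subgroup_self])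
    have "cm u = \<one>" if "u \<in> omega" for u
    proof -
      have uc: "u \<in> carrier G" using omega_carrier[OF that] .
      have "cm u = (x \<otimes> u) \<otimes> inv u \<otimes> inv x" using omega_central[OF that x(1)] by (simp add: cm_def)
      then show ?thesis using uc x(1) by (simp add: word_simps)
    qed
    moreover have "cm x = \<one>" using x(1) by (simp add: cm_def m_assoc)
    ultimately show "?M \<subseteq> {g \<in> carrier G. \<chi> (cm g) = 1}"
      using lin_char_one[OF \<chi> omega_subgroup] omega_carrier x(1)
      by (intro cyclic_ext_subset[OF omega_subgroup C]) auto
  qed
  \<comment> \<open>The kernel of \<open>\<lambda>g. \<chi> (cm g)\<close> contains
    \<open>?M\<close>, whose index is at most p. Hence any single y outside \<open>?M\<close>
    decides whether this kernel is the whole group, and the same y serves every \<chi>.\<close>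
  have "\<exists>y\<in>carrier G. \<forall>\<chi>. lin_char G omega \<chi> \<longrightarrow> \<chi> (cm y) = 1 \<longrightarrow> (\<forall>g\<in>carrier G. \<chi> (cm g) = 1)"
  proof (cases "?M = carrier G")
    case True
    then have "\<chi> (cm g) = 1" if "lin_char G omega \<chi>" "g \<in> carrier G" for \<chi> g using ker(2)[OF that(1)] that(2) by auto
    then show ?thesis by blast
  next
    case False
    then obtain y where y: "y \<in> carrier G" "y \<notin> ?M" using subgroup.subset[OF M] by auto
    have "\<chi> (cm g) = 1" if \<chi>: "lin_char G omega \<chi>" "\<chi> (cm y) = 1" and g: "g \<in> carrier G" for \<chi> g
    proof -
      let ?C = "{g \<in> carrier G. \<chi> (cm g) = 1}"
      have "?M \<noteq> ?C" using y \<chi>(2) by auto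
      then have "p * card ?M \<le> card ?C" by (rule proper_subgroup_card[OF M ker[OF \<chi>(1)]])
      moreover have "p * p ^ Suc r \<le> p * card ?M" using cM by (rule mult_le_mono2)
      moreover have "card (carrier G) = p * p ^ Suc r" using order_eq r(3) by simp
      ultimately have "card (carrier G) \<le> card ?C" by linarith
      then have "?C = carrier G" using finite_carrier by (intro card_seteq) auto
      then show ?thesis using g by auto
    qed
    then show ?thesis using y by blast
  qed
  then obtain y where y: "y \<in> carrier G" and yt: "\<And>\<chi> g. lin_char G omega \<chi> \<Longrightarrow> \<chi> (cm y) = 1 \<Longrightarrow> g \<in> carrier G \<Longrightarrow> \<chi> (cm g) = 1"
    by blast
  define c where "c = cm y"
  have c: "c \<in> omega" using x(3) y by (simp add: c_def cm_def)
  have deg1: "scalar_rep G omega \<chi> 1" if \<chi>: "lin_char G omega \<chi>" "\<chi> c = 1" for \<chi>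
  proof -
    have t: "\<chi> (g \<otimes> x \<otimes> inv g \<otimes> inv x) = 1" if "g \<in> carrier G" for g
      using yt[OF \<chi>(1) _ that] \<chi>(2) by (simp add: c_def cm_def)
    obtain j where "2 * j + r < n" "scalar_rep G omega \<chi> (p ^ j)" using scalar_rep_degenerate[OF x \<chi>(1) t r(1)] .
    moreover have "j = 0" using calculation(1) r(3) by simp
    ultimately show ?thesis by simp
  qed
  have one: "subgroup {\<one>} G" by (rule triv_subgroup)
  have oo: "{\<one>} \<subseteq> omega" using subgroup.one_closed[OF omega_subgroup] by simp
  have n1: "n \<ge> 1" and p2: "p \<ge> 2" using r prime_ge_2_nat[OF p] by auto
  show ?thesis
  proof (cases "c = \<one>")
    case True
    obtain cs where cs: "\<And>\<chi>. \<chi> \<in> set cs \<Longrightarrow> lin_char G omega \<chi>"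
      "\<And>z. z \<in> omega \<Longrightarrow> \<forall>\<chi>\<in>set cs. \<chi> z = 1 \<Longrightarrow> z \<in> {\<one>}" "p ^ length cs * card {\<one>} \<le> card omega"
      using omega_separating_chars[OF one omega_subgroup oo order_refl] by metis
    have len: "length cs \<le> r" using cs(3) r(1) prime_gt_1_nat[OF p] by simp
    have d1: "\<exists>m\<le>1. scalar_rep G omega \<chi> m" if "\<chi> \<in> set cs" for \<chi>
      using deg1[OF cs(1)[OF that]] lin_char_one[OF cs(1)[OF that] omega_subgroup] True by auto
    obtain xs where xs: "map fst xs = cs" "\<And>\<chi> m. (\<chi>, m) \<in> set xs \<Longrightarrow> scalar_rep G omega \<chi> m"
      "sum_list (map snd xs) \<le> length cs * 1"
      using scalar_reps_list[OF d1] by blast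
    have "fst ` set xs = set cs" using xs(1) by (metis set_map)
    then have "rdim G \<le> sum_list (map snd xs)"
      using cs(2) by (intro rdim_le_sum_scalar_reps[OF n1 xs(2)]) auto
    then show ?thesis using xs(3) len p2 by linarith
  next
    case False
    have cc: "c \<in> carrier G" using omega_carrier[OF c] .
    \<comment> \<open>The characters in \<open>cs\<close> separate \<Omega> modulo the powers of c:
      there are at most r - 1, each of degree 1. One more character, nontrivial on c and of degree
      at most p, separates the powers of c because c has prime order. The total is p + (r -
      1).\<close>
    let ?D = "cyclic_ext {\<one>} c"
    have D: "subgroup ?D G" by (rule cyclic_ext_subgroup[OF one cc]) (use cc in simp)
    have cD: "c \<in> ?D" by (rule cyclic_ext_self[OF one cc])
    have Do: "?D \<subseteq> omega" by (rule cyclic_ext_subset[OF one omega_subgroup oo c])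
    have oD: "{\<one>} \<subseteq> ?D" by (rule cyclic_ext_supset[OF one])
    have "p * card {\<one>} \<le> card ?D" using cD False by (intro proper_subgroup_card[OF one D oD]) auto
    then have pD: "p \<le> card ?D" by simp
    obtain cs where cs: "\<And>\<chi>. \<chi> \<in> set cs \<Longrightarrow> lin_char G omega \<chi>" "\<And>\<chi> z. \<chi> \<in> set cs \<Longrightarrow> z \<in> ?D \<Longrightarrow> \<chi> z = 1"
      "\<And>z. z \<in> omega \<Longrightarrow> \<forall>\<chi>\<in>set cs. \<chi> z = 1 \<Longrightarrow> z \<in> ?D" "p ^ length cs * card ?D \<le> card omega"
      using omega_separating_chars[OF D omega_subgroup Do order_refl] by metis
    have "p ^ length cs * p \<le> p ^ length cs * card ?D" using pD by simp
    moreover have "p ^ Suc (length cs) = p ^ length cs * p" by simp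
    ultimately have "p ^ Suc (length cs) \<le> p ^ r" using cs(4)[unfolded r(1)] by linarith
    then have len: "length cs \<le> r - 1" using prime_gt_1_nat[OF p] by (auto simp del: power_Suc)
    obtain z :: complex where z: "z ^ p = 1" "z \<noteq> 1" using exists_nontrivial_root_of_unity[OF p2] by metis
    have c1: "c \<notin> {\<one>}" using False by simp
    obtain \<chi>' where X: "lin_char G ?D \<chi>'" "\<chi>' c = z"
      using elementary_char_step[OF omega_subgroup omega_comm omega_pow one oo triv c c1 z(1)] by metis
    obtain \<chi>\<^sub>0 where \<chi>0: "lin_char G omega \<chi>\<^sub>0" "\<chi>\<^sub>0 c = z"
      using extend_elementary_char[OF omega_subgroup omega_comm omega_pow D Do X(1)] X(2) cD by metis
    have d1: "\<exists>m\<le>1. scalar_rep G omega \<chi> m" if "\<chi> \<in> set cs" for \<chi>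
      using deg1[OF cs(1)[OF that]] cs(2)[OF that cD] by auto
    obtain xs where xs: "map fst xs = cs" "\<And>\<chi> m. (\<chi>, m) \<in> set xs \<Longrightarrow> scalar_rep G omega \<chi> m"
      "sum_list (map snd xs) \<le> length cs * 1"
      using scalar_reps_list[OF d1] by blast
    obtain m where m: "m \<le> p ^ ((n - r) div 2)" "scalar_rep G omega \<chi>\<^sub>0 m" using scalar_rep_le[OF \<chi>0(1) r(1)] .
    have fs: "fst ` set ((\<chi>\<^sub>0, m) # xs) = insert \<chi>\<^sub>0 (set cs)" using xs(1) by (metis set_map list.set(2) image_insert fst_conv)
    have "rdim G \<le> sum_list (map snd ((\<chi>\<^sub>0, m) # xs))"
    proof (rule rdim_le_sum_scalar_reps[OF n1])
      show "scalar_rep G omega \<chi> k" if "(\<chi>, k) \<in> set ((\<chi>\<^sub>0, m) # xs)" for \<chi> k using that xs(2) m(2) by auto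
      fix u assume u: "u \<in> omega" "\<forall>\<chi>\<in>fst ` set ((\<chi>\<^sub>0, m) # xs). \<chi> u = 1"
      then have u0: "\<chi>\<^sub>0 u = 1" and "u \<in> ?D" using cs(3)[OF u(1)] unfolding fs by auto
      then obtain i :: nat where i: "u = c [^] i" using cc by (auto simp: cyclic_ext_def)
      have K: "subgroup {v \<in> omega. \<chi>\<^sub>0 v = 1} G" by (rule lin_char_kernel_subgroup[OF \<chi>0(1) omega_subgroup])
      have "p dvd i"
        by (rule pow_mem_iff[OF K cc]) (use z \<chi>0 u0 u(1) i omega_pow[OF c] subgroup.one_closed[OF K] in auto)
      then obtain k where "i = p * k" by blast
      then show "u = \<one>" using i cc omega_pow[OF c] by (simp flip: nat_pow_pow)
    qed
    also have "\<dots> \<le> m + (r - 1)" using xs(3) len by simp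
    also have "m \<le> p" using m(1) r(3) by simp
    finally show ?thesis by simp
  qed
qed

end

section \<open>Groups of order 128\<close>

lemma lin_char_times: "lin_char G H \<chi> \<Longrightarrow> lin_char G H \<psi> \<Longrightarrow> lin_char G H (\<lambda>z. \<chi> z * \<psi> z)"
  by (auto simp: lin_char_def)

context p_group
begin

definition cm :: "'a \<Rightarrow> 'a \<Rightarrow> 'a" where "cm g h = g \<otimes> h \<otimes> inv g \<otimes> inv h"

lemma cm_closed [simp]: "g \<in> carrier G \<Longrightarrow> h \<in> carrier G \<Longrightarrow> cm g h \<in> carrier G"
  by (simp add: cm_def)

lemma cm_inv: "g \<in> carrier G \<Longrightarrow> h \<in> carrier G \<Longrightarrow> inv (cm g h) = cm h g"
  by (simp add: cm_def word_simps)

lemma cm_swap_mem: "g \<in> carrier G \<Longrightarrow> h \<in> carrier G \<Longrightarrow> cm g h \<in> omega \<Longrightarrow> cm h g \<in> omega"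
  using subgroup.m_inv_closed[OF omega_subgroup, of "cm g h"] by (simp add: cm_inv)

text \<open>The factor conjugated by g is \<open>cm h k\<close>, so its centrality is the one that
  is assumed; this form is usable before all commutators are known to be central.\<close>

lemma cm_mult_left:
  assumes "g \<in> carrier G" "h \<in> carrier G" "k \<in> carrier G" "cm h k \<in> omega"
  shows "cm (g \<otimes> h) k = cm h k \<otimes> cm g k"
proof -
  have "cm (g \<otimes> h) k = (g \<otimes> cm h k \<otimes> inv g) \<otimes> cm g k" using assms(1-3) by (simp add: cm_def word_simps)
  then show ?thesis using omega_conj[OF assms(4,1)] by simp
qed

lemma cm_mult_right:
  assumes "g \<in> carrier G" "h \<in> carrier G" "k \<in> carrier G" "cm k h \<in> omega"
  shows "cm k (g \<otimes> h) = cm k g \<otimes> cm k h"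
proof -
  have "cm k (g \<otimes> h) = cm k g \<otimes> (g \<otimes> cm k h \<otimes> inv g)" using assms(1-3) by (simp add: cm_def word_simps)
  then show ?thesis using omega_conj[OF assms(4,1)] by simp
qed

lemma cm_omega:
  assumes "u \<in> omega" "g \<in> carrier G" shows "cm g u = \<one>" "cm u g = \<one>"
proof -
  have uc: "u \<in> carrier G" using omega_carrier[OF assms(1)] .
  have "cm g u = (g \<otimes> u \<otimes> inv g) \<otimes> inv u" by (simp add: cm_def)
  then show 1: "cm g u = \<one>" using omega_conj[OF assms] uc by simp
  have "cm u g = inv (cm g u)" using cm_inv assms(2) uc by simp
  then show "cm u g = \<one>" using 1 by simp
qed

end

text \<open>In this locale every nontrivial character of \<open>omega\<close> lies only under representations of
  the maximal degree 4; this is refuted below.\<close>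
locale fully_ramified_128 = p_group G 2 7 for G (structure) +
  assumes card8: "card omega = 8"
    and no_small: "\<And>\<chi> m. lin_char G omega \<chi> \<Longrightarrow> \<exists>z\<in>omega. \<chi> z \<noteq> 1 \<Longrightarrow> scalar_rep G omega \<chi> m \<Longrightarrow> m > 2"
begin

lemma sq_one: "z \<in> omega \<Longrightarrow> z \<otimes> z = \<one>"
  using omega_pow[of z] omega_carrier[of z] by (simp add: numeral_2_eq_2)

lemma inv_omega: "z \<in> omega \<Longrightarrow> inv z = z"
  using sq_one[of z] omega_carrier[of z] by (simp add: inv_equality)

lemma omega_mult: "z \<in> omega \<Longrightarrow> w \<in> omega \<Longrightarrow> z \<otimes> w \<in> omega"
  by (rule subgroup.m_closed[OF omega_subgroup])

lemma omega_left_comm: "x \<in> omega \<Longrightarrow> y \<in> omega \<Longrightarrow> z \<in> omega \<Longrightarrow> x \<otimes> (y \<otimes> z) = y \<otimes> (x \<otimes> z)"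
  using omega_comm[of x y] omega_carrier by (simp flip: m_assoc)

lemma sq_one_left: "z \<in> omega \<Longrightarrow> w \<in> omega \<Longrightarrow> z \<otimes> (z \<otimes> w) = w"
  using sq_one[of z] omega_carrier by (simp flip: m_assoc)

lemma omega_eq_iff:
  assumes "z \<in> omega" "w \<in> omega" shows "z \<otimes> w = \<one> \<longleftrightarrow> z = w"
proof
  assume "z \<otimes> w = \<one>"
  then have "z \<otimes> w = z \<otimes> z" using sq_one[OF assms(1)] by simp
  then show "z = w" using omega_carrier[OF assms(1)] omega_carrier[OF assms(2)] by simp
qed (use sq_one assms in simp)

text \<open>The central involutions of the quotient by \<Omega>, expressed in G.\<close>

definition central_mod :: "'a \<Rightarrow> bool" where
  "central_mod x \<longleftrightarrow> x \<in> carrier G \<and> x \<notin> omega \<and> (\<forall>g\<in>carrier G. cm g x \<in> omega) \<and> x \<otimes> x \<in> omega"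

text \<open>The commutators with x form a subgroup of \<Omega>. If it were proper, a nontrivial
  character would kill it, x would be in the radical of its form, and 2j + 3 < 7 would give a
  representation of degree at most 2.\<close>

lemma central_mod_onto:
  assumes x: "central_mod x" and z: "z \<in> omega" obtains g where "g \<in> carrier G" "cm g x = z"
proof -
  have xc: "x \<in> carrier G" "x \<notin> omega" "\<And>g. g \<in> carrier G \<Longrightarrow> cm g x \<in> omega" "x \<otimes> x \<in> omega"
    using x by (auto simp: central_mod_def)
  let ?I = "(\<lambda>g. cm g x) ` carrier G"
  have I: "subgroup ?I G"
  proof (rule subgroupI)
    show "?I \<subseteq> carrier G" using xc by auto
    show "?I \<noteq> {}" by auto
  next
    fix a assume "a \<in> ?I"
    moreover have "inv a = a" using calculation xc inv_omega by auto
    ultimately show "inv a \<in> ?I" by simp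
  next
    fix a b assume "a \<in> ?I" "b \<in> ?I"
    then obtain g h where gh: "g \<in> carrier G" "h \<in> carrier G" "a = cm g x" "b = cm h x" by auto
    have "cm (h \<otimes> g) x = a \<otimes> b" using gh xc by (simp add: cm_mult_left)
    then show "a \<otimes> b \<in> ?I" using gh by (metis image_eqI m_closed)
  qed
  have "z \<in> ?I"
  proof (rule ccontr)
    assume zI: "z \<notin> ?I"
    obtain cs where cs: "\<And>\<chi>. \<chi> \<in> set cs \<Longrightarrow> lin_char G omega \<chi>" "\<And>\<chi> z. \<chi> \<in> set cs \<Longrightarrow> z \<in> ?I \<Longrightarrow> \<chi> z = 1"
      "\<And>z. z \<in> omega \<Longrightarrow> \<forall>\<chi>\<in>set cs. \<chi> z = 1 \<Longrightarrow> z \<in> ?I"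
      using omega_separating_chars[OF I omega_subgroup _ order_refl] xc(3) by (metis image_subsetI)
    then obtain \<chi> where \<chi>: "\<chi> \<in> set cs" "\<chi> z \<noteq> 1" using zI z by blast
    have t: "\<chi> (g \<otimes> x \<otimes> inv g \<otimes> inv x) = 1" "g \<otimes> x \<otimes> inv g \<otimes> inv x \<in> omega" if "g \<in> carrier G" for g
      using cs(2)[OF \<chi>(1), of "cm g x"] xc(3) that by (auto simp: cm_def)
    have x2: "x [^] (2::nat) \<in> omega" using xc by (simp add: numeral_2_eq_2)
    have c8: "card omega = 2 ^ 3" using card8 by simp
    obtain j where "2 * j + 3 < 7" "scalar_rep G omega \<chi> (2 ^ j)"
      using scalar_rep_degenerate[OF xc(1,2) t(2) x2 cs(1)[OF \<chi>(1)] t(1) c8] .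
    moreover have "(2::nat) ^ j \<le> 2 ^ 1" using calculation(1) by (intro power_increasing) auto
    ultimately show False using no_small[OF cs(1)[OF \<chi>(1)]] \<chi>(2) z by fastforce
  qed
  then show ?thesis using that by auto
qed

text \<open>Taking the commutator with x is a homomorphism onto \<Omega>, so its kernel has order at
  most 128 / 8 = 16, and \<Omega> together with its coset of x already has 16 elements.\<close>

lemma central_mod_kernel:
  assumes x: "central_mod x" and k: "k \<in> carrier G" "cm k x = \<one>"
  obtains "k \<in> omega" | u where "u \<in> omega" "k = u \<otimes> x"
proof -
  have xc: "x \<in> carrier G" "x \<notin> omega" "\<And>g. g \<in> carrier G \<Longrightarrow> cm g x \<in> omega" "x \<otimes> x \<in> omega"
    using x by (auto simp: central_mod_def)
  let ?K = "{g \<in> carrier G. cm g x = \<one>}"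
  let ?L = "omega \<union> (\<lambda>u. u \<otimes> x) ` omega"
  have "\<exists>g. g \<in> carrier G \<and> cm g x = z" if "z \<in> omega" for z by (rule central_mod_onto[OF x that]) blast
  then have "\<forall>z\<in>omega. \<exists>g. g \<in> carrier G \<and> cm g x = z" by blast
  from bchoice[OF this] obtain s where s: "\<And>z. z \<in> omega \<Longrightarrow> s z \<in> carrier G \<and> cm (s z) x = z" by blast
  have fK: "finite ?K" and fo: "finite omega" using finite_carrier subgroup_finite[OF omega_subgroup] by auto
  have cmks: "cm (k \<otimes> s z) x = z" if "k \<in> ?K" "z \<in> omega" for k z
    using that s[OF that(2)] xc omega_carrier[OF that(2)] by (simp add: cm_mult_left)
  have "inj_on (\<lambda>(k, z). k \<otimes> s z) (?K \<times> omega)"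
  proof (rule inj_onI, clarsimp)
    fix k z k' z' assume a: "k \<in> carrier G" "cm k x = \<one>" "z \<in> omega" "k' \<in> carrier G" "cm k' x = \<one>" "z' \<in> omega"
      "k \<otimes> s z = k' \<otimes> s z'"
    have "z = z'" using cmks[of k z] cmks[of k' z'] a by simp
    then show "k = k' \<and> z = z'" using a s by auto
  qed
  moreover have "(\<lambda>(k, z). k \<otimes> s z) ` (?K \<times> omega) \<subseteq> carrier G" using s by auto
  ultimately have "card (?K \<times> omega) \<le> card (carrier G)" using finite_carrier by (rule card_inj_on_le)
  then have cK: "card ?K \<le> 16" using card8 order_eq by (simp add: card_cartesian_product)
  have "omega \<inter> (\<lambda>u. u \<otimes> x) ` omega = {}"
  proof (rule ccontr)
    assume "\<not> ?thesis"
    then obtain u where u: "u \<in> omega" "u \<otimes> x \<in> omega" by auto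
    then have "inv u \<otimes> (u \<otimes> x) \<in> omega" using omega_mult subgroup.m_inv_closed[OF omega_subgroup] by blast
    then show False using xc u omega_carrier by (simp add: word_simps)
  qed
  moreover have "inj_on (\<lambda>u. u \<otimes> x) omega" using xc omega_carrier by (auto simp: inj_on_def)
  ultimately have "card ?L = 16" using fo card8 by (simp add: card_Un_disjoint card_image)
  moreover have "?L \<subseteq> ?K"
  proof
    fix l assume "l \<in> ?L"
    moreover have "cm x x = \<one>" using xc by (simp add: cm_def m_assoc)
    ultimately show "l \<in> ?K"
      using cm_omega(2) xc omega_carrier subgroup.one_closed[OF omega_subgroup] by (auto simp: cm_mult_left)
  qed
  ultimately have "?L = ?K" using cK fK by (intro card_seteq) auto
  then have "k \<in> ?L" using k by auto
  then show ?thesis using that by auto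
qed

lemma central_mod_exists: obtains x where "central_mod x"
proof -
  obtain x where "x \<in> carrier G" "x \<notin> omega" "\<And>g. g \<in> carrier G \<Longrightarrow> g \<otimes> x \<otimes> inv g \<otimes> inv x \<in> omega" "x [^] (2::nat) \<in> omega"
    using exists_central_mod_omega[of 3] card8 by auto
  then show ?thesis by (intro that[of x]) (auto simp: central_mod_def cm_def numeral_2_eq_2)
qed

lemma central_mod_kernel_central:
  assumes x: "central_mod x" and k: "k \<in> carrier G" "cm k x = \<one>" and g: "g \<in> carrier G"
  shows "cm g k \<in> omega"
proof -
  have xc: "x \<in> carrier G" "\<And>g. g \<in> carrier G \<Longrightarrow> cm g x \<in> omega" using x by (auto simp: central_mod_def)
  show ?thesis
    using x k
  proof (cases rule: central_mod_kernel)
    case 1 then show ?thesis using cm_omega[OF _ g] subgroup.one_closed[OF omega_subgroup] by simp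
  next
    case (2 u)
    then show ?thesis using cm_mult_right[of u x g] cm_omega[OF 2(1) g] xc g omega_carrier[OF 2(1)]
      by (simp add: subgroup.mem_carrier[OF omega_subgroup])
  qed
qed

text \<open>Expanding the commutator of \<open>a\<^sup>2\<close> and \<open>b\<close> in two ways.\<close>
lemma commutator_square_relation:
  assumes x: "central_mod x" and a: "a \<in> carrier G" and b: "b \<in> carrier G" and ab: "cm a b \<notin> omega"
  shows "x \<otimes> x = cm a x \<or> x \<otimes> x = cm a x \<otimes> cm b x"
proof -
  have xc: "x \<in> carrier G" "\<And>g. g \<in> carrier G \<Longrightarrow> cm g x \<in> omega" "x \<otimes> x \<in> omega" using x by (auto simp: central_mod_def)
  note oc = omega_carrier
  have hom: "cm (g \<otimes> h) x = cm h x \<otimes> cm g x" if "g \<in> carrier G" "h \<in> carrier G" for g h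
    using that xc by (simp add: cm_mult_left)
  have inv1: "cm (inv g) x = cm g x" if "g \<in> carrier G" for g
  proof -
    have "cm g x \<otimes> cm (inv g) x = \<one>" using hom[of "inv g" g] that xc by (simp add: cm_def)
    then show ?thesis using omega_eq_iff xc that by (metis inv_closed)
  qed
  \<comment> \<open>The commutator with x is a homomorphism into an abelian group, hence it kills
    \<open>cm a b\<close>; the description of its kernel then gives
    \<open>cm a b = u \<otimes> x\<close>.\<close>
  have "cm (cm a b) x = \<one>"
  proof -
    have e: "cm a b = (a \<otimes> b) \<otimes> (inv a \<otimes> inv b)" using a b by (simp add: cm_def m_assoc)
    show ?thesis unfolding e using a b xc(2)[OF a] xc(2)[OF b]
      by (simp add: hom inv1 m_assoc oc omega_left_comm sq_one sq_one_left omega_mult)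
  qed
  then obtain u where u: "u \<in> omega" "cm a b = u \<otimes> x" using central_mod_kernel[OF x cm_closed[OF a b]] ab by metis
  have uc: "u \<in> carrier G" using oc[OF u(1)] .
  \<comment> \<open>First expansion: [a^2,b] = a[a,b]a^-1 [a,b] with [a,b] = ux, where conjugating x
    by a costs \<open>cm a x\<close>.\<close>
  have "cm (a \<otimes> a) b = a \<otimes> cm a b \<otimes> inv a \<otimes> cm a b" using a b by (simp add: cm_def word_simps)
  also have "\<dots> = (a \<otimes> u \<otimes> inv a) \<otimes> (cm a x \<otimes> x) \<otimes> (u \<otimes> x)"
    unfolding u(2) using a uc xc(1) by (simp add: cm_def word_simps)
  also have "\<dots> = u \<otimes> cm a x \<otimes> (x \<otimes> u) \<otimes> x" using omega_conj[OF u(1) a] uc xc a by (simp add: m_assoc)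
  also have "x \<otimes> u = u \<otimes> x" by (rule omega_central[OF u(1) xc(1)])
  also have "u \<otimes> cm a x \<otimes> (u \<otimes> x) \<otimes> x = (u \<otimes> (cm a x \<otimes> u)) \<otimes> (x \<otimes> x)" using uc xc a by (simp add: m_assoc)
  also have "u \<otimes> (cm a x \<otimes> u) = cm a x" using omega_comm[OF xc(2)[OF a] u(1)] sq_one_left[OF u(1) xc(2)[OF a]] by simp
  finally have L: "cm (a \<otimes> a) b = cm a x \<otimes> (x \<otimes> x)" .
  \<comment> \<open>Second evaluation: the square of a also commutes with x, so it lies in \<Omega>
    or in the coset of x; the two cases give the two alternatives.\<close>
  have aa: "cm (a \<otimes> a) x = \<one>" using hom[OF a a] sq_one[OF xc(2)[OF a]] by simp
  show ?thesis
    using x m_closed[OF a a] aa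
  proof (cases rule: central_mod_kernel)
    case 1
    then have "cm a x \<otimes> (x \<otimes> x) = \<one>" using L cm_omega(2)[OF 1 b] by simp
    then have "cm a x = x \<otimes> x" using omega_eq_iff[OF xc(2)[OF a] xc(3)] by blast
    then show ?thesis by simp
  next
    case (2 v)
    have xb: "cm x b = cm b x" using cm_inv[OF b xc(1)] inv_omega[OF xc(2)[OF b]] by simp
    have "cm (a \<otimes> a) b = cm x b \<otimes> cm v b"
      unfolding 2(2) by (rule cm_mult_left) (use 2 oc xc b xb in auto)
    then have "cm a x \<otimes> (x \<otimes> x) = cm b x" using L xb cm_omega(2)[OF 2(1) b] xc b by simp
    then have "x \<otimes> x = cm a x \<otimes> cm b x" using sq_one_left[OF xc(2)[OF a] xc(3)] by metis
    then show ?thesis by simp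
  qed
qed

text \<open>With A and B the commutators of a and b with x, the square relation for (a,b), (b,a) and
  (a,ab) puts x^2 into {A, AB}, {B, AB} and {A, B}. But A, B and AB are nontrivial, hence pairwise
  distinct: an element commuting with x has all its commutators in \<Omega>.\<close>

lemma commutators_in_omega:
  assumes a: "a \<in> carrier G" and b: "b \<in> carrier G" shows "cm a b \<in> omega"
proof (rule ccontr)
  assume ab: "cm a b \<notin> omega"
  obtain x where x: "central_mod x" using central_mod_exists .
  have xc: "x \<in> carrier G" "\<And>g. g \<in> carrier G \<Longrightarrow> cm g x \<in> omega" using x by (auto simp: central_mod_def)
  have ba: "cm b a \<notin> omega" using ab cm_swap_mem[OF b a] by blast
  have e: "cm a (a \<otimes> b) = a \<otimes> cm a b \<otimes> inv a" using a b by (simp add: cm_def word_simps)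
  have aab: "cm a (a \<otimes> b) \<notin> omega"
  proof
    assume "cm a (a \<otimes> b) \<in> omega"
    from omega_conj[OF this, of "inv a"] have "cm a b = cm a (a \<otimes> b)" unfolding e using a b by (simp add: word_simps)
    then show False using ab \<open>cm a (a \<otimes> b) \<in> omega\<close> by simp
  qed
  let ?A = "cm a x" and ?B = "cm b x"
  have A: "?A \<in> omega" and B: "?B \<in> omega" using xc a b by auto
  have hab: "cm (a \<otimes> b) x = ?A \<otimes> ?B" using cm_mult_left[OF a b xc(1) B] omega_comm[OF A B] by simp
  have nA: "?A \<noteq> \<one>" using central_mod_kernel_central[OF x a _ b] ba by blast
  have nB: "?B \<noteq> \<one>" using central_mod_kernel_central[OF x b _ a] ab by blast
  have nAB: "?A \<otimes> ?B \<noteq> \<one>" using central_mod_kernel_central[OF x m_closed[OF a b] _ a] aab hab by auto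
  have 1: "x \<otimes> x = ?A \<or> x \<otimes> x = ?A \<otimes> ?B" by (rule commutator_square_relation[OF x a b ab])
  have 2: "x \<otimes> x = ?B \<or> x \<otimes> x = ?B \<otimes> ?A" by (rule commutator_square_relation[OF x b a ba])
  have 3: "x \<otimes> x = ?A \<or> x \<otimes> x = ?A \<otimes> (?A \<otimes> ?B)"
    using commutator_square_relation[OF x a m_closed[OF a b] aab] hab by simp
  have "?A \<otimes> (?A \<otimes> ?B) = ?B" by (rule sq_one_left[OF A B])
  moreover have "?A \<otimes> ?B = ?A \<longleftrightarrow> ?B = \<one>" "?A \<otimes> ?B = ?B \<longleftrightarrow> ?A = \<one>" "?B \<otimes> ?A = ?A \<otimes> ?B"
    using a b xc omega_comm[OF A B] by auto
  ultimately show False using 1 2 3 nA nB nAB omega_eq_iff[OF A B] by metis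
qed

text \<open>Commutators are now bilinear with values in exponent 2, so squares are central. In
  particular y^2 commutes with the chosen x and lies in \<Omega> or in its coset of x; in the second
  case x would be central, against surjectivity of its commutator map.\<close>

lemma all_central_mod:
  assumes y: "y \<in> carrier G" "y \<notin> omega" shows "central_mod y"
proof -
  obtain x where x: "central_mod x" using central_mod_exists .
  have xc: "x \<in> carrier G" using x by (auto simp: central_mod_def)
  have yy: "cm g (y \<otimes> y) = \<one>" if "g \<in> carrier G" for g
    using cm_mult_right[OF y(1) y(1) that] commutators_in_omega[OF that y(1)] sq_one by simp
  have "cm (y \<otimes> y) x = \<one>" using yy[OF xc] cm_inv[OF xc m_closed[OF y(1) y(1)]] by simp
  then have "y \<otimes> y \<in> omega"
  proof (cases rule: central_mod_kernel[OF x m_closed[OF y(1) y(1)]])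
    case (3 u)
    have "cm g x = \<one>" if g: "g \<in> carrier G" for g
      using yy[OF g] cm_mult_right[of u x g] cm_omega(1)[OF 3(1) g] 3 g xc omega_carrier[OF 3(1)] commutators_in_omega[OF g xc] by simp
    then have "z = \<one>" if "z \<in> omega" for z using central_mod_onto[OF x that] by metis
    then have "omega \<subseteq> {\<one>}" by blast
    then have "card omega \<le> card {\<one>}" by (intro card_mono) auto
    then show ?thesis using card8 by simp
  qed auto
  then show ?thesis using y commutators_in_omega by (auto simp: central_mod_def)
qed

text \<open>The centraliser of g consists of \<Omega> and its coset of g.\<close>

lemma commute_imp:
  assumes g: "g \<in> carrier G" "g \<notin> omega" and h: "h \<in> carrier G" and c: "cm h g = \<one>" and x: "x \<in> carrier G"
  shows "cm h x = \<one> \<or> cm h x = cm g x"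
  using all_central_mod[OF g] h c
proof (cases rule: central_mod_kernel)
  case 1 then show ?thesis using cm_omega(2)[OF 1 x] by simp
next
  case (2 u)
  have "cm h x = cm g x \<otimes> cm u x" unfolding 2(2)
    by (rule cm_mult_left) (use 2 omega_carrier g x commutators_in_omega in auto)
  then show ?thesis using cm_omega(2)[OF 2(1) x] g x by simp
qed

text \<open>Otherwise \<open>cm g h\<close> lies in the kernel {1, e, e', ee'} of \<psi>. These four
  values would make h and g, hx and g, gx and h, or hx and gx commute. None of these is possible by
  \<open>commute_imp\<close>, since the commutators of the two elements with x are the distinct
  nontrivial e and e'.\<close>

lemma commutator_char_nontrivial:
  assumes x: "central_mod x" and g: "g \<in> carrier G" and h: "h \<in> carrier G"
    and ef: "cm g x = e" "cm h x = e'" "e \<noteq> \<one>" "e' \<noteq> \<one>" "e \<noteq> e'"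
    and \<psi>: "lin_char G omega \<psi>" "\<psi> e = 1" "\<psi> e' = 1" and z: "z \<in> omega" "\<psi> z \<noteq> 1"
  shows "\<psi> (cm g h) = -1"
proof -
  have xc: "x \<in> carrier G" using x by (auto simp: central_mod_def)
  note ci = commutators_in_omega
  have e: "e \<in> omega" and e': "e' \<in> omega" using ef ci g h xc by auto
  have ec: "e \<in> carrier G" "e' \<in> carrier G" using e e' omega_carrier by auto
  let ?K = "{v \<in> omega. \<psi> v = 1}"
  have K: "subgroup ?K G" by (rule lin_char_kernel_subgroup[OF \<psi>(1) omega_subgroup])
  have "2 * card ?K \<le> card omega" by (rule proper_subgroup_card[OF K omega_subgroup]) (use z in auto)
  then have cK: "card ?K \<le> 4" using card8 by simp
  have "e \<otimes> e' \<noteq> \<one>" "e \<otimes> e' \<noteq> e" "e \<otimes> e' \<noteq> e'" using ef omega_eq_iff[OF e e'] ec by auto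
  then have "card {\<one>, e, e', e \<otimes> e'} = 4" using ef by (auto simp: card_insert_if)
  moreover have "{\<one>, e, e', e \<otimes> e'} \<subseteq> ?K"
    using \<psi> e e' omega_mult[OF e e'] lin_char_mult[OF \<psi>(1) e e'] lin_char_one[OF \<psi>(1) omega_subgroup]
      subgroup.one_closed[OF omega_subgroup] by auto
  moreover have "finite ?K" using subgroup_finite[OF K] .
  ultimately have Keq: "?K = {\<one>, e, e', e \<otimes> e'}" using cK by (metis card_seteq)
  have gn: "g \<notin> omega" "h \<notin> omega" using ef cm_omega(2)[OF _ xc] by auto
  have xg: "cm x g = e" "cm x h = e'" using cm_inv g h xc ef inv_omega[OF e] inv_omega[OF e'] by metis+
  have hx: "cm (h \<otimes> x) x = e'" "cm (g \<otimes> x) x = e"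
    using cm_mult_left[OF h xc xc] cm_mult_left[OF g xc xc] ef ci[OF xc xc] ec xc by (simp_all add: cm_def m_assoc)
  have swap: "cm u v = cm v u" if "u \<in> carrier G" "v \<in> carrier G" for u v
    using cm_inv[OF that] inv_omega[OF ci[OF that]] by simp
  have "cm g h \<noteq> \<one>"
  proof
    assume "cm g h = \<one>"
    then have "cm h g = \<one>" using swap g h by simp
    then show False using commute_imp[OF g gn(1) h _ xc] ef by auto
  qed
  moreover have "cm g h \<noteq> e"
  proof
    assume a: "cm g h = e"
    have "cm (h \<otimes> x) g = \<one>"
      using cm_mult_left[OF h xc g ci[OF xc g]] xg swap[OF h g] a sq_one[OF e] by simp
    then show False using commute_imp[OF g gn(1) m_closed[OF h xc] _ xc] hx ef by auto
  qed
  moreover have "cm g h \<noteq> e'"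
  proof
    assume a: "cm g h = e'"
    have "cm (g \<otimes> x) h = \<one>" using cm_mult_left[OF g xc h ci[OF xc h]] xg a sq_one[OF e'] by simp
    then show False using commute_imp[OF h gn(2) m_closed[OF g xc] _ xc] hx ef by auto
  qed
  moreover have "cm g h \<noteq> e \<otimes> e'"
  proof
    assume a: "cm g h = e \<otimes> e'"
    have gx: "g \<otimes> x \<in> carrier G" "g \<otimes> x \<notin> omega" using g xc hx ef cm_omega(2)[OF _ xc] by auto
    have "cm h (g \<otimes> x) = cm h g \<otimes> cm h x" by (rule cm_mult_right[OF g xc h ci[OF h xc]])
    also have "\<dots> = e" using a swap[OF h g] ef sq_one[OF e'] ec by (simp add: m_assoc)
    finally have 1: "cm h (g \<otimes> x) = e" .
    have "cm x (g \<otimes> x) = e" using swap[OF xc gx(1)] hx by simp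
    then have "cm (h \<otimes> x) (g \<otimes> x) = \<one>" using cm_mult_left[OF h xc gx(1) ci[OF xc gx(1)]] 1 sq_one[OF e] by simp
    then show False using commute_imp[OF gx m_closed[OF h xc] _ xc] hx ef by auto
  qed
  ultimately have "cm g h \<notin> ?K" unfolding Keq by auto
  then have n1: "\<psi> (cm g h) \<noteq> 1" using ci[OF g h] by auto
  have "\<psi> (cm g h) * \<psi> (cm g h) = 1"
    using lin_char_mult[OF \<psi>(1) ci[OF g h] ci[OF g h]] sq_one[OF ci[OF g h]] lin_char_one[OF \<psi>(1) omega_subgroup] by simp
  then show ?thesis using n1 by (simp add: square_eq_1_iff)
qed

text \<open>The seven nontrivial characters \<open>\<psi>\<close> of \<open>omega\<close> all take the value \<open>-1\<close> on a commutator; in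
  the product of these seven values every factor occurs an even number of times.\<close>
lemma contradiction: False
proof -
  obtain x where x: "central_mod x" using central_mod_exists .
  have xc: "x \<in> carrier G" using x by (auto simp: central_mod_def)
  note ci = commutators_in_omega
  have one: "subgroup {\<one>} G" by (rule triv_subgroup)
  have oo: "{\<one>} \<subseteq> omega" using subgroup.one_closed[OF omega_subgroup] by simp
  obtain cs where cs: "\<And>\<chi>. \<chi> \<in> set cs \<Longrightarrow> lin_char G omega \<chi>"
    "\<And>z. z \<in> omega \<Longrightarrow> \<forall>\<chi>\<in>set cs. \<chi> z = 1 \<Longrightarrow> z \<in> {\<one>}" "2 ^ length cs * card {\<one>} \<le> card omega"
    using omega_separating_chars[OF one omega_subgroup oo order_refl] by metis
  have "(2::nat) ^ length cs \<le> 2 ^ 3" using cs(3) card8 by simp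
  then have len: "length cs \<le> 3" by (simp only: power_increasing_iff)
  \<comment> \<open>Padding with trivial characters gives exactly three; since 8 elements are
    separated by 8 sign patterns, every pattern then occurs.\<close>
  define ds where "ds = cs @ replicate (3 - length cs) (\<lambda>_. 1)"
  have "length ds = 3" using len by (simp add: ds_def)
  then obtain c1 c2 c3 where ds3: "ds = [c1, c2, c3]"
    by (auto simp: length_Suc_conv numeral_3_eq_3)
  have dl: "lin_char G omega \<chi>" if "\<chi> \<in> set ds" for \<chi> using that cs(1) by (auto simp: ds_def lin_char_def)
  have l1: "lin_char G omega c1" and l2: "lin_char G omega c2" and l3: "lin_char G omega c3" using dl ds3 by auto
  have sep: "z = \<one>" if "z \<in> omega" "c1 z = 1" "c2 z = 1" "c3 z = 1" for z
  proof -
    have "\<forall>\<chi>\<in>set ds. \<chi> z = 1" using that ds3 by simp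
    then show ?thesis using cs(2)[OF that(1)] by (auto simp: ds_def)
  qed
  have pm: "\<chi> z = 1 \<or> \<chi> z = -1" if "lin_char G omega \<chi>" "z \<in> omega" for \<chi> z
    using lin_char_mult[OF that(1,2,2)] sq_one[OF that(2)] lin_char_one[OF that(1) omega_subgroup]
    by (simp add: square_eq_1_iff)
  let ?S = "\<lambda>z. (c1 z, c2 z, c3 z)"
  let ?P = "{1, -1} \<times> {1, -1} \<times> {1, -1} :: (complex \<times> complex \<times> complex) set"
  have inj: "inj_on ?S omega"
  proof (rule inj_onI)
    fix z w assume zw: "z \<in> omega" "w \<in> omega" "?S z = ?S w"
    have m: "\<chi> (z \<otimes> w) = 1" if "lin_char G omega \<chi>" "\<chi> z = \<chi> w" for \<chi>
      using lin_char_mult[OF that(1) zw(1,2)] that(2) pm[OF that(1) zw(2)] by auto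
    have "z \<otimes> w = \<one>" by (rule sep) (use omega_mult[OF zw(1,2)] m l1 l2 l3 zw(3) in auto)
    then show "z = w" using omega_eq_iff[OF zw(1,2)] by simp
  qed
  have cP: "card ?P = 8" by (simp add: card_cartesian_product)
  have "?S ` omega = ?P"
  proof (rule card_seteq)
    show "finite ?P" by simp
    show "?S ` omega \<subseteq> ?P" using pm[OF l1] pm[OF l2] pm[OF l3] by blast
    show "card ?P \<le> card (?S ` omega)" unfolding cP card_image[OF inj] card8 by simp
  qed
  then have ex: "\<exists>z\<in>omega. c1 z = s1 \<and> c2 z = s2 \<and> c3 z = s3" if "(s1, s2, s3) \<in> ?P" for s1 s2 s3
  proof -
    have "(s1, s2, s3) \<in> ?S ` omega" using that \<open>?S ` omega = ?P\<close> by (simp only:)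
    then show ?thesis by blast
  qed
  \<comment> \<open>A basis of \<Omega> dual to \<open>c1\<close>, \<open>c2\<close>,
    \<open>c3\<close>; a, b, c are lifts of it through the commutator with x.\<close>
  obtain u where u: "u \<in> omega" "c1 u = -1" "c2 u = 1" "c3 u = 1" using ex[of "-1" 1 1] by auto
  obtain v where v: "v \<in> omega" "c1 v = 1" "c2 v = -1" "c3 v = 1" using ex[of 1 "-1" 1] by auto
  obtain w where w: "w \<in> omega" "c1 w = 1" "c2 w = 1" "c3 w = -1" using ex[of 1 1 "-1"] by auto
  obtain a where a: "a \<in> carrier G" "cm a x = u" using central_mod_onto[OF x u(1)] .
  obtain b where b: "b \<in> carrier G" "cm b x = v" using central_mod_onto[OF x v(1)] .
  obtain c where c: "c \<in> carrier G" "cm c x = w" using central_mod_onto[OF x w(1)] .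
  have ml: "cm (g \<otimes> h) k = cm h k \<otimes> cm g k" if "g \<in> carrier G" "h \<in> carrier G" "k \<in> carrier G" for g h k
    using cm_mult_left[OF that ci[OF that(2,3)]] .
  have mr: "cm k (g \<otimes> h) = cm k g \<otimes> cm k h" if "g \<in> carrier G" "h \<in> carrier G" "k \<in> carrier G" for g h k
    using cm_mult_right[OF that ci[OF that(3,2)]] .
  have swap: "cm g h = cm h g" if "g \<in> carrier G" "h \<in> carrier G" for g h
    using cm_inv[OF that] inv_omega[OF ci[OF that]] by simp
  have self: "cm g g = \<one>" if "g \<in> carrier G" for g using that by (simp add: cm_def m_assoc)
  let ?al = "cm a b" and ?be = "cm a c" and ?ga = "cm b c"
  note mults = lin_char_mult[OF l1] lin_char_mult[OF l2] lin_char_mult[OF l3]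
  note lt = lin_char_times
  note main = commutator_char_nontrivial[OF x]
  have vw: "cm (b \<otimes> c) x = w \<otimes> v" and uw: "cm (a \<otimes> c) x = w \<otimes> u" and uv: "cm (a \<otimes> b) x = v \<otimes> u"
    using ml a b c xc by auto
  have val: "c1 (w \<otimes> v) = 1" "c2 (w \<otimes> v) = -1" "c3 (w \<otimes> v) = -1" "c1 (w \<otimes> u) = -1" "c2 (w \<otimes> u) = 1" "c3 (w \<otimes> u) = -1"
    "c1 (v \<otimes> u) = -1" "c2 (v \<otimes> u) = -1" "c3 (v \<otimes> u) = 1"
    using u v w by (simp_all add: mults)
  have ne: "y \<noteq> z" if "(c1 y, c2 y, c3 y) \<noteq> (c1 z, c2 z, c3 z)" for y z using that by auto
  have o1: "c1 \<one> = 1" "c2 \<one> = 1" "c3 \<one> = 1"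
    using lin_char_one[OF l1 omega_subgroup] lin_char_one[OF l2 omega_subgroup] lin_char_one[OF l3 omega_subgroup] by auto
  have bc: "b \<otimes> c \<in> carrier G" "a \<otimes> c \<in> carrier G" "a \<otimes> b \<in> carrier G" using a b c by auto
  \<comment> \<open>For each nontrivial product \<psi> of \<open>c1\<close>, \<open>c2\<close>,
    \<open>c3\<close>, the pair is chosen so that its commutators with x generate the kernel of
    \<psi>; the last argument is an element outside that kernel.\<close>
  have e1: "c3 ?al = -1"
    by (rule main[OF a(1) b(1) a(2) b(2) _ _ _ l3 _ _ w(1)]) (auto intro!: ne simp: u v w o1)
  have e2: "c2 ?be = -1"
    by (rule main[OF a(1) c(1) a(2) c(2) _ _ _ l2 _ _ v(1)]) (auto intro!: ne simp: u v w o1)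
  have e3: "c1 ?ga = -1"
    by (rule main[OF b(1) c(1) b(2) c(2) _ _ _ l1 _ _ u(1)]) (auto intro!: ne simp: u v w o1)
  have e4: "c2 (cm a (b \<otimes> c)) * c3 (cm a (b \<otimes> c)) = -1"
    by (rule main[OF a(1) bc(1) a(2) vw _ _ _ lt[OF l2 l3] _ _ w(1)]) (auto intro!: ne simp: u v w o1 val)
  have e5: "c1 (cm b (a \<otimes> c)) * c3 (cm b (a \<otimes> c)) = -1"
    by (rule main[OF b(1) bc(2) b(2) uw _ _ _ lt[OF l1 l3] _ _ w(1)]) (auto intro!: ne simp: u v w o1 val)
  have e6: "c1 (cm c (a \<otimes> b)) * c2 (cm c (a \<otimes> b)) = -1"
    by (rule main[OF c(1) bc(3) c(2) uv _ _ _ lt[OF l1 l2] _ _ u(1)]) (auto intro!: ne simp: u v w o1 val)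
  have e7: "c1 (cm (a \<otimes> b) (b \<otimes> c)) * (c2 (cm (a \<otimes> b) (b \<otimes> c)) * c3 (cm (a \<otimes> b) (b \<otimes> c))) = -1"
    by (rule main[OF bc(3) bc(1) uv vw _ _ _ lt[OF l1 lt[OF l2 l3]] _ _ u(1)]) (auto intro!: ne simp: u v w o1 val)
  have O3: "?al \<in> omega" "?be \<in> omega" "?ga \<in> omega" using ci a b c by auto
  have x4: "cm a (b \<otimes> c) = ?al \<otimes> ?be" using mr a b c by simp
  have x5: "cm b (a \<otimes> c) = ?al \<otimes> ?ga" using mr[of a c b] swap[of b a] a b c by simp
  have x6: "cm c (a \<otimes> b) = ?be \<otimes> ?ga" using mr[of a b c] swap[of c a] swap[of c b] a b c by simp
  have x7: "cm (a \<otimes> b) (b \<otimes> c) = ?ga \<otimes> (?al \<otimes> ?be)"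
    using ml[of a b "b \<otimes> c"] mr[of b c b] mr[of b c a] self[of b] a b c omega_carrier[OF O3(3)] by simp
  have al: "c1 ?al = 1 \<or> c1 ?al = -1" "c2 ?al = 1 \<or> c2 ?al = -1" using pm l1 l2 O3 by auto
  have be: "c1 ?be = 1 \<or> c1 ?be = -1" "c3 ?be = 1 \<or> c3 ?be = -1" using pm l1 l3 O3 by auto
  have ga: "c2 ?ga = 1 \<or> c2 ?ga = -1" "c3 ?ga = 1 \<or> c3 ?ga = -1" using pm l2 l3 O3 by auto
  have O4: "?al \<otimes> ?be \<in> omega" using omega_mult O3 by simp
  \<comment> \<open>Of the nine signs of \<open>c1\<close>, \<open>c2\<close>, \<open>c3\<close> on
    the three commutators, \<open>e1\<close> to \<open>e3\<close> make three equal to -1. Given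
    these, \<open>e4\<close> to \<open>e6\<close> say that the other six multiply in disjoint pairs
    to -1. So the product of all nine is 1, while \<open>e7\<close> says that it is -1.\<close>
  show False
    using e1 e2 e3 e4 e5 e6 e7 al be ga O3 O4 unfolding x4 x5 x6 x7 by (auto simp: mults)
qed

end

context p_group
begin

text \<open>One nontrivial character of degree at most 2 exists, and two characters of degree at
  most 4 separate its kernel, which has at most 4 elements: 2 + 4 + 4.\<close>

theorem rdim_le_128:
  assumes p2: "p = 2" and n7: "n = 7" and r: "card omega = p ^ 3"
  shows "rdim G \<le> 10"
proof -
  have "\<exists>\<chi> m. lin_char G omega \<chi> \<and> (\<exists>z\<in>omega. \<chi> z \<noteq> 1) \<and> scalar_rep G omega \<chi> m \<and> m \<le> 2"
  proof (rule ccontr)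
    assume no: "\<not> ?thesis"
    have X: "p_group G 2 7" using p_group_axioms unfolding p2 n7 .
    have r8: "card omega = 8" using r p2 by simp
    have oeq: "p_group.omega G 2 = omega" unfolding p2 ..
    have "fully_ramified_128 G"
    proof (intro fully_ramified_128.intro fully_ramified_128_axioms.intro X)
      show "card (p_group.omega G 2) = 8" unfolding oeq by (rule r8)
      show "2 < m" if "lin_char G (p_group.omega G 2) \<chi>" "\<exists>z\<in>p_group.omega G 2. \<chi> z \<noteq> 1"
        "scalar_rep G (p_group.omega G 2) \<chi> m" for \<chi> m
        using that no unfolding oeq by (meson not_le)
    qed
    then show False by (rule fully_ramified_128.contradiction)
  qed
  then obtain \<chi> m z where \<chi>: "lin_char G omega \<chi>" "z \<in> omega" "\<chi> z \<noteq> 1" "scalar_rep G omega \<chi> m" "m \<le> 2" by blast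
  let ?K = "{v \<in> omega. \<chi> v = 1}"
  have K: "subgroup ?K G" by (rule lin_char_kernel_subgroup[OF \<chi>(1) omega_subgroup])
  have "p * card ?K \<le> card omega" by (rule proper_subgroup_card[OF K omega_subgroup]) (use \<chi> in auto)
  then have cK: "card ?K \<le> 4" using r p2 by simp
  have one: "subgroup {\<one>} G" by (rule triv_subgroup)
  have oK: "{\<one>} \<subseteq> ?K" using subgroup.one_closed[OF K] by simp
  obtain cs where cs: "\<And>\<chi>. \<chi> \<in> set cs \<Longrightarrow> lin_char G omega \<chi>"
    "\<And>z. z \<in> ?K \<Longrightarrow> \<forall>\<chi>\<in>set cs. \<chi> z = 1 \<Longrightarrow> z \<in> {\<one>}" "p ^ length cs * card {\<one>} \<le> card ?K"
  proof (rule omega_separating_chars[OF one K oK])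
    show "?K \<subseteq> omega" by blast
  qed (rule that)
  have "(2::nat) ^ length cs \<le> 2 ^ 2" using cs(3) cK p2 by simp
  then have len: "length cs \<le> 2" by (simp only: power_increasing_iff)
  have d4: "\<exists>m\<le>4. scalar_rep G omega \<chi> m" if "\<chi> \<in> set cs" for \<chi>
    using scalar_rep_le[OF cs(1)[OF that] r] p2 n7 by auto
  obtain xs where xs: "map fst xs = cs" "\<And>\<chi> m. (\<chi>, m) \<in> set xs \<Longrightarrow> scalar_rep G omega \<chi> m"
    "sum_list (map snd xs) \<le> length cs * 4"
    using scalar_reps_list[OF d4] by blast
  have fs: "fst ` set ((\<chi>, m) # xs) = insert \<chi> (set cs)" using xs(1) by (metis set_map list.set(2) image_insert fst_conv)
  have "rdim G \<le> sum_list (map snd ((\<chi>, m) # xs))"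
  proof (rule rdim_le_sum_scalar_reps)
    show "n \<ge> 1" using n7 by simp
    show "scalar_rep G omega \<psi> k" if "(\<psi>, k) \<in> set ((\<chi>, m) # xs)" for \<psi> k using that xs(2) \<chi>(4) by auto
    fix u assume u: "u \<in> omega" "\<forall>\<chi>\<in>fst ` set ((\<chi>, m) # xs). \<chi> u = 1"
    then show "u = \<one>" using cs(2)[of u] unfolding fs by auto
  qed
  also have "\<dots> \<le> 10" using xs(3) len \<chi>(5) by simp
  finally show ?thesis .
qed

end

section \<open>Eigenvectors of abelian subgroups\<close>

text \<open>If m < k, pad both factors with zeros to size k. Then AB = 1 forces BA = 1, although the
  last row of BA vanishes.\<close>

lemma left_inverse_dim_le:
  fixes L V :: "nat \<Rightarrow> nat \<Rightarrow> complex"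
  assumes LV: "\<And>i j. i < k \<Longrightarrow> j < k \<Longrightarrow> (\<Sum>c<m. L i c * V c j) = (if i = j then 1 else 0)"
  shows "k \<le> m"
proof (rule ccontr)
  assume "\<not> k \<le> m"
  then have mk: "m < k" by simp
  define A where "A = mat k k (\<lambda>(i,c). if c < m then L i c else 0)"
  define B where "B = mat k k (\<lambda>(c,j). if c < m then V c j else 0)"
  have AB: "A \<in> carrier_mat k k" "B \<in> carrier_mat k k" by (simp_all add: A_def B_def)
  have "A * B = 1\<^sub>m k"
  proof (rule eq_matI)
    fix i j assume "i < dim_row (1\<^sub>m k :: complex mat)" "j < dim_col (1\<^sub>m k :: complex mat)"
    then have ij: "i < k" "j < k" by auto
    have "(A * B) $$ (i,j) = (\<Sum>c<k. (if c < m then L i c else 0) * (if c < m then V c j else 0))"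
      using ij by (simp add: A_def B_def scalar_prod_def atLeast0LessThan)
    also have "\<dots> = (\<Sum>c<m. L i c * V c j)"
      using mk by (intro sum.mono_neutral_cong_right) auto
    finally show "(A * B) $$ (i,j) = 1\<^sub>m k $$ (i,j)" using LV[OF ij] ij by simp
  qed (simp_all add: A_def B_def)
  then have "B * A = 1\<^sub>m k" using mat_mult_left_right_inverse[OF AB] by simp
  then have "(B * A) $$ (k - 1, k - 1) = 1" using mk by simp
  moreover have "(B * A) $$ (k - 1, k - 1) = 0"
    using mk by (auto simp: A_def B_def scalar_prod_def intro!: sum.neutral)
  ultimately show False by simp
qed

lemma sum_shift_Suc:
  fixes g :: "nat \<Rightarrow> complex"
  shows "(\<Sum>j<N. g (Suc j)) + g 0 = (\<Sum>j<N. g j) + g N"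
  by (induction N) (simp_all add: algebra_simps)

lemma sum_shift_cyclic:
  fixes g :: "nat \<Rightarrow> complex"
  assumes "g N = g 0" shows "(\<Sum>j<N. g (Suc j)) = (\<Sum>j<N. g j)"
  using sum_shift_Suc[where g = g and N = N] assms by simp

lemma cis_root_neq_1:
  assumes "0 < j" "j < N" shows "cis (2 * pi * real j / real N) \<noteq> 1"
proof -
  have "inj_on (\<lambda>k. cis (2 * pi * real k / real N)) {..<N}"
    using bij_betw_roots_unity[of N] assms by (auto simp: bij_betw_def)
  from inj_onD[OF this, of j 0] show ?thesis using assms by auto
qed

locale matrix_rep = group G for G (structure) +
  fixes \<rho> :: "'a \<Rightarrow> complex mat" and m :: nat
  assumes rep: "\<rho> \<in> hom G (GL m)" and finG: "finite (carrier G)"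
begin

text \<open>Vectors are functions vanishing from m on, so that equality of vectors is equality of
  functions.\<close>

definition vs :: "(nat \<Rightarrow> complex) set" where "vs = {v. \<forall>i\<ge>m. v i = 0}"

definition T :: "'a \<Rightarrow> (nat \<Rightarrow> complex) \<Rightarrow> nat \<Rightarrow> complex" where
  "T g v = (\<lambda>i. if i < m then \<Sum>j<m. \<rho> g $$ (i,j) * v j else 0)"

definition eig :: "'a \<Rightarrow> complex \<Rightarrow> (nat \<Rightarrow> complex) \<Rightarrow> bool" where
  "eig g \<mu> v \<longleftrightarrow> T g v = (\<lambda>i. \<mu> * v i)"

lemma rho_carrier: "g \<in> carrier G \<Longrightarrow> \<rho> g \<in> carrier_mat m m"
  using hom_in_carrier[OF rep] by simp

lemma T_vs: "T g v \<in> vs" by (simp add: T_def vs_def)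

lemma T_mult:
  assumes "g \<in> carrier G" "h \<in> carrier G"
  shows "T (g \<otimes> h) v = T g (T h v)"
proof
  fix i
  show "T (g \<otimes> h) v i = T g (T h v) i"
  proof (cases "i < m")
    case True
    have e: "\<rho> (g \<otimes> h) = \<rho> g * \<rho> h" using hom_mult[OF rep assms] by simp
    have "T (g \<otimes> h) v i = (\<Sum>j<m. (\<Sum>k<m. \<rho> g $$ (i,k) * \<rho> h $$ (k,j)) * v j)"
      using True rho_carrier[OF assms(1)] rho_carrier[OF assms(2)]
      by (auto simp: T_def e scalar_prod_def atLeast0LessThan intro!: sum.cong)
    also have "\<dots> = (\<Sum>j<m. \<Sum>k<m. \<rho> g $$ (i,k) * (\<rho> h $$ (k,j) * v j))"
      by (simp add: sum_distrib_right mult.assoc)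
    also have "\<dots> = (\<Sum>k<m. \<Sum>j<m. \<rho> g $$ (i,k) * (\<rho> h $$ (k,j) * v j))" by (rule sum.swap)
    also have "\<dots> = T g (T h v) i" using True by (simp add: T_def sum_distrib_left)
    finally show ?thesis .
  qed (simp add: T_def)
qed

lemma T_one: "v \<in> vs \<Longrightarrow> T \<one> v = v"
proof
  fix i assume v: "v \<in> vs"
  have "(\<Sum>j<m. 1\<^sub>m m $$ (i,j) * v j) = (\<Sum>j<m. if j = i then v i else 0)" if "i < m"
    using that by (intro sum.cong) auto
  then show "T \<one> v i = v i" using v by (auto simp: T_def hom_GL_one[OF rep] vs_def)
qed

lemma T_sum: "T g (\<lambda>i. \<Sum>a\<in>A. c a * w a i) = (\<lambda>i. \<Sum>a\<in>A. c a * T g (w a) i)"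
proof
  fix i
  have "(\<Sum>j<m. \<rho> g $$ (i,j) * (\<Sum>a\<in>A. c a * w a j)) = (\<Sum>j<m. \<Sum>a\<in>A. c a * (\<rho> g $$ (i,j) * w a j))"
    by (simp add: sum_distrib_left mult_ac)
  also have "\<dots> = (\<Sum>a\<in>A. \<Sum>j<m. c a * (\<rho> g $$ (i,j) * w a j))" by (rule sum.swap)
  finally show "T g (\<lambda>i. \<Sum>a\<in>A. c a * w a i) i = (\<Sum>a\<in>A. c a * T g (w a) i)"
    by (simp add: T_def sum_distrib_left)
qed

lemma T_scale: "T g (\<lambda>i. c * v i) = (\<lambda>i. c * T g v i)"
  using T_sum[of g "\<lambda>_. c" "\<lambda>_. v" "{()}"] by simp

lemma T_zero: "T g (\<lambda>_. 0) = (\<lambda>_. 0)"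
  by (simp add: T_def fun_eq_iff)

lemma eig_unique: "eig g \<mu> v \<Longrightarrow> eig g \<nu> v \<Longrightarrow> v \<noteq> (\<lambda>_. 0) \<Longrightarrow> \<mu> = \<nu>"
  by (auto simp: eig_def fun_eq_iff)

lemma eig_mult:
  assumes "eig g \<mu> v" "eig h \<nu> v" "g \<in> carrier G" "h \<in> carrier G" shows "eig (g \<otimes> h) (\<mu> * \<nu>) v"
  using assms by (simp add: eig_def T_mult T_scale mult_ac)

lemma eig_char:
  assumes A: "subgroup A G" and v: "v \<in> vs" "v \<noteq> (\<lambda>_. 0)" and e: "\<And>a. a \<in> A \<Longrightarrow> eig a (\<mu> a) v"
  shows "lin_char G A \<mu>"
proof -
  note ac = subgroup.mem_carrier[OF A]
  have mult: "\<mu> (x \<otimes> y) = \<mu> x * \<mu> y" if "x \<in> A" "y \<in> A" for x y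
    using eig_unique[OF e[OF subgroup.m_closed[OF A that]] eig_mult[OF e e] v(2)] that ac by blast
  have "eig \<one> 1 v" using T_one[OF v(1)] by (simp add: eig_def)
  then have one: "\<mu> \<one> = 1" using eig_unique[OF e[OF subgroup.one_closed[OF A]] _ v(2)] by blast
  have "\<mu> x \<noteq> 0" if x: "x \<in> A" for x
    using mult[OF x subgroup.m_inv_closed[OF A x]] one ac[OF x] by auto
  then show ?thesis using mult by (simp add: lin_char_def)
qed

text \<open>The averages of \<open>\<rho>\<close> over the \<open>A i\<close>, weighted by \<open>\<mu> i\<close>, are biorthogonal to the vectors \<open>v i\<close>.\<close>
theorem card_eigenvectors_le:
  assumes I: "finite I" and A: "\<And>i. i \<in> I \<Longrightarrow> subgroup (A i) G"
    and v: "\<And>i. i \<in> I \<Longrightarrow> v i \<in> vs \<and> v i \<noteq> (\<lambda>_. 0)"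
    and e: "\<And>i a. i \<in> I \<Longrightarrow> a \<in> A i \<Longrightarrow> eig a (\<mu> i a) (v i)"
    and sep: "\<And>i j. i \<in> I \<Longrightarrow> j \<in> I \<Longrightarrow> i \<noteq> j \<Longrightarrow> \<exists>b\<in>A i. \<exists>\<nu>. \<nu> \<noteq> \<mu> i b \<and> eig b \<nu> (v j)"
  shows "card I \<le> m"
proof -
  \<comment> \<open>Up to the factor \<open>card (A i)\<close>, the projection onto the eigenspace
    of \<open>A i\<close> for the character \<open>\<mu> i\<close>.\<close>
  define Q where "Q i w = (\<lambda>k. \<Sum>a\<in>A i. \<mu> i (inv a) * T a w k)" for i w
  have \<mu>: "lin_char G (A i) (\<mu> i)" if "i \<in> I" for i using eig_char[OF A[OF that]] v[OF that] e[OF that] by blast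
  have fA: "finite (A i)" if "i \<in> I" for i using A[OF that] finG by (meson finite_subset subgroup.subset)
  have Qii: "Q i (v i) = (\<lambda>k. of_nat (card (A i)) * v i k)" if i: "i \<in> I" for i
  proof
    fix k
    have "\<mu> i (inv a) * T a (v i) k = v i k" if a: "a \<in> A i" for a
    proof -
      have "T a (v i) k = \<mu> i a * v i k" using e[OF i a] by (simp add: eig_def)
      then show ?thesis using lin_char_inv[OF \<mu>[OF i] A[OF i] a] lin_char_nonzero[OF \<mu>[OF i] a] by simp
    qed
    then show "Q i (v i) k = of_nat (card (A i)) * v i k" by (simp add: Q_def)
  qed
  have QT: "Q i (T b w) = (\<lambda>k. \<mu> i b * Q i w k)" if i: "i \<in> I" and b: "b \<in> A i" for i b w
  proof
    fix k
    note ac = subgroup.mem_carrier[OF A[OF i]]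
    have "Q i (T b w) k = (\<Sum>a\<in>A i. \<mu> i (inv a) * T (a \<otimes> b) w k)"
      unfolding Q_def using ac b by (intro sum.cong) (auto simp: T_mult)
    also have "\<dots> = (\<Sum>a\<in>A i. \<mu> i b * (\<mu> i (inv (a \<otimes> b)) * T (a \<otimes> b) w k))"
    proof (intro sum.cong refl)
      fix a assume a: "a \<in> A i"
      have "inv a = b \<otimes> inv (a \<otimes> b)" using ac a b by (simp add: word_simps)
      then have "\<mu> i (inv a) = \<mu> i b * \<mu> i (inv (a \<otimes> b))"
        using lin_char_mult[OF \<mu>[OF i] b, of "inv (a \<otimes> b)"] subgroup.m_inv_closed[OF A[OF i]] subgroup.m_closed[OF A[OF i] a b] by simp
      then show "\<mu> i (inv a) * T (a \<otimes> b) w k = \<mu> i b * (\<mu> i (inv (a \<otimes> b)) * T (a \<otimes> b) w k)" by simp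
    qed
    also have "\<dots> = (\<Sum>a\<in>A i. \<mu> i b * (\<mu> i (inv a) * T a w k))"
    proof (rule sum.reindex_bij_betw)
      show "bij_betw (\<lambda>a. a \<otimes> b) (A i) (A i)"
        by (rule bij_betw_byWitness[where f' = "\<lambda>a. a \<otimes> inv b"])
          (use ac b subgroup.m_closed[OF A[OF i]] subgroup.m_inv_closed[OF A[OF i]] in \<open>auto simp: word_simps\<close>)
    qed
    finally show "Q i (T b w) k = \<mu> i b * Q i w k" by (simp add: Q_def sum_distrib_left)
  qed
  \<comment> \<open>Applying \<open>Q i\<close> after \<open>T b\<close> multiplies by
    \<open>\<mu> i b\<close> on one reading and by the eigenvalue \<nu> of \<open>v j\<close> on the
    other.\<close>
  have Qij: "Q i (v j) = (\<lambda>_. 0)" if ij: "i \<in> I" "j \<in> I" "i \<noteq> j" for i j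
  proof -
    obtain b \<nu> where b: "b \<in> A i" "\<nu> \<noteq> \<mu> i b" "eig b \<nu> (v j)" using sep[OF ij] by blast
    have "Q i (T b (v j)) = (\<lambda>k. \<nu> * Q i (v j) k)"
      using b(3) by (simp add: eig_def Q_def T_scale sum_distrib_left mult_ac)
    then have "\<mu> i b * Q i (v j) k = \<nu> * Q i (v j) k" for k
      using QT[OF ij(1) b(1), of "v j"] by metis
    then show ?thesis using b(2) by (metis mult_cancel_right)
  qed
  have "\<exists>k<m. v i k \<noteq> 0" if "i \<in> I" for i
  proof -
    obtain k where k: "v i k \<noteq> 0" using v[OF \<open>i \<in> I\<close>] by blast
    then have "k < m" using v[OF \<open>i \<in> I\<close>] by (auto simp: vs_def not_le[symmetric] simp del: not_le)
    then show ?thesis using k by blast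
  qed
  then have "\<forall>i\<in>I. \<exists>k. k < m \<and> v i k \<noteq> 0" by blast
  from bchoice[OF this] obtain k where k: "\<And>i. i \<in> I \<Longrightarrow> k i < m \<and> v i (k i) \<noteq> 0" by blast
  \<comment> \<open>Row \<open>k i\<close> of the projection, at a coordinate where
    \<open>v i\<close> does not vanish, scaled to take the value 1 on \<open>v i\<close>.\<close>
  define L where "L i c = (\<Sum>a\<in>A i. \<mu> i (inv a) * \<rho> a $$ (k i, c)) / (of_nat (card (A i)) * v i (k i))" for i c
  have LQ: "(\<Sum>c<m. L i c * w c) = Q i w (k i) / (of_nat (card (A i)) * v i (k i))" if i: "i \<in> I" for i w
  proof -
    have "(\<Sum>c<m. (\<Sum>a\<in>A i. \<mu> i (inv a) * \<rho> a $$ (k i, c)) * w c) = (\<Sum>c<m. \<Sum>a\<in>A i. \<mu> i (inv a) * (\<rho> a $$ (k i, c) * w c))"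
      by (simp add: sum_distrib_right mult.assoc)
    also have "\<dots> = (\<Sum>a\<in>A i. \<Sum>c<m. \<mu> i (inv a) * (\<rho> a $$ (k i, c) * w c))" by (rule sum.swap)
    also have "\<dots> = Q i w (k i)" using k[OF i] by (simp add: Q_def T_def sum_distrib_left)
    finally show ?thesis unfolding L_def by (simp only: times_divide_eq_left sum_divide_distrib[symmetric])
  qed
  obtain h where h: "bij_betw h {..<card I} I"
    using ex_bij_betw_nat_finite[OF I] by (metis atLeast0LessThan)
  have hI: "h i \<in> I" if "i < card I" for i using h that by (auto simp: bij_betw_def)
  show ?thesis
  proof (rule left_inverse_dim_le[where L = "\<lambda>i. L (h i)" and V = "\<lambda>c j. v (h j) c"])
    fix i j assume ij: "i < card I" "j < card I"
    show "(\<Sum>c<m. L (h i) c * v (h j) c) = (if i = j then 1 else 0)"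
    proof (cases "i = j")
      case True
      have "card (A (h i)) \<noteq> 0"
        using fA[OF hI[OF ij(1)]] subgroup.one_closed[OF A[OF hI[OF ij(1)]]] by (metis card_eq_0_iff empty_iff)
      then show ?thesis using True LQ[OF hI[OF ij(1)]] Qii[OF hI[OF ij(1)]] k[OF hI[OF ij(1)]] by simp
    next
      case False
      then have "h i \<noteq> h j" using h ij by (auto simp: bij_betw_def inj_on_def)
      then show ?thesis using False LQ[OF hI[OF ij(1)]] Qij hI ij by simp
    qed
  qed
qed

text \<open>A discrete Fourier transform over the powers of s: W_i = \<Sum>_j z^(ij) s^j w with z a
  primitive N-th root of unity. It replaces diagonalisation, and everything commuting with s keeps
  its eigenvalue on each component.\<close>

lemma spectral_components:
  assumes s: "s \<in> carrier G" and w: "w \<in> vs"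
  obtains W N \<omega> where "N > 0" "\<And>i. i < N \<Longrightarrow> W i \<in> vs" "\<And>i. i < N \<Longrightarrow> eig s (\<omega> i) (W i)"
    "\<And>k. (\<Sum>i<N. W i k) = of_nat N * w k"
    "\<And>i b \<nu>. i < N \<Longrightarrow> b \<in> carrier G \<Longrightarrow> b \<otimes> s = s \<otimes> b \<Longrightarrow> eig b \<nu> w \<Longrightarrow> eig b \<nu> (W i)"
proof -
  define N where "N = Coset.order G"
  have N: "N > 0" "s [^] N = \<one>" using finG pow_order_eq_1[OF s] order_gt_0_iff_finite N_def by auto
  define z where "z = cis (2 * pi / real N)"
  have zN: "z ^ N = 1" using N by (simp add: z_def DeMoivre)
  have z0: "z \<noteq> 0" by (simp add: z_def)
  define W where "W i = (\<lambda>k. \<Sum>j<N. z ^ (i * j) * T (s [^] j) w k)" for i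
  have Wvs: "W i \<in> vs" for i using T_vs by (auto simp: W_def vs_def)
  have shift: "(\<Sum>j<N. z ^ (i * Suc j) * T (s [^] Suc j) w k) = W i k" for i k
  proof -
    let ?g = "\<lambda>j. z ^ (i * j) * T (s [^] j) w k"
    have "?g N = ?g 0" using N zN by (simp add: mult.commute[of i] power_mult)
    then have "(\<Sum>j<N. ?g (Suc j)) = (\<Sum>j<N. ?g j)" by (rule sum_shift_cyclic[of ?g])
    then show ?thesis by (simp only: W_def)
  qed
  have We: "eig s (inverse (z ^ i)) (W i)" for i
  proof -
    have "T s (W i) = (\<lambda>k. \<Sum>j<N. z ^ (i * j) * T (s [^] Suc j) w k)"
      unfolding W_def T_sum using s by (simp only: T_mult[symmetric] nat_pow_closed nat_pow_Suc2)
    also have "\<dots> = (\<lambda>k. \<Sum>j<N. inverse (z ^ i) * (z ^ (i * Suc j) * T (s [^] Suc j) w k))"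
      using z0 by (intro ext sum.cong) (auto simp: power_add)
    also have "\<dots> = (\<lambda>k. inverse (z ^ i) * W i k)" by (simp only: sum_distrib_left[symmetric] shift)
    finally show ?thesis by (simp add: eig_def)
  qed
  have Wsum: "(\<Sum>i<N. W i k) = of_nat N * w k" for k
  proof -
    have g: "(\<Sum>i<N. z ^ (i * j)) = (if j = 0 then of_nat N else 0)" if j: "j < N" for j
    proof (cases "j = 0")
      case False
      have "z ^ j = cis (2 * pi * real j / real N)" by (simp add: z_def DeMoivre mult_ac)
      then have zj: "z ^ j \<noteq> 1" using cis_root_neq_1 False j by simp
      have "(\<Sum>i<N. z ^ (i * j)) = (\<Sum>i<N. (z ^ j) ^ i)"
        by (intro sum.cong refl) (metis mult.commute power_mult)
      also have "\<dots> = ((z ^ j) ^ N - 1) / (z ^ j - 1)" using zj by (rule geometric_sum)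
      also have "(z ^ j) ^ N = 1" using zN by (metis mult.commute power_mult power_one)
      finally show ?thesis using False by simp
    qed simp
    have "(\<Sum>i<N. W i k) = (\<Sum>j<N. (\<Sum>i<N. z ^ (i * j)) * T (s [^] j) w k)"
      unfolding W_def sum_distrib_right by (rule sum.swap)
    also have "\<dots> = (\<Sum>j<N. if j = 0 then of_nat N * w k else 0)"
      using T_one[OF w] by (intro sum.cong) (auto simp: g)
    also have "\<dots> = of_nat N * w k" using N by simp
    finally show ?thesis .
  qed
  have Wb: "eig b \<nu> (W i)" if b: "b \<in> carrier G" "b \<otimes> s = s \<otimes> b" "eig b \<nu> w" for i b \<nu>
  proof -
    have c: "b \<otimes> s [^] j = s [^] j \<otimes> b" for j :: nat
    proof (induction j)
      case (Suc j)
      have "b \<otimes> s [^] Suc j = (b \<otimes> s [^] j) \<otimes> s" using b s by (simp add: m_assoc)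
      also have "\<dots> = s [^] j \<otimes> (b \<otimes> s)" unfolding Suc using b s by (simp add: m_assoc)
      also have "\<dots> = s [^] Suc j \<otimes> b" unfolding b(2) using b s by (simp add: m_assoc)
      finally show ?case .
    qed (use b in simp)
    have "T b (T (s [^] j) w) = (\<lambda>k. \<nu> * T (s [^] j) w k)" for j :: nat
    proof -
      have "T b (T (s [^] j) w) = T (s [^] j \<otimes> b) w" using b s by (simp add: T_mult[symmetric] c)
      also have "\<dots> = T (s [^] j) (\<lambda>i. \<nu> * w i)" using b s by (simp add: T_mult eig_def)
      finally show ?thesis by (simp add: T_scale)
    qed
    then have "T b (W i) = (\<lambda>k. \<Sum>j<N. z ^ (i * j) * (\<nu> * T (s [^] j) w k))" unfolding W_def T_sum by simp
    then show ?thesis by (simp add: eig_def W_def sum_distrib_left mult_ac)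
  qed
  show ?thesis using that[OF N(1) Wvs We Wsum Wb] by blast
qed

text \<open>Pass to a nonzero spectral component for one element of A after another; eigenvalues
  already obtained survive because A is abelian.\<close>

lemma eigenvector_refine:
  assumes A: "subgroup A G" and comm: "\<And>a b. a \<in> A \<Longrightarrow> b \<in> A \<Longrightarrow> a \<otimes> b = b \<otimes> a"
    and w: "w \<in> vs" "w \<noteq> (\<lambda>_. 0)"
  obtains w' \<mu> where "w' \<in> vs" "w' \<noteq> (\<lambda>_. 0)" "\<And>a. a \<in> A \<Longrightarrow> eig a (\<mu> a) w'"
    "\<And>b \<nu>. b \<in> A \<Longrightarrow> eig b \<nu> w \<Longrightarrow> eig b \<nu> w'"
proof -
  note ac = subgroup.mem_carrier[OF A]
  have "finite A" using finG subgroup.subset[OF A] by (rule rev_finite_subset)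
  moreover have "finite S \<Longrightarrow> S \<subseteq> A \<Longrightarrow> \<exists>w'. w' \<in> vs \<and> w' \<noteq> (\<lambda>_. 0) \<and> (\<forall>a\<in>S. \<exists>\<mu>. eig a \<mu> w') \<and> (\<forall>b\<in>A. \<forall>\<nu>. eig b \<nu> w \<longrightarrow> eig b \<nu> w')" for S
  proof (induction S rule: finite_induct)
    case empty then show ?case using w by auto
  next
    case (insert s S)
    then obtain w1 where w1: "w1 \<in> vs" "w1 \<noteq> (\<lambda>_. 0)" "\<forall>a\<in>S. \<exists>\<mu>. eig a \<mu> w1" "\<forall>b\<in>A. \<forall>\<nu>. eig b \<nu> w \<longrightarrow> eig b \<nu> w1"
      by auto
    have sA: "s \<in> A" and SA: "S \<subseteq> A" using insert.prems by auto
    obtain W N \<omega> where W: "N > 0" "\<And>i. i < N \<Longrightarrow> W i \<in> vs" "\<And>i. i < N \<Longrightarrow> eig s (\<omega> i) (W i)"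
      "\<And>k. (\<Sum>i<N. W i k) = of_nat N * w1 k"
      "\<And>i b \<nu>. i < N \<Longrightarrow> b \<in> carrier G \<Longrightarrow> b \<otimes> s = s \<otimes> b \<Longrightarrow> eig b \<nu> w1 \<Longrightarrow> eig b \<nu> (W i)"
      using spectral_components[OF ac[OF sA] w1(1)] by metis
    obtain k where k: "w1 k \<noteq> 0" using w1(2) by auto
    have "(\<Sum>i<N. W i k) \<noteq> 0" using W(1,4) k by simp
    then obtain i where i: "i < N" "W i k \<noteq> 0" by (metis lessThan_iff sum.neutral)
    have p: "eig b \<nu> (W i)" if "b \<in> A" "eig b \<nu> w1" for b \<nu>
      by (rule W(5)[OF i(1) ac[OF that(1)] comm[OF that(1) sA] that(2)])
    have "W i \<noteq> (\<lambda>_. 0)" using i(2) by auto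
    moreover have "\<forall>a\<in>insert s S. \<exists>\<mu>. eig a \<mu> (W i)" using W(3)[OF i(1)] w1(3) p SA by blast
    moreover have "\<forall>b\<in>A. \<forall>\<nu>. eig b \<nu> w \<longrightarrow> eig b \<nu> (W i)" using w1(4) p by blast
    ultimately show ?case using W(2)[OF i(1)] by blast
  qed
  ultimately obtain w' where w': "w' \<in> vs" "w' \<noteq> (\<lambda>_. 0)" "\<forall>a\<in>A. \<exists>\<mu>. eig a \<mu> w'" "\<forall>b\<in>A. \<forall>\<nu>. eig b \<nu> w \<longrightarrow> eig b \<nu> w'"
    by blast
  from bchoice[OF w'(3)] obtain \<mu> where "\<forall>a\<in>A. eig a (\<mu> a) w'" by blast
  then show ?thesis using that w' by blast
qed

definition occurs :: "'a set \<Rightarrow> ('a \<Rightarrow> complex) \<Rightarrow> bool" where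
  "occurs Z \<chi> \<longleftrightarrow> (\<exists>v\<in>vs. v \<noteq> (\<lambda>_. 0) \<and> (\<forall>z\<in>Z. eig z (\<chi> z) v))"

text \<open>Faithfulness gives a vector moved by z, hence a nonzero spectral component for z with
  eigenvalue other than 1; refining it to a common eigenvector of Z keeps that eigenvalue.\<close>

lemma occurs_separates:
  assumes inj: "inj_on \<rho> (carrier G)" and Z: "subgroup Z G" and comm: "\<And>a b. a \<in> Z \<Longrightarrow> b \<in> Z \<Longrightarrow> a \<otimes> b = b \<otimes> a"
    and z: "z \<in> Z" "z \<noteq> \<one>"
  obtains \<chi> where "occurs Z \<chi>" "\<chi> z \<noteq> 1"
proof -
  have zc: "z \<in> carrier G" using subgroup.mem_carrier[OF Z z(1)] .
  have "\<exists>u\<in>vs. T z u \<noteq> u"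
  proof (rule ccontr)
    assume "\<not> ?thesis"
    then have fx0: "T z u = u" if "u \<in> vs" for u using that by blast
    have "\<rho> z = 1\<^sub>m m"
    proof (rule eq_matI)
      fix i j assume "i < dim_row (1\<^sub>m m :: complex mat)" "j < dim_col (1\<^sub>m m :: complex mat)"
      then have ij: "i < m" "j < m" by auto
      define u :: "nat \<Rightarrow> complex" where "u k = (if k = j then 1 else 0)" for k
      have uv: "u \<in> vs" using ij by (auto simp: u_def vs_def)
      have "T z u i = (\<Sum>k<m. if k = j then \<rho> z $$ (i,j) else 0)" 
        unfolding T_def u_def using ij by (simp only: if_True) (intro sum.cong, auto)
      also have "\<dots> = \<rho> z $$ (i,j)" using ij by simp
      finally have "\<rho> z $$ (i,j) = u i" using fx0[OF uv] by simp
      then show "\<rho> z $$ (i,j) = 1\<^sub>m m $$ (i,j)" using ij by (simp add: u_def)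
    qed (use rho_carrier[OF zc] in auto)
    then have "\<rho> z = \<rho> \<one>" using hom_GL_one[OF rep] by simp
    then show False using inj_onD[OF inj _ zc one_closed] z(2) by blast
  qed
  then obtain u where u: "u \<in> vs" "T z u \<noteq> u" by blast
  obtain W N \<omega> where W: "N > 0" "\<And>i. i < N \<Longrightarrow> W i \<in> vs" "\<And>i. i < N \<Longrightarrow> eig z (\<omega> i) (W i)"
    "\<And>k. (\<Sum>i<N. W i k) = of_nat N * u k"
    using spectral_components[OF zc u(1)] by metis
  have "\<exists>i<N. \<omega> i \<noteq> 1 \<and> W i \<noteq> (\<lambda>_. 0)"
  proof (rule ccontr)
    assume no: "\<not> ?thesis"
    have fx: "T z (W i) = W i" if "i < N" for i
    proof (cases "\<omega> i = 1")
      case True then show ?thesis using W(3)[OF that] by (simp add: eig_def)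
    next
      case False
      then have "W i = (\<lambda>_. 0)" using no that by blast
      then show ?thesis using T_zero by simp
    qed
    have ueq: "u = (\<lambda>k. \<Sum>i<N. inverse (of_nat N) * W i k)"
      using W(1) by (auto simp: sum_distrib_left[symmetric] W(4) fun_eq_iff)
    have "T z u = (\<lambda>k. \<Sum>i<N. inverse (of_nat N) * T z (W i) k)" by (subst ueq) (rule T_sum)
    also have "\<dots> = (\<lambda>k. \<Sum>i<N. inverse (of_nat N) * W i k)" using fx by simp
    also have "\<dots> = u" by (rule ueq[symmetric])
    finally show False using u(2) by simp
  qed
  then obtain i where i: "i < N" "\<omega> i \<noteq> 1" "W i \<noteq> (\<lambda>_. 0)" by blast
  obtain w' \<mu> where w': "w' \<in> vs" "w' \<noteq> (\<lambda>_. 0)" "\<And>a. a \<in> Z \<Longrightarrow> eig a (\<mu> a) w'" "\<And>b \<nu>. b \<in> Z \<Longrightarrow> eig b \<nu> (W i) \<Longrightarrow> eig b \<nu> w'"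
    using eigenvector_refine[OF Z comm W(2)[OF i(1)] i(3)] by metis
  have "\<mu> z = \<omega> i" using eig_unique[OF w'(3)[OF z(1)] w'(4)[OF z(1) W(3)[OF i(1)]] w'(2)] .
  then show ?thesis using that[of \<mu>] w' i(2) by (auto simp: occurs_def)
qed

text \<open>Whatever character of A lies over \<chi>, its conjugates by different t in S differ: the
  two conjugates of some a differ by a z with \<chi>(z) \<noteq> 1. The condition avoids the
  character of A, which is known only once a representation is given.\<close>

definition translates :: "'a set \<Rightarrow> ('a \<Rightarrow> complex) \<Rightarrow> 'a set \<Rightarrow> 'a set \<Rightarrow> bool" where
  "translates Z \<chi> A S \<longleftrightarrow> subgroup A G \<and> Z \<subseteq> A \<and> (\<forall>a\<in>A. \<forall>b\<in>A. a \<otimes> b = b \<otimes> a) \<and> finite S \<and> S \<subseteq> carrier G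
    \<and> (\<forall>t\<in>S. \<forall>a\<in>A. inv t \<otimes> a \<otimes> t \<in> A)
    \<and> (\<forall>t\<in>S. \<forall>t'\<in>S. t \<noteq> t' \<longrightarrow> (\<exists>a\<in>A. \<exists>z\<in>Z. \<chi> z \<noteq> 1 \<and> inv t \<otimes> a \<otimes> t = (inv t' \<otimes> a \<otimes> t') \<otimes> z))"

text \<open>For each \<chi> take a common eigenvector of \<open>A \<chi>\<close> over it and
  translate it by \<open>S \<chi>\<close>. Elements of Z distinguish the vectors for different
  \<chi>, elements of \<open>A \<chi>\<close> those for the same one, so all of them count towards
  m.\<close>

theorem sum_translates_le:
  assumes Z: "subgroup Z G" and cent: "\<And>z g. z \<in> Z \<Longrightarrow> g \<in> carrier G \<Longrightarrow> g \<otimes> z = z \<otimes> g"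
    and X: "finite X" "\<And>\<chi>. \<chi> \<in> X \<Longrightarrow> occurs Z \<chi>"
    and Xd: "\<And>\<chi> \<chi>'. \<chi> \<in> X \<Longrightarrow> \<chi>' \<in> X \<Longrightarrow> \<chi> \<noteq> \<chi>' \<Longrightarrow> \<exists>z\<in>Z. \<chi> z \<noteq> \<chi>' z"
    and tr: "\<And>\<chi>. \<chi> \<in> X \<Longrightarrow> translates Z \<chi> (A \<chi>) (S \<chi>)"
  shows "(\<Sum>\<chi>\<in>X. card (S \<chi>)) \<le> m"
proof -
  have ex: "\<exists>q. fst q \<in> vs \<and> fst q \<noteq> (\<lambda>_. 0) \<and> (\<forall>a\<in>A \<chi>. eig a (snd q a) (fst q)) \<and> (\<forall>z\<in>Z. eig z (\<chi> z) (fst q))"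
    if c: "\<chi> \<in> X" for \<chi>
  proof -
    have t: "subgroup (A \<chi>) G" "Z \<subseteq> A \<chi>" "\<And>a b. a \<in> A \<chi> \<Longrightarrow> b \<in> A \<chi> \<Longrightarrow> a \<otimes> b = b \<otimes> a"
      using tr[OF c] by (auto simp: translates_def)
    obtain v where v: "v \<in> vs" "v \<noteq> (\<lambda>_. 0)" "\<And>z. z \<in> Z \<Longrightarrow> eig z (\<chi> z) v" using X(2)[OF c] by (auto simp: occurs_def)
    obtain w \<mu> where "w \<in> vs" "w \<noteq> (\<lambda>_. 0)" "\<And>a. a \<in> A \<chi> \<Longrightarrow> eig a (\<mu> a) w" "\<And>b \<nu>. b \<in> A \<chi> \<Longrightarrow> eig b \<nu> v \<Longrightarrow> eig b \<nu> w"
      using eigenvector_refine[OF t(1,3) v(1,2)] by metis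
    then show ?thesis using v(3) t(2) by (intro exI[of _ "(w, \<mu>)"]) auto
  qed
  define q where "q \<chi> = (SOME q. fst q \<in> vs \<and> fst q \<noteq> (\<lambda>_. 0) \<and> (\<forall>a\<in>A \<chi>. eig a (snd q a) (fst q)) \<and> (\<forall>z\<in>Z. eig z (\<chi> z) (fst q)))" for \<chi>
  define w where "w \<chi> = fst (q \<chi>)" for \<chi>
  define \<mu> where "\<mu> \<chi> = snd (q \<chi>)" for \<chi>
  have w: "w \<chi> \<in> vs" "w \<chi> \<noteq> (\<lambda>_. 0)" "\<And>a. a \<in> A \<chi> \<Longrightarrow> eig a (\<mu> \<chi> a) (w \<chi>)" "\<And>z. z \<in> Z \<Longrightarrow> eig z (\<chi> z) (w \<chi>)"
    if "\<chi> \<in> X" for \<chi>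
    using someI_ex[OF ex[OF that]] unfolding w_def \<mu>_def q_def by blast+
  have A: "subgroup (A \<chi>) G" "Z \<subseteq> A \<chi>" "finite (S \<chi>)" "S \<chi> \<subseteq> carrier G"
    "\<And>t a. t \<in> S \<chi> \<Longrightarrow> a \<in> A \<chi> \<Longrightarrow> inv t \<otimes> a \<otimes> t \<in> A \<chi>"
    "\<And>t t'. t \<in> S \<chi> \<Longrightarrow> t' \<in> S \<chi> \<Longrightarrow> t \<noteq> t' \<Longrightarrow> \<exists>a\<in>A \<chi>. \<exists>z\<in>Z. \<chi> z \<noteq> 1 \<and> inv t \<otimes> a \<otimes> t = (inv t' \<otimes> a \<otimes> t') \<otimes> z"
    if "\<chi> \<in> X" for \<chi>
    using tr[OF that] unfolding translates_def by blast+
  define v where "v i = T (snd i) (w (fst i))" for i :: "('a \<Rightarrow> complex) \<times> 'a"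
  define l where "l i a = \<mu> (fst i) (inv (snd i) \<otimes> a \<otimes> snd i)" for i a
  have ev: "eig a (l (\<chi>, t) a) (v (\<chi>, t))" if c: "\<chi> \<in> X" and t: "t \<in> S \<chi>" and a: "a \<in> A \<chi>" for \<chi> t a
  proof -
    have [simp]: "t \<in> carrier G" "a \<in> carrier G" using A(4)[OF c] t subgroup.mem_carrier[OF A(1)[OF c] a] by auto
    have "T a (T t (w \<chi>)) = T (t \<otimes> (inv t \<otimes> a \<otimes> t)) (w \<chi>)" by (simp add: T_mult[symmetric] word_simps)
    also have "\<dots> = T t (T (inv t \<otimes> a \<otimes> t) (w \<chi>))" by (rule T_mult) simp_all
    also have "\<dots> = (\<lambda>i. \<mu> \<chi> (inv t \<otimes> a \<otimes> t) * T t (w \<chi>) i)"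
      using w(3)[OF c A(5)[OF c t a]] by (simp add: eig_def T_scale)
    finally show ?thesis by (simp add: eig_def v_def l_def)
  qed
  have ez: "eig z (\<chi> z) (v (\<chi>, t))" if c: "\<chi> \<in> X" and t: "t \<in> S \<chi>" and z: "z \<in> Z" for \<chi> t z
  proof -
    have [simp]: "t \<in> carrier G" "z \<in> carrier G" using A(4)[OF c] t subgroup.mem_carrier[OF Z z] by auto
    have "inv t \<otimes> z \<otimes> t = inv t \<otimes> (t \<otimes> z)" unfolding cent[OF z \<open>t \<in> carrier G\<close>] by (simp add: m_assoc)
    then have "inv t \<otimes> z \<otimes> t = z" by (simp add: word_simps)
    then have "l (\<chi>, t) z = \<mu> \<chi> z" by (simp add: l_def)
    also have "\<dots> = \<chi> z" using eig_unique[OF w(3)[OF c] w(4)[OF c z] w(2)[OF c]] z A(2)[OF c] by blast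
    finally show ?thesis using ev[OF c t, of z] z A(2)[OF c] by auto
  qed
  have "card (SIGMA \<chi>:X. S \<chi>) \<le> m"
  proof (rule card_eigenvectors_le[where A = "\<lambda>i. A (fst i)" and v = v and \<mu> = l])
    show "finite (SIGMA \<chi>:X. S \<chi>)" using X(1) A(3) by auto
    show "subgroup (A (fst i)) G" if "i \<in> (SIGMA \<chi>:X. S \<chi>)" for i using that A(1) by auto
    show "v i \<in> vs \<and> v i \<noteq> (\<lambda>_. 0)" if i: "i \<in> (SIGMA \<chi>:X. S \<chi>)" for i
    proof
      show "v i \<in> vs" by (simp add: v_def T_vs)
      obtain \<chi> t where it: "i = (\<chi>, t)" "\<chi> \<in> X" "t \<in> S \<chi>" using i by auto
      have tc: "t \<in> carrier G" using A(4) it by auto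
      have "T (inv t) (v i) = w \<chi>" using it tc T_one[OF w(1)[OF it(2)]] by (simp add: v_def T_mult[symmetric])
      then show "v i \<noteq> (\<lambda>_. 0)" using w(2)[OF it(2)] T_zero[of "inv t"] by metis
    qed
    show "eig a (l i a) (v i)" if "i \<in> (SIGMA \<chi>:X. S \<chi>)" "a \<in> A (fst i)" for i a using that ev by auto
    fix i j assume ij: "i \<in> (SIGMA \<chi>:X. S \<chi>)" "j \<in> (SIGMA \<chi>:X. S \<chi>)" "i \<noteq> j"
    obtain \<chi> t \<chi>' t' where e: "i = (\<chi>, t)" "\<chi> \<in> X" "t \<in> S \<chi>" "j = (\<chi>', t')" "\<chi>' \<in> X" "t' \<in> S \<chi>'" using ij by auto
    show "\<exists>b\<in>A (fst i). \<exists>\<nu>. \<nu> \<noteq> l i b \<and> eig b \<nu> (v j)"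
    proof (cases "\<chi> = \<chi>'")
      case False
      then obtain z where z: "z \<in> Z" "\<chi> z \<noteq> \<chi>' z" using Xd e by metis
      have "eig z (l i z) (v i)" "eig z (\<chi> z) (v i)" using ev[of \<chi> t z] ez[of \<chi> t z] e z A(2) by auto
      moreover have "T (inv t) (v i) = w \<chi>" 
        using e A(4)[OF e(2)] T_one[OF w(1)[OF e(2)]] by (simp add: v_def T_mult[symmetric] subset_iff)
      then have "v i \<noteq> (\<lambda>_. 0)" using w(2)[OF e(2)] T_zero[of "inv t"] by metis
      ultimately have "l i z = \<chi> z" using eig_unique by blast
      moreover have "eig z (\<chi>' z) (v j)" using ez e z by auto
      ultimately show ?thesis using z A(2) e by (metis fst_conv subsetD)
    next
      case True
      then have "t \<noteq> t'" using ij e by auto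
      then obtain a z where a: "a \<in> A \<chi>" "z \<in> Z" "\<chi> z \<noteq> 1" "inv t \<otimes> a \<otimes> t = (inv t' \<otimes> a \<otimes> t') \<otimes> z"
        using A(6)[OF e(2,3)] e True by metis
      have lc: "lin_char G (A \<chi>) (\<mu> \<chi>)" using eig_char[OF A(1)[OF e(2)] w(1,2,3)[OF e(2)]] e(2) by blast
      have a': "inv t' \<otimes> a \<otimes> t' \<in> A \<chi>" using A(5)[OF e(2)] e True a by blast
      have "\<mu> \<chi> z = \<chi> z" using eig_unique[OF w(3)[OF e(2)] w(4)[OF e(2) a(2)] w(2)[OF e(2)]] a A(2)[OF e(2)] by blast
      then have "l i a = l j a * \<chi> z" using lin_char_mult[OF lc a', of z] a A(2)[OF e(2)] e True by (auto simp: l_def)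
      then have "l j a \<noteq> l i a" using a(3) lin_char_nonzero[OF lc a'] e True by (auto simp: l_def)
      moreover have "eig a (l j a) (v j)" using ev e True a by auto
      ultimately show ?thesis using a e by auto
    qed
  qed
  then show ?thesis using X(1) A(3) by (simp add: card_SigmaI)
qed

end

section \<open>Central extensions by a bilinear cocycle\<close>

locale root_exp =
  fixes p :: nat
  assumes p: "prime p"
begin

definition zeta :: "int \<Rightarrow> complex" where "zeta k = cis (2 * pi * real_of_int k / real p)"

lemma p_pos: "p > 0" using p prime_gt_0_nat by simp

lemma zeta_add: "zeta (k + l) = zeta k * zeta l"
  by (simp add: zeta_def cis_mult add_divide_distrib distrib_left)

lemma zeta_0 [simp]: "zeta 0 = 1" by (simp add: zeta_def)

lemma zeta_eq_1_iff: "zeta k = 1 \<longleftrightarrow> int p dvd k"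
proof
  assume "zeta k = 1"
  then have "cos (2 * pi * real_of_int k / real p) = 1" by (simp add: zeta_def complex_eq_iff)
  then obtain l :: int where "2 * pi * real_of_int k / real p = of_int l * 2 * pi" using cos_one_2pi_int by blast
  then have "real_of_int k = of_int l * real p" using p_pos by (simp add: field_simps)
  then have "k = l * int p" by (metis of_int_eq_iff of_int_mult of_int_of_nat_eq)
  then show "int p dvd k" by simp
next
  assume "int p dvd k"
  then obtain l where "k = int p * l" by blast
  then have "2 * pi * real_of_int k / real p = 2 * pi * of_int l" using p_pos by simp
  then show "zeta k = 1" using cis_multiple_2pi[of "of_int l"] by (simp add: zeta_def)
qed

lemma zeta_cong: "[k = l] (mod int p) \<Longrightarrow> zeta k = zeta l"
proof -
  assume "[k = l] (mod int p)"
  then have "zeta (k - l) = 1" by (simp add: zeta_eq_1_iff cong_iff_dvd_diff)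
  then show ?thesis using zeta_add[of "k - l" l] by simp
qed

lemma residue_vectors_differ:
  assumes "u \<in> PiE {..<k} (\<lambda>_. {0..<int p})" "v \<in> PiE {..<k} (\<lambda>_. {0..<int p})" "u \<noteq> v"
  obtains s where "s < k" "\<not> [u s = v s] (mod int p)"
proof -
  obtain s where s: "s \<in> {..<k}" "u s \<noteq> v s" using PiE_ext[OF assms(1,2)] assms(3) by blast
  have "u s \<in> {0..<int p}" "v s \<in> {0..<int p}" using PiE_mem[OF assms(1) s(1)] PiE_mem[OF assms(2) s(1)] .
  then have "\<not> [u s = v s] (mod int p)" using s(2) cong_less_imp_eq_int[of "u s" "int p" "v s"] by auto
  then show ?thesis using that s(1) by simp
qed

lemma zeta_power: "zeta k ^ c = zeta (int c * k)"
  by (induction c) (simp_all add: zeta_add algebra_simps)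

lemma root_of_unity_zeta:
  assumes "z ^ p = 1" obtains a where "z = zeta a"
proof -
  have "z \<in> (\<lambda>k. cis (2 * pi * real k / real p)) ` {..<p}"
    using bij_betw_roots_unity[OF p_pos] assms by (auto simp: bij_betw_def)
  then obtain k where "z = zeta (int k)" by (auto simp: zeta_def)
  then show ?thesis by (rule that)
qed

end

text \<open>The central extension of \<open>\<int>/p\<^sup>d\<close> by \<open>\<int>/p\<^sup>r\<close> with bilinear cocycle \<open>B\<close>: the first \<open>d\<close> coordinates
  of an element describe its image in the quotient.\<close>
locale ext_group = root_exp p for p :: nat +
  fixes d r :: nat and B :: "nat \<Rightarrow> nat \<Rightarrow> nat \<Rightarrow> int"
begin

definition bil :: "nat \<Rightarrow> (nat \<Rightarrow> int) \<Rightarrow> (nat \<Rightarrow> int) \<Rightarrow> int" where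
  "bil s u v = (\<Sum>i<d. \<Sum>j<d. B s i j * u i * v j)"

text \<open>The canonical representative of an integer vector modulo p. Calculations are done with
  unreduced vectors and only compared modulo p.\<close>

definition elt :: "(nat \<Rightarrow> int) \<Rightarrow> nat \<Rightarrow> int" where
  "elt u = restrict (\<lambda>i. u i mod int p) {..<d + r}"

text \<open>The form reads the first d coordinates, on which \<open>prd\<close> is addition, and
  contributes only to the last r. Hence \<open>prd\<close> is associative over the integers, before
  any reduction.\<close>

definition prd :: "(nat \<Rightarrow> int) \<Rightarrow> (nat \<Rightarrow> int) \<Rightarrow> nat \<Rightarrow> int" where
  "prd u v = (\<lambda>i. u i + v i + (if i < d then 0 else bil (i - d) u v))"

definition E :: "(nat \<Rightarrow> int) monoid" where
  "E = \<lparr>carrier = PiE {..<d + r} (\<lambda>_. {0..<int p}), monoid.mult = (\<lambda>u v. elt (prd u v)), one = elt (\<lambda>_. 0)\<rparr>"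

lemma elt_eq_iff: "elt u = elt v \<longleftrightarrow> (\<forall>i<d + r. [u i = v i] (mod int p))"
  by (auto simp: elt_def cong_def restrict_def fun_eq_iff)

lemma elt_carrier [simp]: "elt u \<in> carrier E"
  using p_pos by (auto simp: E_def elt_def)

lemma carrier_elt: "u \<in> carrier E \<Longrightarrow> elt u = u"
  by (rule PiE_ext[of _ "{..<d + r}" "\<lambda>_. {0..<int p}"]) (auto simp: E_def elt_def PiE_iff p_pos)

lemma elt_cong: "i < d + r \<Longrightarrow> [elt u i = u i] (mod int p)"
  by (simp add: elt_def cong_def)

lemma bil_cong:
  assumes "\<And>i. i < d \<Longrightarrow> [u i = u' i] (mod int p)" "\<And>i. i < d \<Longrightarrow> [v i = v' i] (mod int p)"
  shows "[bil s u v = bil s u' v'] (mod int p)"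
  unfolding bil_def by (intro cong_sum cong_mult cong_refl) (use assms in auto)

lemma prd_cong:
  assumes "\<And>i. i < d + r \<Longrightarrow> [u i = u' i] (mod int p)" "\<And>i. i < d + r \<Longrightarrow> [v i = v' i] (mod int p)"
  shows "elt (prd u v) = elt (prd u' v')"
  unfolding elt_eq_iff prd_def using assms by (auto intro!: cong_add bil_cong)

lemma elt_mult: "elt u \<otimes>\<^bsub>E\<^esub> elt v = elt (prd u v)"
proof -
  have "elt (prd (elt u) (elt v)) = elt (prd u v)" by (rule prd_cong) (auto intro: elt_cong)
  then show ?thesis by (simp add: E_def)
qed

lemma E_one: "\<one>\<^bsub>E\<^esub> = elt (\<lambda>_. 0)" by (simp add: E_def)

lemma bil_add_left: "bil s (\<lambda>i. u i + u' i) v = bil s u v + bil s u' v"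
  by (simp add: bil_def sum.distrib algebra_simps)

lemma bil_add_right: "bil s u (\<lambda>i. v i + v' i) = bil s u v + bil s u v'"
  by (simp add: bil_def sum.distrib algebra_simps)

lemma bil_prd_left: "bil s (prd u u') v = bil s u v + bil s u' v"
proof -
  have "bil s (prd u u') v = bil s (\<lambda>i. u i + u' i) v" unfolding bil_def prd_def by (intro sum.cong) auto
  then show ?thesis by (simp add: bil_add_left)
qed

lemma bil_prd_right: "bil s u (prd v v') = bil s u v + bil s u v'"
proof -
  have "bil s u (prd v v') = bil s u (\<lambda>i. v i + v' i)" unfolding bil_def prd_def by (intro sum.cong) auto
  then show ?thesis by (simp add: bil_add_right)
qed

lemma prd_assoc: "prd (prd u v) w = prd u (prd v w)"
  by (auto simp: prd_def[of "prd u v"] prd_def[of u "prd v w"] bil_prd_left bil_prd_right fun_eq_iff) (auto simp: prd_def)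

lemma E_group: "group E"
proof (rule groupI)
  show "\<one>\<^bsub>E\<^esub> \<in> carrier E" by (simp add: E_one)
  show "u \<otimes>\<^bsub>E\<^esub> v \<in> carrier E" if "u \<in> carrier E" "v \<in> carrier E" for u v using elt_carrier by (simp add: E_def)
  fix u assume u: "u \<in> carrier E"
  have "bil s (\<lambda>_. 0) u = 0" for s by (simp add: bil_def)
  then have "prd (\<lambda>_. 0) u = u" by (auto simp: prd_def)
  then show "\<one>\<^bsub>E\<^esub> \<otimes>\<^bsub>E\<^esub> u = u" using elt_mult[of "\<lambda>_. 0" u] carrier_elt[OF u] by (simp add: E_one)
  define v where "v = (\<lambda>i. - u i + (if i < d then 0 else bil (i - d) u u))"
  have "bil s v u = bil s (\<lambda>i. - u i) u" for s unfolding bil_def v_def by (intro sum.cong) auto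
  then have "bil s v u = - bil s u u" for s by (simp add: bil_def sum_negf)
  then have "prd v u = (\<lambda>_. 0)" by (auto simp: prd_def v_def)
  then have "elt v \<otimes>\<^bsub>E\<^esub> u = \<one>\<^bsub>E\<^esub>" using elt_mult[of v u] carrier_elt[OF u] by (simp add: E_one)
  then show "\<exists>w\<in>carrier E. w \<otimes>\<^bsub>E\<^esub> u = \<one>\<^bsub>E\<^esub>" using elt_carrier by blast
next
  fix u v w assume a: "u \<in> carrier E" "v \<in> carrier E" "w \<in> carrier E"
  have "elt u \<otimes>\<^bsub>E\<^esub> elt v \<otimes>\<^bsub>E\<^esub> elt w = elt u \<otimes>\<^bsub>E\<^esub> (elt v \<otimes>\<^bsub>E\<^esub> elt w)" by (simp add: elt_mult prd_assoc)
  then show "u \<otimes>\<^bsub>E\<^esub> v \<otimes>\<^bsub>E\<^esub> w = u \<otimes>\<^bsub>E\<^esub> (v \<otimes>\<^bsub>E\<^esub> w)" using a by (simp add: carrier_elt)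
qed

lemma card_E: "card (carrier E) = p ^ (d + r)"
  by (simp add: E_def card_PiE)

lemma finite_E: "finite (carrier E)"
  by (simp add: E_def finite_PiE)

definition zel :: "(nat \<Rightarrow> int) \<Rightarrow> nat \<Rightarrow> int" where
  "zel w = elt (\<lambda>i. if i < d then 0 else w (i - d))"

definition Z :: "(nat \<Rightarrow> int) set" where "Z = range zel"

lemma zel_carrier [simp]: "zel w \<in> carrier E" by (simp add: zel_def)

lemma elt_zel: "elt u \<otimes>\<^bsub>E\<^esub> zel w = elt (\<lambda>i. u i + (if i < d then 0 else w (i - d)))"
proof -
  have "bil s u (\<lambda>i. if i < d then 0 else w (i - d)) = 0" for s by (simp add: bil_def)
  then have "prd u (\<lambda>i. if i < d then 0 else w (i - d)) = (\<lambda>i. u i + (if i < d then 0 else w (i - d)))"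
    by (auto simp: prd_def)
  then show ?thesis by (simp add: zel_def elt_mult)
qed

lemma zel_elt: "zel w \<otimes>\<^bsub>E\<^esub> elt u = elt (\<lambda>i. u i + (if i < d then 0 else w (i - d)))"
proof -
  have "bil s (\<lambda>i. if i < d then 0 else w (i - d)) u = 0" for s by (simp add: bil_def)
  then have "prd (\<lambda>i. if i < d then 0 else w (i - d)) u = (\<lambda>i. u i + (if i < d then 0 else w (i - d)))"
    by (auto simp: prd_def)
  then show ?thesis by (simp add: zel_def elt_mult)
qed

lemma zel_mult: "zel w \<otimes>\<^bsub>E\<^esub> zel w' = zel (\<lambda>s. w s + w' s)"
proof -
  have "zel w \<otimes>\<^bsub>E\<^esub> zel w' = elt (\<lambda>i. (if i < d then 0 else w (i - d)) + (if i < d then 0 else w' (i - d)))"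
    using elt_zel[of "\<lambda>i. if i < d then 0 else w (i - d)" w'] by (simp add: zel_def)
  also have "\<dots> = zel (\<lambda>s. w s + w' s)" unfolding zel_def by (rule arg_cong[of _ _ elt]) auto
  finally show ?thesis .
qed

lemma zel_eq_iff: "zel w = zel w' \<longleftrightarrow> (\<forall>s<r. [w s = w' s] (mod int p))"
proof -
  have "zel w = zel w' \<longleftrightarrow> (\<forall>i<d + r. i \<ge> d \<longrightarrow> [w (i - d) = w' (i - d)] (mod int p))"
    by (auto simp: zel_def elt_eq_iff)
  also have "\<dots> \<longleftrightarrow> (\<forall>s<r. [w s = w' s] (mod int p))"
  proof (intro iffI allI impI)
    fix s assume a: "\<forall>i<d + r. i \<ge> d \<longrightarrow> [w (i - d) = w' (i - d)] (mod int p)" and s: "s < r"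
    then show "[w s = w' s] (mod int p)" using a[rule_format, of "d + s"] by simp
  qed auto
  finally show ?thesis .
qed

lemma zel_0: "zel (\<lambda>_. 0) = \<one>\<^bsub>E\<^esub>"
  unfolding zel_def E_one by (rule arg_cong[of _ _ elt]) auto

lemma zel_central: "u \<in> carrier E \<Longrightarrow> u \<otimes>\<^bsub>E\<^esub> zel w = zel w \<otimes>\<^bsub>E\<^esub> u"
  using elt_zel[of u w] zel_elt[of w u] carrier_elt[of u] by simp

lemma Z_central:
  assumes "z \<in> Z" "u \<in> carrier E" shows "u \<otimes>\<^bsub>E\<^esub> z = z \<otimes>\<^bsub>E\<^esub> u"
proof -
  obtain w where "z = zel w" using assms(1) unfolding Z_def by blast
  then show ?thesis using zel_central[OF assms(2), of w] by simp
qed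

lemma Z_subgroup: "subgroup Z E"
proof (rule group.subgroupI[OF E_group])
  show "Z \<subseteq> carrier E" "Z \<noteq> {}" by (auto simp: Z_def)
  fix a assume "a \<in> Z"
  then obtain w where w: "a = zel w" by (auto simp: Z_def)
  have "zel (\<lambda>s. - w s) \<otimes>\<^bsub>E\<^esub> a = \<one>\<^bsub>E\<^esub>" by (simp add: w zel_mult zel_0)
  then have "inv\<^bsub>E\<^esub> a = zel (\<lambda>s. - w s)" using group.inv_equality[OF E_group] w by simp
  then show "inv\<^bsub>E\<^esub> a \<in> Z" by (simp add: Z_def)
next
  fix a b assume "a \<in> Z" "b \<in> Z"
  then show "a \<otimes>\<^bsub>E\<^esub> b \<in> Z" by (auto simp: Z_def zel_mult)
qed

lemma conj_eq:
  "inv\<^bsub>E\<^esub> (elt t) \<otimes>\<^bsub>E\<^esub> elt x \<otimes>\<^bsub>E\<^esub> elt t = elt x \<otimes>\<^bsub>E\<^esub> zel (\<lambda>s. bil s x t - bil s t x)"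
proof -
  interpret group E by (rule E_group)
  have "elt t \<otimes>\<^bsub>E\<^esub> (elt x \<otimes>\<^bsub>E\<^esub> zel (\<lambda>s. bil s x t - bil s t x)) = (elt t \<otimes>\<^bsub>E\<^esub> elt x) \<otimes>\<^bsub>E\<^esub> zel (\<lambda>s. bil s x t - bil s t x)"
    by (simp add: m_assoc)
  also have "\<dots> = elt (\<lambda>i. prd t x i + (if i < d then 0 else bil (i - d) x t - bil (i - d) t x))"
    by (simp add: elt_mult elt_zel)
  also have "\<dots> = elt (prd x t)" by (rule arg_cong[of _ _ elt]) (auto simp: prd_def)
  also have "\<dots> = elt x \<otimes>\<^bsub>E\<^esub> elt t" by (simp add: elt_mult)
  finally have "elt x \<otimes>\<^bsub>E\<^esub> elt t = elt t \<otimes>\<^bsub>E\<^esub> (elt x \<otimes>\<^bsub>E\<^esub> zel (\<lambda>s. bil s x t - bil s t x))" by simp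
  then show ?thesis by (simp add: m_assoc inv_mult_cancel_left)
qed

definition pair :: "(nat \<Rightarrow> int) \<Rightarrow> (nat \<Rightarrow> int) \<Rightarrow> int" where
  "pair a w = (\<Sum>s<r. a s * w s)"

lemma pair_cong:
  assumes "\<And>s. s < r \<Longrightarrow> [a s = a' s] (mod int p)" "\<And>s. s < r \<Longrightarrow> [w s = w' s] (mod int p)"
  shows "[pair a w = pair a' w'] (mod int p)"
  unfolding pair_def by (intro cong_sum cong_mult) (use assms in auto)

lemma pair_diff: "pair a (\<lambda>s. w s - w' s) = pair a w - pair a w'"
  by (simp add: pair_def sum_subtractf right_diff_distrib)

text \<open>The values on unit vectors are p-th roots of unity \<open>zeta (a s)\<close>. A vector
  with nonnegative entries is assembled coordinate by coordinate from natural multiples of these,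
  and reduction modulo p handles signs.\<close>

lemma char_form:
  assumes \<chi>: "lin_char E Z \<chi>" obtains a where "\<And>w. \<chi> (zel w) = zeta (pair a w)"
proof -
  interpret group E by (rule E_group)
  have add: "\<chi> (zel (\<lambda>s. w s + w' s)) = \<chi> (zel w) * \<chi> (zel w')" for w w'
    using lin_char_mult[OF \<chi>, of "zel w" "zel w'"] by (simp add: Z_def zel_mult)
  have one: "\<chi> (zel (\<lambda>_. 0)) = 1" using lin_char_one[OF \<chi> Z_subgroup] by (simp add: zel_0)
  define dl where "dl s c = (\<lambda>t. if t = s then c else (0::int))" for s :: nat and c
  have dlp: "\<chi> (zel (dl s (int c))) = \<chi> (zel (dl s 1)) ^ c" for s c
  proof (induction c)
    case 0
    have "dl s (int 0) = (\<lambda>_. 0)" by (auto simp: dl_def)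
    then show ?case using one by simp
  next
    case (Suc c)
    have "dl s (int (Suc c)) = (\<lambda>t. dl s (int c) t + dl s 1 t)" by (auto simp: dl_def)
    then show ?case using Suc add by simp
  qed
  have "\<exists>b. \<chi> (zel (dl s 1)) = zeta b" for s
  proof -
    have "zel (dl s (int p)) = zel (\<lambda>_. 0)" by (auto simp: zel_eq_iff dl_def cong_def)
    then have "\<chi> (zel (dl s 1)) ^ p = 1" using dlp[of s p] one by simp
    then show ?thesis using root_of_unity_zeta by metis
  qed
  then obtain a where a: "\<And>s. \<chi> (zel (dl s 1)) = zeta (a s)" by metis
  have nn: "\<chi> (zel w) = zeta (pair a w)" if w: "\<And>s. w s \<ge> 0" for w
  proof -
    have "\<chi> (zel (\<lambda>t. if t < k then w t else 0)) = zeta (\<Sum>s<k. a s * w s)" for k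
    proof (induction k)
      case 0 show ?case using one by simp
    next
      case (Suc k)
      obtain c where c: "w k = int c" using w[of k] nonneg_int_cases by blast
      have "(\<lambda>t. if t < Suc k then w t else 0) = (\<lambda>t. (if t < k then w t else 0) + dl k (int c) t)"
        by (auto simp: dl_def less_Suc_eq c)
      then have "\<chi> (zel (\<lambda>t. if t < Suc k then w t else 0)) = zeta (\<Sum>s<k. a s * w s) * zeta (a k) ^ c"
        by (simp only: add Suc dlp a)
      then show ?case by (simp add: zeta_power zeta_add mult.commute c)
    qed
    from this[of r] have "\<chi> (zel (\<lambda>t. if t < r then w t else 0)) = zeta (pair a w)" by (simp add: pair_def)
    moreover have "zel (\<lambda>t. if t < r then w t else 0) = zel w" by (auto simp: zel_eq_iff)
    ultimately show ?thesis by simp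
  qed
  have "\<chi> (zel w) = zeta (pair a w)" for w
  proof -
    have "zel w = zel (\<lambda>s. w s mod int p)" by (auto simp: zel_eq_iff cong_def)
    then have "\<chi> (zel w) = \<chi> (zel (\<lambda>s. w s mod int p))" by simp
    also have "\<dots> = zeta (pair a (\<lambda>s. w s mod int p))" by (rule nn) (simp add: p_pos)
    also have "\<dots> = zeta (pair a w)" by (intro zeta_cong pair_cong) (auto simp: cong_def)
    finally show ?thesis .
  qed
  then show ?thesis using that by blast
qed

text \<open>A total function reading the last r coordinates; it is meant as a character on
  Z.\<close>

definition zchar :: "(nat \<Rightarrow> int) \<Rightarrow> (nat \<Rightarrow> int) \<Rightarrow> complex" where
  "zchar a g = zeta (pair a (\<lambda>s. g (d + s)))"

lemma zchar_zel: "zchar a (zel w) = zeta (pair a w)"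
  unfolding zchar_def by (intro zeta_cong pair_cong) (auto simp: zel_def elt_def cong_def)

text \<open>The form taken by \<open>translates\<close> here: conjugation by t multiplies x by a
  central element whose coordinates are the alternating forms of x and t, so only their combination
  with coefficients a matters.\<close>

definition good :: "(nat \<Rightarrow> int) \<Rightarrow> (nat \<Rightarrow> int) set \<Rightarrow> (nat \<Rightarrow> int) set \<Rightarrow> bool" where
  "good a A S \<longleftrightarrow> subgroup A E \<and> Z \<subseteq> A \<and> (\<forall>x\<in>A. \<forall>y\<in>A. x \<otimes>\<^bsub>E\<^esub> y = y \<otimes>\<^bsub>E\<^esub> x) \<and> S \<subseteq> carrier E
    \<and> (\<forall>t\<in>S. \<forall>t'\<in>S. t \<noteq> t' \<longrightarrow> (\<exists>x\<in>A. \<not> [pair a (\<lambda>s. bil s x t - bil s t x) = pair a (\<lambda>s. bil s x t' - bil s t' x)] (mod int p)))"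

text \<open>X collects the labels of the nontrivial characters of Z occurring in the representation;
  faithfulness makes them separate Z. Returning X itself, and not just a number, allows the
  exceptional orders to weigh its members differently.\<close>

theorem lower_bound:
  assumes \<rho>: "\<rho> \<in> hom E (GL m)" and inj: "inj_on \<rho> (carrier E)"
    and H: "\<And>a. \<exists>s<r. \<not> int p dvd a s \<Longrightarrow> \<exists>A S. good a A S \<and> wt a \<le> card S"
  obtains X where "finite X" "X \<subseteq> PiE {..<r} (\<lambda>_. {0..<int p})"
    "\<forall>a\<in>X. \<exists>s<r. \<not> int p dvd a s"
    "\<forall>w. (\<exists>s<r. \<not> int p dvd w s) \<longrightarrow> (\<exists>a\<in>X. \<not> int p dvd pair a w)"
    "(\<Sum>a\<in>X. wt a) \<le> m" "r \<le> card X"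
proof -
  interpret R: matrix_rep E \<rho> m
    by (intro matrix_rep.intro E_group matrix_rep_axioms.intro \<rho> finite_E)
  define X where "X = {a \<in> PiE {..<r} (\<lambda>_. {0..<int p}). (\<exists>s<r. \<not> int p dvd a s) \<and> R.occurs Z (zchar a)}"
  have finP: "finite (PiE {..<r} (\<lambda>_. {0..<int p}))" by (simp add: finite_PiE)
  then have finX: "finite X" unfolding X_def by simp
  have sep: "\<exists>a\<in>X. \<not> int p dvd pair a w" if w: "\<exists>s<r. \<not> int p dvd w s" for w
  proof -
    have w1: "zel w \<noteq> \<one>\<^bsub>E\<^esub>" using w unfolding zel_0[symmetric] zel_eq_iff by (auto simp: cong_0_iff)
    obtain \<chi> where \<chi>: "R.occurs Z \<chi>" "\<chi> (zel w) \<noteq> 1"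
    proof (rule R.occurs_separates[OF inj Z_subgroup])
      show "x \<otimes>\<^bsub>E\<^esub> y = y \<otimes>\<^bsub>E\<^esub> x" if "x \<in> Z" "y \<in> Z" for x y
        by (rule Z_central[OF that(2) subgroup.mem_carrier[OF Z_subgroup that(1)]])
      show "zel w \<in> Z" by (simp add: Z_def)
      show "zel w \<noteq> \<one>\<^bsub>E\<^esub>" by (rule w1)
    qed
    then have "lin_char E Z \<chi>" using R.eig_char[OF Z_subgroup] unfolding R.occurs_def by blast
    then obtain b where b: "\<And>w. \<chi> (zel w) = zeta (pair b w)" using char_form by blast
    \<comment> \<open>Reduction of the label makes X finite and distinct labels distinct
      characters.\<close>
    define a where "a = restrict (\<lambda>s. b s mod int p) {..<r}"
    have ab: "[pair a w = pair b w] (mod int p)" for w by (rule pair_cong) (auto simp: a_def cong_def)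
    have eq: "zchar a z = \<chi> z" if "z \<in> Z" for z using that zeta_cong[OF ab] by (auto simp: Z_def zchar_zel b)
    have "R.occurs Z (zchar a)" 
    proof -
      obtain v where v: "v \<in> R.vs" "v \<noteq> (\<lambda>_. 0)" "\<And>z. z \<in> Z \<Longrightarrow> R.eig z (\<chi> z) v"
        using \<chi>(1) unfolding R.occurs_def by blast
      have "\<forall>z\<in>Z. R.eig z (zchar a z) v" using v(3) eq by metis
      then show ?thesis using v(1,2) unfolding R.occurs_def by blast
    qed
    moreover have nd: "\<not> int p dvd pair a w"
    proof
      assume "int p dvd pair a w"
      then have "zeta (pair a w) = 1" by (simp only: zeta_eq_1_iff)
      then show False using \<chi>(2) b[of w] zeta_cong[OF ab[of w]] by simp
    qed
    moreover have "\<exists>s<r. \<not> int p dvd a s"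
    proof (rule ccontr)
      assume "\<not> ?thesis"
      then have "int p dvd pair a w" unfolding pair_def by (intro dvd_sum) auto
      then show False using nd by simp
    qed
    moreover have "a \<in> PiE {..<r} (\<lambda>_. {0..<int p})" using p_pos by (auto simp: a_def)
    ultimately show ?thesis unfolding X_def by blast
  qed
  have dist: "\<exists>z\<in>Z. zchar a z \<noteq> zchar b z" if ab: "a \<in> X" "b \<in> X" "a \<noteq> b" for a b
  proof -
    have P: "a \<in> PiE {..<r} (\<lambda>_. {0..<int p})" "b \<in> PiE {..<r} (\<lambda>_. {0..<int p})" using ab X_def by auto
    obtain s where s: "s < r" "\<not> [a s = b s] (mod int p)" using residue_vectors_differ[OF P ab(3)] .
    have nd: "\<not> int p dvd a s - b s" using s(2) by (simp add: cong_iff_dvd_diff)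
    let ?w = "\<lambda>t. if t = s then 1 else (0::int)"
    have pw: "pair c ?w = c s" for c
      unfolding pair_def using s(1) by (simp add: if_distrib[of "\<lambda>x. _ * x"] cong: if_cong)
    have "zchar a (zel ?w) \<noteq> zchar b (zel ?w)"
    proof
      assume "zchar a (zel ?w) = zchar b (zel ?w)"
      then have "zeta (a s) = zeta (b s)" by (simp add: zchar_zel pw)
      moreover have "zeta (a s) = zeta (a s - b s) * zeta (b s)" using zeta_add[of "a s - b s" "b s"] by simp
      moreover have "zeta (b s) \<noteq> 0" by (simp add: zeta_def)
      ultimately have "zeta (a s - b s) = 1" by simp
      then show False using nd zeta_eq_1_iff by simp
    qed
    then show ?thesis by (auto simp: Z_def)
  qed
  have "\<forall>a\<in>X. \<exists>q. good a (fst q) (snd q) \<and> wt a \<le> card (snd q)" using H X_def by fastforce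
  from bchoice[OF this] obtain q where q: "\<And>a. a \<in> X \<Longrightarrow> good a (fst (q a)) (snd (q a)) \<and> wt a \<le> card (snd (q a))" by blast
  have injz: "inj_on zchar X"
  proof (rule inj_onI, rule ccontr)
    fix a b assume "a \<in> X" "b \<in> X" "zchar a = zchar b" "a \<noteq> b"
    then show False using dist by metis
  qed
  \<comment> \<open>Recovers the label from a character, since the dimension count is indexed by
    characters.\<close>
  define un where "un = the_inv_into X zchar"
  have un: "un (zchar a) = a" if "a \<in> X" for a using the_inv_into_f_f[OF injz that] by (simp add: un_def)
  have "(\<Sum>\<chi>\<in>zchar ` X. card (snd (q (un \<chi>)))) \<le> m"
  proof (rule R.sum_translates_le[OF Z_subgroup, where A = "\<lambda>\<chi>. fst (q (un \<chi>))"])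
    show "g \<otimes>\<^bsub>E\<^esub> z = z \<otimes>\<^bsub>E\<^esub> g" if "z \<in> Z" "g \<in> carrier E" for z g by (rule Z_central[OF that])
    show "finite (zchar ` X)" using finX by simp
    show "R.occurs Z \<chi>" if "\<chi> \<in> zchar ` X" for \<chi> using that by (auto simp: X_def)
    show "\<exists>z\<in>Z. \<chi> z \<noteq> \<chi>' z" if c: "\<chi> \<in> zchar ` X" "\<chi>' \<in> zchar ` X" "\<chi> \<noteq> \<chi>'" for \<chi> \<chi>'
    proof -
      obtain a b where "a \<in> X" "b \<in> X" "\<chi> = zchar a" "\<chi>' = zchar b" using c by blast
      then show ?thesis using dist[of a b] c(3) by blast
    qed
    fix \<chi> assume "\<chi> \<in> zchar ` X"
    then obtain a where a: "a \<in> X" "\<chi> = zchar a" by blast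
    let ?A = "fst (q a)" and ?S = "snd (q a)"
    have g: "subgroup ?A E" "Z \<subseteq> ?A" "\<forall>x\<in>?A. \<forall>y\<in>?A. x \<otimes>\<^bsub>E\<^esub> y = y \<otimes>\<^bsub>E\<^esub> x" "?S \<subseteq> carrier E"
      "\<And>t t'. t \<in> ?S \<Longrightarrow> t' \<in> ?S \<Longrightarrow> t \<noteq> t' \<Longrightarrow> \<exists>x\<in>?A. \<not> [pair a (\<lambda>s. bil s x t - bil s t x) = pair a (\<lambda>s. bil s x t' - bil s t' x)] (mod int p)"
      using q[OF a(1)] unfolding good_def by blast+
    have ce: "inv\<^bsub>E\<^esub> t \<otimes>\<^bsub>E\<^esub> x \<otimes>\<^bsub>E\<^esub> t = x \<otimes>\<^bsub>E\<^esub> zel (\<lambda>s. bil s x t - bil s t x)" if "t \<in> ?S" "x \<in> ?A" for t x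
    proof -
      have tx: "elt t = t" "elt x = x" using that g(4) subgroup.mem_carrier[OF g(1)] carrier_elt by auto
      show ?thesis using conj_eq[of t x] unfolding tx .
    qed
    have "R.translates Z \<chi> ?A ?S"
      unfolding R.translates_def
    proof (intro conjI ballI impI)
      show "finite ?S" using finite_subset[OF g(4) finite_E] .
      show "inv\<^bsub>E\<^esub> t \<otimes>\<^bsub>E\<^esub> x \<otimes>\<^bsub>E\<^esub> t \<in> ?A" if "t \<in> ?S" "x \<in> ?A" for t x
        unfolding ce[OF that] using subgroup.m_closed[OF g(1) that(2)] g(2) by (auto simp: Z_def)
      fix t t' assume t: "t \<in> ?S" "t' \<in> ?S" "t \<noteq> t'"
      obtain x where x: "x \<in> ?A" "\<not> [pair a (\<lambda>s. bil s x t - bil s t x) = pair a (\<lambda>s. bil s x t' - bil s t' x)] (mod int p)"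
        using g(5)[OF t] by blast
      let ?w = "\<lambda>s. (bil s x t - bil s t x) - (bil s x t' - bil s t' x)"
      have xc: "x \<in> carrier E" using subgroup.mem_carrier[OF g(1) x(1)] .
      have "inv\<^bsub>E\<^esub> t' \<otimes>\<^bsub>E\<^esub> x \<otimes>\<^bsub>E\<^esub> t' \<otimes>\<^bsub>E\<^esub> zel ?w = x \<otimes>\<^bsub>E\<^esub> (zel (\<lambda>s. bil s x t' - bil s t' x) \<otimes>\<^bsub>E\<^esub> zel ?w)"
        unfolding ce[OF t(2) x(1)] using xc by (simp add: R.m_assoc)
      also have "\<dots> = x \<otimes>\<^bsub>E\<^esub> zel (\<lambda>s. bil s x t - bil s t x)" by (simp add: zel_mult)
      finally have "inv\<^bsub>E\<^esub> t \<otimes>\<^bsub>E\<^esub> x \<otimes>\<^bsub>E\<^esub> t = inv\<^bsub>E\<^esub> t' \<otimes>\<^bsub>E\<^esub> x \<otimes>\<^bsub>E\<^esub> t' \<otimes>\<^bsub>E\<^esub> zel ?w"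
        using ce[OF t(1) x(1)] by simp
      moreover have "\<chi> (zel ?w) \<noteq> 1"
        using x(2) by (simp add: a zchar_zel zeta_eq_1_iff pair_diff cong_iff_dvd_diff)
      ultimately show "\<exists>x\<in>?A. \<exists>z\<in>Z. \<chi> z \<noteq> 1 \<and> inv\<^bsub>E\<^esub> t \<otimes>\<^bsub>E\<^esub> x \<otimes>\<^bsub>E\<^esub> t = inv\<^bsub>E\<^esub> t' \<otimes>\<^bsub>E\<^esub> x \<otimes>\<^bsub>E\<^esub> t' \<otimes>\<^bsub>E\<^esub> z"
        using x(1) by (auto simp: Z_def)
    qed (use g in auto)
    then show "R.translates Z \<chi> (fst (q (un \<chi>))) (snd (q (un \<chi>)))" using a un by simp
  qed
  also have "(\<Sum>\<chi>\<in>zchar ` X. card (snd (q (un \<chi>)))) = (\<Sum>a\<in>X. card (snd (q a)))"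
    using un by (simp add: sum.reindex[OF injz])
  finally have "(\<Sum>a\<in>X. card (snd (q a))) \<le> m" .
  moreover have "(\<Sum>a\<in>X. wt a) \<le> (\<Sum>a\<in>X. card (snd (q a)))" using q by (intro sum_mono) blast
  ultimately have wtm: "(\<Sum>a\<in>X. wt a) \<le> m" by linarith
  let ?W = "PiE {..<r} (\<lambda>_. {0..<int p})"
  \<comment> \<open>The values of the pairings with all labels determine w modulo p, which bounds
    p^r by p^(card X).\<close>
  let ?F = "\<lambda>w. restrict (\<lambda>a. pair a w mod int p) X"
  have "inj_on ?F ?W"
  proof (rule inj_onI, rule ccontr)
    fix w w' assume w: "w \<in> ?W" "w' \<in> ?W" "?F w = ?F w'" "w \<noteq> w'"
    obtain s where s: "s < r" "\<not> [w s = w' s] (mod int p)" using residue_vectors_differ[OF w(1,2,4)] .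
    then have "\<not> int p dvd w s - w' s" by (simp add: cong_iff_dvd_diff)
    then obtain a where a: "a \<in> X" "\<not> int p dvd pair a (\<lambda>s. w s - w' s)" using sep[of "\<lambda>s. w s - w' s"] s(1) by blast
    have "pair a w mod int p = pair a w' mod int p" using fun_cong[OF w(3), of a] a(1) by simp
    then show False using a(2) by (simp add: pair_diff mod_eq_dvd_iff)
  qed
  moreover have "?F ` ?W \<subseteq> PiE X (\<lambda>_. {0..<int p})"
    by (rule image_subsetI, rule restrict_PiE_iff[THEN iffD2]) (simp add: p_pos)
  moreover have "finite (PiE X (\<lambda>_. {0..<int p}))" using finX by (simp add: finite_PiE)
  ultimately have "card ?W \<le> card (PiE X (\<lambda>_. {0..<int p}))" by (rule card_inj_on_le)
  then have "p ^ r \<le> p ^ card X" using finX by (simp add: card_PiE)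
  then have rX: "r \<le> card X" using prime_gt_1_nat[OF p] by simp
  show ?thesis by (rule that[OF finX _ _ _ wtm rX]) (use sep X_def in blast)+
qed

end

section \<open>Groups of large representation dimension\<close>

context ext_group
begin

lemma E_nth: "u \<in> carrier E \<Longrightarrow> v \<in> carrier E \<Longrightarrow> i < d \<Longrightarrow> (u \<otimes>\<^bsub>E\<^esub> v) i = (u i + v i) mod int p"
  by (simp add: E_def elt_def prd_def)

lemma E_one_nth: "i < d + r \<Longrightarrow> \<one>\<^bsub>E\<^esub> i = 0"
  by (simp add: E_one elt_def)

lemma E_range: "u \<in> carrier E \<Longrightarrow> i < d + r \<Longrightarrow> 0 \<le> u i \<and> u i < int p"
  by (auto simp: E_def PiE_iff)

lemma zel_nth: "i < d \<Longrightarrow> zel w i = 0"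
  by (simp add: zel_def elt_def)

definition vanish :: "nat set \<Rightarrow> (nat \<Rightarrow> int) set" where
  "vanish I = {u \<in> carrier E. \<forall>i\<in>I. u i = 0}"

lemma vanish_subgroup:
  assumes I: "I \<subseteq> {..<d}" shows "subgroup (vanish I) E"
proof (rule group.subgroupI[OF E_group])
  interpret group E by (rule E_group)
  show "vanish I \<subseteq> carrier E" by (auto simp: vanish_def)
  have "\<one>\<^bsub>E\<^esub> \<in> vanish I" using I E_one_nth by (auto simp: vanish_def)
  then show "vanish I \<noteq> {}" by blast
  show "inv\<^bsub>E\<^esub> a \<in> vanish I" if a: "a \<in> vanish I" for a
  proof -
    have ac: "a \<in> carrier E" using a by (simp add: vanish_def)
    have "(inv\<^bsub>E\<^esub> a) i = 0" if i: "i \<in> I" for i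
    proof -
      have id: "i < d" using i I by auto
      have "(a \<otimes>\<^bsub>E\<^esub> inv\<^bsub>E\<^esub> a) i = (a i + (inv\<^bsub>E\<^esub> a) i) mod int p" by (rule E_nth[OF ac inv_closed[OF ac] id])
      then have "(inv\<^bsub>E\<^esub> a) i mod int p = 0" using a i ac E_one_nth[of i] id by (simp add: vanish_def)
      then show ?thesis using E_range[of "inv\<^bsub>E\<^esub> a" i] ac id by simp
    qed
    then show ?thesis using ac by (simp add: vanish_def)
  qed
  show "a \<otimes>\<^bsub>E\<^esub> b \<in> vanish I" if ab: "a \<in> vanish I" "b \<in> vanish I" for a b
  proof -
    have "(a \<otimes>\<^bsub>E\<^esub> b) i = 0" if "i \<in> I" for i
      using E_nth[of a b i] ab that I by (auto simp: vanish_def)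
    then show ?thesis using ab by (simp add: vanish_def)
  qed
qed

lemma Z_vanish: "I \<subseteq> {..<d} \<Longrightarrow> Z \<subseteq> vanish I"
  using zel_nth by (auto simp: Z_def vanish_def)

lemma commute_of_bil_eq:
  assumes "x \<in> carrier E" "y \<in> carrier E" "\<And>s. bil s x y = bil s y x"
  shows "x \<otimes>\<^bsub>E\<^esub> y = y \<otimes>\<^bsub>E\<^esub> x"
proof -
  have "prd x y = prd y x" using assms(3) by (auto simp: prd_def)
  then show ?thesis by (simp add: E_def)
qed

text \<open>Gives every label weight 1, even one whose form is zero.\<close>

lemma good_trivial: "good a Z {\<one>\<^bsub>E\<^esub>}"
  unfolding good_def
proof (intro conjI ballI impI)
  show "x \<otimes>\<^bsub>E\<^esub> y = y \<otimes>\<^bsub>E\<^esub> x" if "x \<in> Z" "y \<in> Z" for x y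
    by (rule Z_central[OF that(2) subgroup.mem_carrier[OF Z_subgroup that(1)]])
  show "{\<one>\<^bsub>E\<^esub>} \<subseteq> carrier E" by (simp add: E_one)
qed (use Z_subgroup in auto)

lemma pair_neg: "pair a (\<lambda>s. - w s) = - pair a w"
  by (simp add: pair_def sum_negf)

text \<open>Here the last \<open>d - k\<close> coordinates give a common isotropic subspace.\<close>
lemma good_bipartite:
  assumes d: "d = 2 * k" and B0: "\<And>s i j. i \<ge> k \<Longrightarrow> B s i j = 0"
    and ND: "\<And>x. (\<And>j. j < k \<Longrightarrow> int p dvd pair a (\<lambda>s. \<Sum>i<k. B s i (k + j) * x i)) \<Longrightarrow> \<forall>i<k. int p dvd x i"
  obtains A S where "good a A S" "card S = p ^ k"
proof -
  interpret group E by (rule E_group)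
  have kd: "i < d" "i < d + r" if "i < k" for i using that d by auto
  have kj: "k + j < d" if "j < k" for j using that d by auto
  \<comment> \<open>The translating elements: residue vectors placed in the first k
    coordinates.\<close>
  define em where "em u = elt (\<lambda>i. if i < k then u i else 0)" for u :: "nat \<Rightarrow> int"
  let ?P = "PiE {..<k} (\<lambda>_. {0..<int p})"
  have em_nth: "em u i = u i" if "u \<in> ?P" "i < k" for u i using that kd(2)[of i] by (auto simp: em_def elt_def PiE_iff)
  have inj: "inj_on em ?P"
  proof (rule inj_onI)
    fix u v assume uv: "u \<in> ?P" "v \<in> ?P" "em u = em v"
    then have "u i = v i" if "i < k" for i using em_nth that by metis
    then show "u = v" using PiE_ext[OF uv(1,2)] by auto
  qed
  have cS: "card (em ` ?P) = p ^ k" using card_image[OF inj] by (simp add: card_PiE)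
  let ?A = "vanish {..<k}"
  have Ad: "{..<k} \<subseteq> {..<d}" using d by auto
  have bilA: "bil s x t = 0" if "x \<in> ?A" for s x t
    unfolding bil_def
  proof (intro sum.neutral ballI)
    fix i j show "B s i j * x i * t j = 0" using that B0[of i s j] by (cases "i < k") (auto simp: vanish_def)
  qed
  have "good a ?A (em ` ?P)"
    unfolding good_def
  proof (intro conjI ballI impI)
    show "subgroup ?A E" by (rule vanish_subgroup[OF Ad])
    show "Z \<subseteq> ?A" by (rule Z_vanish[OF Ad])
    show "x \<otimes>\<^bsub>E\<^esub> y = y \<otimes>\<^bsub>E\<^esub> x" if "x \<in> ?A" "y \<in> ?A" for x y
      using that by (intro commute_of_bil_eq) (auto simp: bilA vanish_def)
    show "em ` ?P \<subseteq> carrier E" unfolding em_def by (rule image_subsetI) (rule elt_carrier)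
    fix t t' assume t: "t \<in> em ` ?P" "t' \<in> em ` ?P" "t \<noteq> t'"
    then obtain u u' where u: "u \<in> ?P" "t = em u" "u' \<in> ?P" "t' = em u'" by blast
    have "u \<noteq> u'" using t u by auto
    then obtain i where i: "i < k" "\<not> [u i = u' i] (mod int p)" by (rule residue_vectors_differ[OF u(1,3)])
    then have "\<not> int p dvd u i - u' i" by (simp add: cong_iff_dvd_diff)
    then obtain j where j: "j < k" "\<not> int p dvd pair a (\<lambda>s. \<Sum>i<k. B s i (k + j) * (u i - u' i))"
      using ND[of "\<lambda>i. u i - u' i"] i(1) by blast
    \<comment> \<open>A unit vector in the isotropic half, at the coordinate where nondegeneracy
      detects the difference of the two translating elements.\<close>
    define x where "x = elt (\<lambda>i. if i = k + j then 1 else 0)"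
    have xn: "x i' = (if i' = k + j then 1 else 0)" if "i' < d" for i'
      using that prime_gt_1_nat[OF p] by (simp add: x_def elt_def)
    have "x \<in> carrier E" by (simp add: x_def)
    then have xA: "x \<in> ?A" using xn kd(1) by (simp add: vanish_def)
    have bt: "bil s (em w) x = (\<Sum>i<k. B s i (k + j) * w i)" if w: "w \<in> ?P" for s w
    proof -
      have "bil s (em w) x = (\<Sum>i<d. B s i (k + j) * em w i)"
        unfolding bil_def
      proof (intro sum.cong refl)
        fix i assume "i \<in> {..<d}"
        have "(\<Sum>j'<d. B s i j' * em w i * x j') = (\<Sum>j'<d. if j' = k + j then B s i (k + j) * em w i else 0)"
          using xn by (intro sum.cong) auto
        also have "\<dots> = B s i (k + j) * em w i" using kj[OF j(1)] by simp
        finally show "(\<Sum>j'<d. B s i j' * em w i * x j') = B s i (k + j) * em w i" .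
      qed
      also have "\<dots> = (\<Sum>i<k. B s i (k + j) * w i)"
        using B0 em_nth[OF w] Ad by (intro sum.mono_neutral_cong_right) auto
      finally show ?thesis .
    qed
    have "pair a (\<lambda>s. bil s x t - bil s t x) - pair a (\<lambda>s. bil s x t' - bil s t' x)
       = - pair a (\<lambda>s. \<Sum>i<k. B s i (k + j) * (u i - u' i))"
      unfolding pair_diff[symmetric] pair_neg[symmetric] u(2,4)
      by (rule arg_cong[of _ _ "pair a"]) (auto simp: bilA[OF xA] bt[OF u(1)] bt[OF u(3)] sum_subtractf right_diff_distrib)
    then have "\<not> [pair a (\<lambda>s. bil s x t - bil s t x) = pair a (\<lambda>s. bil s x t' - bil s t' x)] (mod int p)"
      using j(2) by (simp add: cong_iff_dvd_diff)
    then show "\<exists>x\<in>?A. \<not> [pair a (\<lambda>s. bil s x t - bil s t x) = pair a (\<lambda>s. bil s x t' - bil s t' x)] (mod int p)"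
      using xA by blast
  qed
  then show ?thesis using that cS by blast
qed

end

text \<open>The coefficient of X^i in the remainder of X^n modulo X^k - X^e - c. The test
  \<open>e < k\<close> makes the recursive arguments smaller; the value 0 is a mere default.\<close>

function rec_coeff :: "nat \<Rightarrow> int \<Rightarrow> nat \<Rightarrow> nat \<Rightarrow> nat \<Rightarrow> int" where
  "rec_coeff k c e n i = (if n < k then (if n = i then 1 else 0)
     else if e < k then c * rec_coeff k c e (n - k) i + rec_coeff k c e (n - k + e) i else 0)"
  by pat_completeness auto
termination by (relation "measure (\<lambda>(k, c, e, n, i). n)") auto

declare rec_coeff.simps [simp del]

lemma rec_coeff_less: "n < k \<Longrightarrow> rec_coeff k c e n i = (if n = i then 1 else 0)"
  by (subst rec_coeff.simps) simp

lemma rec_coeff_add: "e < k \<Longrightarrow> rec_coeff k c e (n + k) i = c * rec_coeff k c e n i + rec_coeff k c e (n + e) i"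
  by (subst rec_coeff.simps) simp

text \<open>A linear recurrence of order \<open>k\<close> modulo \<open>p\<close>, with characteristic polynomial \<open>X^k - X^e - c\<close>; shifting
  sequences by one place plays the role of the companion matrix.\<close>
definition rec_seq :: "nat \<Rightarrow> nat \<Rightarrow> int \<Rightarrow> nat \<Rightarrow> (nat \<Rightarrow> int) \<Rightarrow> bool" where
  "rec_seq p k c e y \<longleftrightarrow> (\<forall>n. [y (n + k) = c * y n + y (n + e)] (mod int p))"

definition rec_ext :: "nat \<Rightarrow> int \<Rightarrow> nat \<Rightarrow> (nat \<Rightarrow> int) \<Rightarrow> nat \<Rightarrow> int" where
  "rec_ext k c e x n = (\<Sum>i<k. rec_coeff k c e n i * x i)"

lemma rec_ext_less: "n < k \<Longrightarrow> rec_ext k c e x n = x n"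
  by (simp add: rec_ext_def rec_coeff_less if_distrib[of "\<lambda>z. z * _"] cong: if_cong)

lemma rec_ext_seq: "e < k \<Longrightarrow> rec_seq p k c e (rec_ext k c e x)"
  by (simp add: rec_seq_def rec_ext_def rec_coeff_add sum_distrib_left distrib_right sum.distrib mult.assoc)

lemma rec_seq_shift: "rec_seq p k c e y \<Longrightarrow> rec_seq p k c e (\<lambda>n. y (Suc n))"
  unfolding rec_seq_def
proof
  fix n assume "\<forall>n. [y (n + k) = c * y n + y (n + e)] (mod int p)"
  from this[rule_format, of "Suc n"] show "[y (Suc (n + k)) = c * y (Suc n) + y (Suc (n + e))] (mod int p)" by simp
qed

lemma rec_seq_scale: "rec_seq p k c e y \<Longrightarrow> rec_seq p k c e (\<lambda>n. a * y n)"
  unfolding rec_seq_def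
proof
  fix n assume "\<forall>n. [y (n + k) = c * y n + y (n + e)] (mod int p)"
  then have "[a * y (n + k) = a * (c * y n + y (n + e))] (mod int p)" by (intro cong_mult) auto
  then show "[a * y (n + k) = c * (a * y n) + a * y (n + e)] (mod int p)" by (simp add: algebra_simps)
qed

lemma rec_seq_add: "rec_seq p k c e y \<Longrightarrow> rec_seq p k c e z \<Longrightarrow> rec_seq p k c e (\<lambda>n. y n + z n)"
  unfolding rec_seq_def
proof
  fix n assume "\<forall>n. [y (n + k) = c * y n + y (n + e)] (mod int p)" "\<forall>n. [z (n + k) = c * z n + z (n + e)] (mod int p)"
  then have "[y (n + k) + z (n + k) = (c * y n + y (n + e)) + (c * z n + z (n + e))] (mod int p)" by (intro cong_add) auto
  then show "[y (n + k) + z (n + k) = c * (y n + z n) + (y (n + e) + z (n + e))] (mod int p)" by (simp add: algebra_simps)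
qed

lemma rec_seq_zero:
  assumes y: "rec_seq p k c e y" and e: "e < k" and z: "\<And>n. n < k \<Longrightarrow> int p dvd y n"
  shows "int p dvd y n"
proof (induction n rule: less_induct)
  case (less n)
  show ?case
  proof (cases "n < k")
    case False
    have "[y (n - k + k) = c * y (n - k) + y (n - k + e)] (mod int p)" using y by (simp add: rec_seq_def)
    moreover have "int p dvd y (n - k)" "int p dvd y (n - k + e)" using less False e by auto
    ultimately show ?thesis using False by (simp add: cong_dvd_iff)
  qed (rule z)
qed

text \<open>The pairing of the first \<open>k\<close> with the last \<open>k\<close> coordinates is given by the powers \<open>C\<^sup>s\<close>, \<open>s < l\<close>, of
  the shift. The flag \<open>D\<close> adds the commutator of the first two coordinates that is needed in order 128.\<close>
definition cocycle :: "nat \<Rightarrow> int \<Rightarrow> nat \<Rightarrow> nat \<Rightarrow> bool \<Rightarrow> nat \<Rightarrow> nat \<Rightarrow> nat \<Rightarrow> int" where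
  "cocycle k c e l D s i j = (if i \<ge> k then 0 else if j \<ge> k then (if s < l then rec_coeff k c e (j - k + s) i else 0)
     else if D \<and> s = 2 \<and> i = 0 \<and> j = 1 then 1 else 0)"

text \<open>The first l of the r central coordinates carry powers of the companion matrix; the
  others carry no commutator, except the one with index 2 when D holds.\<close>

locale rec_group = ext_group p "2 * k" r "cocycle k c e l D" for p k r :: nat and c :: int and e l :: nat and D :: bool +
  assumes l: "l \<le> r"
begin

text \<open>Entry (i,j) of C^s is the coefficient of X^i in X^(j+s), so applying C^s to x reads the
  extended sequence s places further on.\<close>

lemma pair_cocycle:
  assumes "j < k"
  shows "pair a (\<lambda>s. \<Sum>i<k. cocycle k c e l D s i (k + j) * x i) = (\<Sum>s<l. a s * rec_ext k c e x (j + s))"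
proof -
  have "pair a (\<lambda>s. \<Sum>i<k. cocycle k c e l D s i (k + j) * x i)
      = (\<Sum>s<r. if s < l then a s * rec_ext k c e x (j + s) else 0)"
    unfolding pair_def by (intro sum.cong) (auto simp: cocycle_def rec_ext_def)
  also have "\<dots> = (\<Sum>s<l. a s * rec_ext k c e x (j + s))"
    using l by (intro sum.mono_neutral_cong_right) auto
  finally show ?thesis .
qed

lemma good_rec:
  assumes "\<And>x. (\<And>j. j < k \<Longrightarrow> int p dvd (\<Sum>s<l. a s * rec_ext k c e x (j + s))) \<Longrightarrow> \<forall>i<k. int p dvd x i"
  obtains A S where "good a A S" "card S = p ^ k"
proof (rule good_bipartite[of k a])
  fix x assume H: "\<And>j. j < k \<Longrightarrow> int p dvd pair a (\<lambda>s. \<Sum>i<k. cocycle k c e l D s i (k + j) * x i)"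
  show "\<forall>i<k. int p dvd x i"
  proof (rule assms)
    fix j assume j: "j < k"
    show "int p dvd (\<Sum>s<l. a s * rec_ext k c e x (j + s))" using H[OF j] unfolding pair_cocycle[OF j] .
  qed
qed (use that in \<open>auto simp: cocycle_def\<close>)

lemma prime_int: "prime (int p)" using p by simp

lemma good_1:
  assumes "l = 1" "\<not> int p dvd a 0"
  obtains A S where "good a A S" "card S = p ^ k"
proof (rule good_rec[of a])
  fix x assume H: "\<And>j. j < k \<Longrightarrow> int p dvd (\<Sum>s<l. a s * rec_ext k c e x (j + s))"
  have "int p dvd x j" if "j < k" for j
  proof -
    have "int p dvd a 0 * x j" using H[OF that] rec_ext_less[OF that] assms(1) by simp
    then show ?thesis using assms(2) prime_int by (simp only: prime_dvd_mult_iff) blast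
  qed
  then show "\<forall>i<k. int p dvd x i" by blast
qed (rule that)

text \<open>This is injectivity of a_0 + a_1 C. If p divides a_1, the operator is multiplication by
  a unit. Otherwise a sequence in its kernel is geometric with ratio t = -a_0/a_1, and the
  recurrence says that y_0 = 0 or t is a root of X^k - X - c.\<close>

lemma good_2:
  assumes l2: "l = 2" and k: "k \<ge> 2" and e1: "e = 1" and nr: "\<And>t::int. \<not> int p dvd t ^ k - t - c"
    and a: "\<not> (int p dvd a 0 \<and> int p dvd a 1)"
  obtains A S where "good a A S" "card S = p ^ k"
proof (rule good_rec[of a])
  fix x assume H: "\<And>j. j < k \<Longrightarrow> int p dvd (\<Sum>s<l. a s * rec_ext k c e x (j + s))"
  define y where "y = rec_ext k c e x"
  have ek: "e < k" using e1 k by simp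
  have y: "rec_seq p k c e y" unfolding y_def by (rule rec_ext_seq[OF ek])
  have "rec_seq p k c e (\<lambda>n. a 0 * y n + a 1 * y (Suc n))"
    by (intro rec_seq_add rec_seq_scale rec_seq_shift y)
  moreover have "int p dvd a 0 * y n + a 1 * y (Suc n)" if "n < k" for n
    using H[OF that] by (simp add: l2 y_def numeral_2_eq_2)
  \<comment> \<open>The hypothesis covers only n < k; the combination satisfies the same recurrence,
    so its first k terms decide it.\<close>
  ultimately have all: "int p dvd a 0 * y n + a 1 * y (Suc n)" for n by (rule rec_seq_zero[OF _ ek])
  have "int p dvd y n" for n
  proof (cases "int p dvd a 1")
    case True
    then have "int p dvd a 0 * y n" using all[of n] by (simp add: dvd_add_left_iff)
    then show ?thesis using True a prime_int by (auto simp: prime_dvd_mult_iff)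
  next
    case False
    then have "coprime (a 1) (int p)" using prime_int by (simp add: prime_imp_coprime coprime_commute)
    then obtain b where b: "[a 1 * b = 1] (mod int p)" using cong_solve_coprime_int by blast
    define t where "t = - a 0 * b"
    have step: "[y (Suc n) = t * y n] (mod int p)" for n
    proof -
      have "[y (Suc n) = (a 1 * b) * y (Suc n)] (mod int p)"
        using cong_mult[OF cong_sym[OF b] cong_refl[of "y (Suc n)"]] by simp
      moreover have "[b * (a 0 * y n + a 1 * y (Suc n)) = 0] (mod int p)" using all[of n] by (simp add: cong_0_iff)
      then have "[(a 1 * b) * y (Suc n) = t * y n] (mod int p)"
        by (simp add: t_def cong_iff_dvd_diff algebra_simps)
      ultimately show ?thesis by (rule cong_trans)
    qed
    have pw: "[y n = t ^ n * y 0] (mod int p)" for n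
    proof (induction n)
      case (Suc n)
      have "[t * y n = t * (t ^ n * y 0)] (mod int p)" using Suc by (intro cong_mult) auto
      then show ?case using cong_trans[OF step] by (simp add: mult.assoc)
    qed simp
    have "[y k = c * y 0 + y 1] (mod int p)" using y[unfolded rec_seq_def, rule_format, of 0] e1 by simp
    moreover have "[c * y 0 + y 1 = c * y 0 + t * y 0] (mod int p)" using step[of 0] by (intro cong_add) auto
    ultimately have "[t ^ k * y 0 = c * y 0 + t * y 0] (mod int p)" using pw[of k] by (meson cong_sym cong_trans)
    then have "int p dvd (t ^ k - t - c) * y 0" by (simp add: cong_iff_dvd_diff algebra_simps)
    then have "int p dvd y 0" using nr[of t] prime_int by (auto simp: prime_dvd_mult_iff)
    then show ?thesis using pw[of n] by (simp add: cong_dvd_iff)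
  qed
  then show "\<forall>i<k. int p dvd x i" using rec_ext_less by (metis y_def)
qed (rule that)

end

text \<open>Only the commutator of the first two coordinates survives: use the centre together with the
  second coordinate, and translate by the first.\<close>
lemma (in rec_group) good_degenerate:
  assumes D: D and k: "k \<ge> 2" and r: "2 < r" and a: "\<not> int p dvd a 2"
  obtains A S where "good a A S" "card S = 2"
proof -
  let ?A = "vanish ({..<2 * k} - {1})"
  define t where "t = elt (\<lambda>i. if i = 0 then 1 else 0)"
  define x where "x = elt (\<lambda>i. if i = 1 then 1 else 0)"
  have I: "{..<2 * k} - {1} \<subseteq> {..<2 * k}" by auto
  have p1: "(1::int) mod int p = 1" using prime_gt_1_nat[OF p] by simp
  have tn: "t i = (if i = 0 then 1 else 0)" and xn: "x i = (if i = 1 then 1 else 0)" if "i < 2 * k" for i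
    using that p1 by (auto simp: t_def x_def elt_def)
  have d2: "0 < 2 * k" "1 < 2 * k" using k by auto
  \<comment> \<open>Only the term with i = j = 1 survives, and it is symmetric.\<close>
  have comm: "bil s u v = bil s v u" if "u \<in> ?A" "v \<in> ?A" for s u v
    unfolding bil_def
  proof (intro sum.cong refl)
    fix i j assume ij: "i \<in> {..<2 * k}" "j \<in> {..<2 * k}"
    have "i = 1 \<or> u i = 0 \<and> v i = 0" "j = 1 \<or> u j = 0 \<and> v j = 0" using that ij by (auto simp: vanish_def)
    then show "cocycle k c e l D s i j * u i * v j = cocycle k c e l D s i j * v i * u j" by auto
  qed
  have b1: "bil s x t = 0" for s
    unfolding bil_def
  proof (intro sum.neutral ballI)
    fix i j assume "i \<in> {..<2 * k}" "j \<in> {..<2 * k}"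
    then show "cocycle k c e l D s i j * x i * t j = 0" using k by (auto simp: xn tn cocycle_def)
  qed
  have b2: "bil s t x = (if s = 2 then 1 else 0)" for s
  proof -
    have "bil s t x = (\<Sum>i<2 * k. if i = 0 then cocycle k c e l D s 0 1 else 0)"
      unfolding bil_def
    proof (intro sum.cong refl)
      fix i assume i: "i \<in> {..<2 * k}"
      have "(\<Sum>j<2 * k. cocycle k c e l D s i j * t i * x j) = (\<Sum>j<2 * k. if j = 1 then cocycle k c e l D s i 1 * t i else 0)"
        by (intro sum.cong) (auto simp: xn)
      also have "\<dots> = cocycle k c e l D s i 1 * t i" using d2 by simp
      finally show "(\<Sum>j<2 * k. cocycle k c e l D s i j * t i * x j) = (if i = 0 then cocycle k c e l D s 0 1 else 0)"
        using i by (simp add: tn)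
    qed
    also have "\<dots> = cocycle k c e l D s 0 1" using d2 by simp
    also have "\<dots> = (if s = 2 then 1 else 0)" using D k by (simp add: cocycle_def)
    finally show ?thesis .
  qed
  have b3: "bil s x \<one>\<^bsub>E\<^esub> = 0" "bil s \<one>\<^bsub>E\<^esub> x = 0" for s
    unfolding bil_def by (auto intro!: sum.neutral simp: E_one_nth)
  have "x \<in> carrier E" by (simp add: x_def)
  then have xA: "x \<in> ?A" using xn by (auto simp: vanish_def)
  have "pair a (\<lambda>s. bil s x t - bil s t x) = (\<Sum>s<r. if s = 2 then - a 2 else 0)"
    unfolding pair_def b1 b2 by (intro sum.cong) auto
  then have pv: "pair a (\<lambda>s. bil s x t - bil s t x) = - a 2" using r by simp
  have p0: "pair a (\<lambda>s. bil s x \<one>\<^bsub>E\<^esub> - bil s \<one>\<^bsub>E\<^esub> x) = 0" by (simp add: b3 pair_def)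
  have nt: "t \<noteq> \<one>\<^bsub>E\<^esub>" using tn[OF d2(1)] E_one_nth[of 0] d2 by auto
  have nc: "\<not> [- a 2 = 0] (mod int p)" "\<not> [0 = - a 2] (mod int p)" using a by (auto simp: cong_iff_dvd_diff)
  have "good a ?A {t, \<one>\<^bsub>E\<^esub>}"
    unfolding good_def
  proof (intro conjI ballI impI)
    show "subgroup ?A E" by (rule vanish_subgroup[OF I])
    show "Z \<subseteq> ?A" by (rule Z_vanish[OF I])
    show "u \<otimes>\<^bsub>E\<^esub> v = v \<otimes>\<^bsub>E\<^esub> u" if "u \<in> ?A" "v \<in> ?A" for u v
      by (rule commute_of_bil_eq) (use that comm in \<open>auto simp: vanish_def\<close>)
    show "{t, \<one>\<^bsub>E\<^esub>} \<subseteq> carrier E" by (auto simp: E_one t_def)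
    fix q q' assume "q \<in> {t, \<one>\<^bsub>E\<^esub>}" "q' \<in> {t, \<one>\<^bsub>E\<^esub>}" "q \<noteq> q'"
    then consider "q = t" "q' = \<one>\<^bsub>E\<^esub>" | "q = \<one>\<^bsub>E\<^esub>" "q' = t" by blast
    then show "\<exists>x\<in>?A. \<not> [pair a (\<lambda>s. bil s x q - bil s q x) = pair a (\<lambda>s. bil s x q' - bil s q' x)] (mod int p)"
      by cases (intro bexI[OF _ xA], simp only: pv p0 nc not_False_eq_True)+
  qed
  then show ?thesis using that nt by (metis card_2_iff)
qed

text \<open>Injectivity of the shift \<open>C\<close>, of \<open>1 + C\<close> and of \<open>1 + C + C\<^sup>2\<close>: the trinomial \<open>X^k + X^e + 1\<close> has no
  factor of degree at most 2 over the field with two elements.\<close>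
context
  fixes k e :: nat and y :: "nat \<Rightarrow> int"
  assumes e: "e = (if k mod 3 = 2 then 2 else 1)" and k: "k \<ge> 3"
begin

lemma shift_even:
  assumes y: "rec_seq 2 k 1 e y" and H: "\<And>n. even (y (Suc n))" shows "even (y n)"
proof -
  have "[y k = y 0 + y e] (mod 2)" using y[unfolded rec_seq_def, rule_format, of 0] by simp
  moreover have "even (y k)" "even (y e)" using H[of "k - 1"] H[of "e - 1"] k e by (auto split: if_splits simp: numeral_2_eq_2)
  ultimately have "even (y 0)" by (metis cong_dvd_iff dvd_add_left_iff)
  then show ?thesis using H by (cases n) auto
qed

text \<open>All terms have the parity of y_0, and the recurrence then reads y_0 = y_0 + y_0.\<close>

lemma add_shift_even:
  assumes y: "rec_seq 2 k 1 e y" and H: "\<And>n. even (y n + y (Suc n))" shows "even (y n)"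
proof -
  have c: "even (y n) \<longleftrightarrow> even (y 0)" for n by (induction n) (use H in auto)
  have "[y k = y 0 + y e] (mod 2)" using y[unfolded rec_seq_def, rule_format, of 0] by simp
  then have "even (y k) \<longleftrightarrow> even (y 0 + y e)" by (metis cong_dvd_iff)
  then have "even (y 0)" using c[of k] c[of e] by auto
  then show ?thesis using c by blast
qed

text \<open>The hypothesis makes the sequence 3-periodic modulo 2, so k may be replaced by its
  residue modulo 3. Two instances of the recurrence then annihilate two of the first three terms,
  and the hypothesis the third. For k = 2 modulo 3 the choice e = 1 would only repeat the
  hypothesis, hence e = 2.\<close>

lemma add_shift2_even:
  assumes y: "rec_seq 2 k 1 e y" and H: "\<And>n. even (y n + y (Suc n) + y (Suc (Suc n)))" shows "even (y n)"
proof -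
  have c3: "even (y (n + 3 * q)) \<longleftrightarrow> even (y n)" for n q
  proof (induction q)
    case (Suc q)
    have "even (y (Suc (Suc (Suc m)))) \<longleftrightarrow> even (y m)" for m using H[of m] H[of "Suc m"] by auto
    from this[of "n + 3 * q"] show ?case using Suc by (simp add: add.commute numeral_3_eq_3)
  qed simp
  have rel: "even (y (n + k)) \<longleftrightarrow> even (y n + y (n + e))" for n
    using y[unfolded rec_seq_def, rule_format, of n] by (metis cong_dvd_iff mult_1 of_nat_numeral)
  have km: "k = k mod 3 + 3 * (k div 3)" by simp
  have kk: "even (y (n + k)) \<longleftrightarrow> even (y (n + k mod 3))" for n
    using c3[of "n + k mod 3" "k div 3"] km by (metis add.assoc)
  have "k mod 3 = 0 \<or> k mod 3 = 1 \<or> k mod 3 = 2" by auto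
  then have "even (y 0) \<and> even (y 1) \<and> even (y 2)"
  proof (elim disjE)
    assume m: "k mod 3 = 0"
    then show ?thesis using rel[of 0] rel[of 1] kk[of 0] kk[of 1] e H[of 0] by (auto simp: numeral_2_eq_2)
  next
    assume m: "k mod 3 = 1"
    then show ?thesis using rel[of 0] rel[of 1] kk[of 0] kk[of 1] e H[of 0] by (auto simp: numeral_2_eq_2)
  next
    assume m: "k mod 3 = 2"
    then show ?thesis using rel[of 0] rel[of 1] kk[of 0] kk[of 1] e H[of 0] by (auto simp: numeral_2_eq_2)
  qed
  then have b: "even (y (n mod 3))" for n
  proof -
    have "n mod 3 = 0 \<or> n mod 3 = 1 \<or> n mod 3 = 2" by auto
    then show ?thesis using \<open>even (y 0) \<and> even (y 1) \<and> even (y 2)\<close> by auto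
  qed
  have "n = n mod 3 + 3 * (n div 3)" by simp
  then show ?thesis using c3[of "n mod 3" "n div 3"] b by metis
qed

end

text \<open>Each of the seven nonzero polynomials of degree at most 2 over the field with two
  elements is 1 + X + X^2 or a product of factors X and 1 + X; for instance 1 + X^2 = (1 + X)^2. The
  factors are removed one at a time.\<close>

lemma quadratic_shift_even:
  fixes k e :: nat and a0 a1 a2 :: int
  assumes e: "e = (if k mod 3 = 2 then 2 else 1)" and k: "k \<ge> 3" and y: "rec_seq 2 k 1 e y"
    and H: "\<And>n. even (a0 * y n + a1 * y (Suc n) + a2 * y (Suc (Suc n)))"
    and a: "\<not> (even a0 \<and> even a1 \<and> even a2)"
  shows "even (y n)"
proof -
  note s1 = shift_even[OF e k] and s2 = add_shift_even[OF e k] and s3 = add_shift2_even[OF e k]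
  let ?y1 = "\<lambda>n. y (Suc n)"
  have y1: "rec_seq 2 k 1 e ?y1" by (rule rec_seq_shift[OF y])
  have ysum: "rec_seq 2 k 1 e (\<lambda>n. y n + y (Suc n))" by (rule rec_seq_add[OF y y1])
  consider "odd a0" "even a1" "even a2" | "even a0" "odd a1" "even a2" | "even a0" "even a1" "odd a2"
    | "odd a0" "odd a1" "even a2" | "even a0" "odd a1" "odd a2" | "odd a0" "even a1" "odd a2" | "odd a0" "odd a1" "odd a2"
    using a by auto
  then show ?thesis
  proof cases
    case 1 then show ?thesis using H[of n] by auto
  next
    case 2 then have "even (y (Suc n))" for n using H[of n] by auto
    then show ?thesis by (rule s1[OF y])
  next
    case 3 then have "even (?y1 (Suc n))" for n using H[of n] by auto
    then have "even (?y1 n)" for n by (rule s1[OF y1])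
    then show ?thesis by (rule s1[OF y])
  next
    case 4 then have "even (y n + y (Suc n))" for n using H[of n] by auto
    then show ?thesis by (rule s2[OF y])
  next
    case 5 then have "even (?y1 n + ?y1 (Suc n))" for n using H[of n] by auto
    then have "even (?y1 n)" for n by (rule s2[OF y1])
    then show ?thesis by (rule s1[OF y])
  next
    case 6 then have "even ((y n + y (Suc n)) + (y (Suc n) + y (Suc (Suc n))))" for n using H[of n] by auto
    then have "even (y n + y (Suc n))" for n by (rule s2[OF ysum])
    then show ?thesis by (rule s2[OF y])
  next
    case 7 then have "even (y n + y (Suc n) + y (Suc (Suc n)))" for n using H[of n] by auto
    then show ?thesis by (rule s3[OF y])
  qed
qed

lemma (in rec_group) good_3:
  assumes p2: "p = 2" and l3: "l = 3" and c1: "c = 1" and k: "k \<ge> 3" and e: "e = (if k mod 3 = 2 then 2 else 1)"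
    and a: "\<not> (even (a 0) \<and> even (a 1) \<and> even (a 2))"
  obtains A S where "good a A S" "card S = p ^ k"
proof (rule good_rec[of a])
  fix x assume H: "\<And>j. j < k \<Longrightarrow> int p dvd (\<Sum>s<l. a s * rec_ext k c e x (j + s))"
  define y where "y = rec_ext k c e x"
  have ek: "e < k" using e k by simp
  have y: "rec_seq 2 k 1 e y" unfolding y_def c1 by (rule rec_ext_seq[OF ek])
  have "rec_seq 2 k 1 e (\<lambda>n. a 0 * y n + a 1 * y (Suc n) + a 2 * y (Suc (Suc n)))"
    by (intro rec_seq_add rec_seq_scale rec_seq_shift[of _ _ _ _ "\<lambda>n. y (Suc n)"] rec_seq_shift[OF y] y)
  moreover have "int 2 dvd a 0 * y n + a 1 * y (Suc n) + a 2 * y (Suc (Suc n))" if "n < k" for n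
    using H[OF that] p2 by (simp add: l3 y_def numeral_3_eq_3 numeral_2_eq_2)
  ultimately have all: "int 2 dvd a 0 * y n + a 1 * y (Suc n) + a 2 * y (Suc (Suc n))" for n
    by (rule rec_seq_zero[OF _ ek])
  have "even (y n)" for n
    by (rule quadratic_shift_even[OF e k y _ a]) (use all in simp)
  then show "\<forall>i<k. int p dvd x i" using rec_ext_less p2 by (metis y_def of_nat_numeral)
qed (rule that)

text \<open>The map \<open>t \<mapsto> t^k - t\<close> takes the same value at 0 and 1, so it misses some residue.\<close>
lemma exists_no_root:
  assumes "prime p" "k \<ge> 2" obtains c :: int where "\<And>t::int. \<not> int p dvd t ^ k - t - c"
proof -
  have p2: "p \<ge> 2" using prime_ge_2_nat[OF assms(1)] .
  let ?P = "{0..<int p}" and ?h = "\<lambda>t::int. (t ^ k - t) mod int p"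
  have "\<not> inj_on ?h ?P"
  proof
    assume "inj_on ?h ?P"
    then have "(0::int) = 1" by (rule inj_onD) (use p2 assms in \<open>auto simp: power_0_left\<close>)
    then show False by simp
  qed
  moreover have "?h ` ?P \<subseteq> ?P" using p2 by auto
  ultimately have "?h ` ?P \<noteq> ?P" using finite_surj_inj[of ?P ?h] by auto
  then obtain c where c: "c \<in> ?P" "c \<notin> ?h ` ?P" using \<open>?h ` ?P \<subseteq> ?P\<close> by blast
  have "\<not> int p dvd t ^ k - t - c" for t
  proof
    assume "int p dvd t ^ k - t - c"
    then have "(t ^ k - t) mod int p = c mod int p" by (simp add: mod_eq_dvd_iff)
    moreover have "[(t mod int p) ^ k - t mod int p = t ^ k - t] (mod int p)"
      by (intro cong_diff cong_pow) (auto simp: cong_def)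
    then have "((t mod int p) ^ k - t mod int p) mod int p = (t ^ k - t) mod int p" by (simp add: cong_def)
    ultimately have "?h (t mod int p) = c" using c by simp
    moreover have "t mod int p \<in> ?P" using p2 by simp
    ultimately show False using c(2) by blast
  qed
  then show ?thesis using that by blast
qed

text \<open>Bounding every faithful representation avoids \<open>rdim\<close> here; the element type
  is that of the extension groups, and transport to natural numbers is done once for all
  orders.\<close>

definition has_lower :: "nat \<Rightarrow> nat \<Rightarrow> nat \<Rightarrow> bool" where
  "has_lower p n v \<longleftrightarrow> (\<exists>G :: (nat \<Rightarrow> int) monoid. group G \<and> finite (carrier G) \<and> card (carrier G) = p ^ n
     \<and> (\<forall>m \<rho>. \<rho> \<in> hom G (GL m) \<longrightarrow> inj_on \<rho> (carrier G) \<longrightarrow> v \<le> m))"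

lemma (in rec_group) has_lowerI:
  assumes "n = 2 * k + r" "\<And>m \<rho>. \<rho> \<in> hom E (GL m) \<Longrightarrow> inj_on \<rho> (carrier E) \<Longrightarrow> v \<le> m"
  shows "has_lower p n v"
  unfolding has_lower_def
proof (intro exI[of _ E] conjI allI impI)
  show "card (carrier E) = p ^ n" using card_E assms(1) by simp
qed (use E_group finite_E assms(2) in auto)

lemma (in rec_group) has_lower_uniform:
  assumes "\<And>a. \<exists>s<r. \<not> int p dvd a s \<Longrightarrow> \<exists>A S. good a A S \<and> w \<le> card S" and n: "n = 2 * k + r"
  shows "has_lower p n (r * w)"
proof (rule has_lowerI[OF n])
  fix m \<rho> assume r: "\<rho> \<in> hom E (GL m)" "inj_on \<rho> (carrier E)"
  obtain X :: "(nat \<Rightarrow> int) set" where X: "(\<Sum>a\<in>X. w) \<le> m" "r \<le> card X"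
    by (rule lower_bound[OF r assms(1)])
  have "r * w \<le> card X * w" using X(2) by (rule mult_le_mono1)
  moreover have "(\<Sum>a\<in>X. w) = card X * w" by simp
  ultimately show "r * w \<le> m" using X(1) by linarith
qed

text \<open>With k = 0 the extension is the elementary abelian group of rank r.\<close>

lemma has_lower_elementary:
  assumes "prime p" "n = r" shows "has_lower p n r"
proof -
  interpret rec_group p 0 r 0 0 0 False by unfold_locales (use assms in auto)
  have "has_lower p r (r * 1)"
  proof (rule has_lower_uniform)
    fix a show "\<exists>A S. good a A S \<and> 1 \<le> card S"
    proof (intro exI conjI)
      show "good a Z {\<one>\<^bsub>E\<^esub>}" by (rule good_trivial)
    qed simp
  qed simp
  then show ?thesis using assms(2) by simp
qed

text \<open>The pairing is the standard dot product, so this is a Heisenberg group.\<close>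

lemma has_lower_1:
  assumes "prime p" shows "has_lower p (2 * k + 1) (p ^ k)"
proof -
  interpret rec_group p k 1 0 0 1 False by unfold_locales (use assms in auto)
  have "has_lower p (2 * k + 1) (1 * p ^ k)"
  proof (rule has_lower_uniform)
    fix a :: "nat \<Rightarrow> int" assume "\<exists>s<1. \<not> int p dvd a s"
    then have "\<not> int p dvd a 0" by simp
    then obtain A S where "good a A S" "card S = p ^ k" by (rule good_1[OF refl])
    then show "\<exists>A S. good a A S \<and> p ^ k \<le> card S" by (intro exI[of _ A] exI[of _ S]) simp
  qed simp
  then show ?thesis by simp
qed

lemma has_lower_2:
  assumes "prime p" "k \<ge> 2" shows "has_lower p (2 * k + 2) (2 * p ^ k)"
proof -
  obtain c :: int where c: "\<And>t::int. \<not> int p dvd t ^ k - t - c" using exists_no_root[OF assms] by blast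
  \<comment> \<open>The polynomial X^k - X - c without roots, with both central coordinates carrying
    a power of its companion matrix.\<close>
  interpret rec_group p k 2 c 1 2 False by unfold_locales (use assms in auto)
  show ?thesis
  proof (rule has_lower_uniform)
    fix a :: "nat \<Rightarrow> int" assume "\<exists>s<2. \<not> int p dvd a s"
    then have "\<not> (int p dvd a 0 \<and> int p dvd a 1)" by (auto simp: less_2_cases_iff)
    then obtain A S where "good a A S" "card S = p ^ k" by (rule good_2[OF refl assms(2) refl c])
    then show "\<exists>A S. good a A S \<and> p ^ k \<le> card S" by (intro exI[of _ A] exI[of _ S]) simp
  qed simp
qed

lemma has_lower_3:
  assumes "k \<ge> 3" shows "has_lower 2 (2 * k + 3) (3 * 2 ^ k)"
proof -
  define e :: nat where "e = (if k mod 3 = 2 then 2 else 1)"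
  interpret rec_group 2 k 3 1 e 3 False by unfold_locales auto
  show ?thesis
  proof (rule has_lower_uniform)
    fix a :: "nat \<Rightarrow> int" assume "\<exists>s<3. \<not> int 2 dvd a s"
    then have "\<not> (even (a 0) \<and> even (a 1) \<and> even (a 2))" by (auto simp: less_Suc_eq numeral_3_eq_3 numeral_2_eq_2)
    then obtain A S where "good a A S" "card S = 2 ^ k" by (rule good_3[OF refl refl refl assms e_def])
    then show "\<exists>A S. good a A S \<and> 2 ^ k \<le> card S" by (intro exI[of _ A] exI[of _ S]) simp
  qed simp
qed

text \<open>The Heisenberg group of order p^3 times a cyclic group of order p. Separating the first
  central coordinate requires a label of weight p, and at least two labels occur.\<close>

lemma has_lower_4:
  assumes "prime p" shows "has_lower p 4 (p + 1)"
proof -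
  interpret rec_group p 1 2 0 0 1 False by unfold_locales (use assms in auto)
  show ?thesis
  proof (rule has_lowerI)
    fix m \<rho> assume r: "\<rho> \<in> hom E (GL m)" "inj_on \<rho> (carrier E)"
    let ?wt = "\<lambda>a. if int p dvd a 0 then 1 else p"
    have H: "\<exists>A S. good a A S \<and> ?wt a \<le> card S" for a
    proof (cases "int p dvd a 0")
      case True
      show ?thesis
      proof (intro exI conjI)
        show "good a Z {\<one>\<^bsub>E\<^esub>}" by (rule good_trivial)
      qed (use True in simp)
    next
      case False
      then obtain A S where "good a A S" "card S = p ^ 1" by (rule good_1[OF refl])
      then show ?thesis using False by (intro exI[of _ A] exI[of _ S]) simp
    qed
    obtain X where X: "finite X" "\<forall>w. (\<exists>s<2. \<not> int p dvd w s) \<longrightarrow> (\<exists>a\<in>X. \<not> int p dvd pair a w)"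
        "(\<Sum>a\<in>X. ?wt a) \<le> m" "2 \<le> card X"
      by (rule lower_bound[OF r H])
    obtain a where a: "a \<in> X" "\<not> int p dvd pair a (\<lambda>s. if s = 0 then 1 else 0)"
      using X(2)[rule_format, of "\<lambda>s. if s = 0 then 1 else 0"] prime_gt_1_nat[OF assms] by force
    then have a0: "\<not> int p dvd a 0" unfolding pair_def by (simp add: numeral_2_eq_2)
    have "card (X - {a}) \<ge> 1" using X(1,4) a(1) by simp
    moreover have "(\<Sum>b\<in>X - {a}. 1) \<le> (\<Sum>b\<in>X - {a}. ?wt b)" using prime_ge_1_nat[OF assms] by (intro sum_mono) auto
    moreover have "(\<Sum>b\<in>X. ?wt b) = ?wt a + (\<Sum>b\<in>X - {a}. ?wt b)" using X(1) a(1) by (rule sum.remove)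
    ultimately show "p + 1 \<le> m" using X(3) a0 by simp
  qed simp
qed

lemma (in rec_group) degree_ge_10:
  assumes p2: "p = 2" and r3: "r = 3" and rho: "\<rho> \<in> hom E (GL m)" "inj_on \<rho> (carrier E)"
    and H: "\<And>a. \<exists>s<r. \<not> int p dvd a s \<Longrightarrow>
      \<exists>A S. good a A S \<and> (if int p dvd a 0 \<and> int p dvd a 1 then 2 else 4) \<le> card S"
  shows "10 \<le> m"
proof -
  let ?bad = "\<lambda>a :: nat \<Rightarrow> int. int p dvd a 0 \<and> int p dvd a 1"
  let ?wt = "\<lambda>a. if ?bad a then 2 else 4 :: nat"
  obtain X where X: "finite X" "X \<subseteq> PiE {..<r} (\<lambda>_. {0..<int p})"
      "\<forall>a\<in>X. \<exists>s<r. \<not> int p dvd a s" "(\<Sum>a\<in>X. ?wt a) \<le> m" "r \<le> card X"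
    by (rule lower_bound[OF rho, where wt = ?wt, OF H])
  have X2: "X \<subseteq> PiE {..<3} (\<lambda>_. {0..<2})" using X(2) p2 r3 by simp
  have val: "a 0 = 0 \<and> a 1 = 0 \<and> a 2 = 1" if a: "a \<in> X" "?bad a" for a
  proof -
    have v: "a s = 0 \<or> a s = 1" if "s < 3" for s using subsetD[OF X2 a(1)] that by (force simp: PiE_iff)
    have "a 0 = 0" "a 1 = 0" using v[of 0] v[of 1] a(2) p2 by auto
    moreover obtain s where s: "s < 3" "\<not> int p dvd a s" using X(3) a(1) r3 by auto
    then have "s = 2" using a(2) by (auto simp: less_Suc_eq numeral_3_eq_3 numeral_2_eq_2)
    ultimately show ?thesis using s v[of 2] by auto
  qed
  let ?Y = "{a \<in> X. ?bad a}"
  have "a = b" if ab: "a \<in> ?Y" "b \<in> ?Y" for a b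
  proof (rule PiE_ext)
    show "a \<in> PiE {..<3} (\<lambda>_. {0..<2})" "b \<in> PiE {..<3} (\<lambda>_. {0..<2})" using X2 ab by auto
    fix s :: nat assume "s \<in> {..<3}"
    then consider "s = 0" | "s = 1" | "s = 2" by fastforce
    then show "a s = b s" using val[of a] val[of b] ab by cases auto
  qed
  then have cY: "card ?Y \<le> 1" by (auto simp: card_le_Suc0_iff_eq X(1))
  have "(\<Sum>a\<in>X. ?wt a) = (\<Sum>a\<in>X - ?Y. ?wt a) + (\<Sum>a\<in>?Y. ?wt a)"
    using X(1) by (intro sum.subset_diff) auto
  also have "(\<Sum>a\<in>X - ?Y. ?wt a) = (\<Sum>a\<in>X - ?Y. 4)" by (intro sum.cong) auto
  also have "(\<Sum>a\<in>?Y. ?wt a) = (\<Sum>a\<in>?Y. 2)" by (intro sum.cong) auto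
  also have "(\<Sum>a\<in>X - ?Y. 4) + (\<Sum>a\<in>?Y. 2) = 4 * card (X - ?Y) + 2 * card ?Y" by simp
  also have "card (X - ?Y) = card X - card ?Y" using X(1) by (intro card_Diff_subset) auto
  finally show "10 \<le> m" using X(4,5) cY r3 by linarith
qed

lemma no_root_quadratic: "\<not> int 2 dvd t ^ 2 - t - (1::int)"
proof
  assume "int 2 dvd t ^ 2 - t - 1"
  then have "even (t ^ 2 - t - 1)" by simp
  moreover have "even (t ^ 2 - t)" by simp
  ultimately have "even ((t ^ 2 - t) - (t ^ 2 - t - 1))" by (rule dvd_diff[rotated])
  then show False by simp
qed

lemma has_lower_2_7: "has_lower 2 7 10"
proof -
  have prime2: "prime (2::nat)" by simp
  have lt: "2 < (3::nat)" by simp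
  \<comment> \<open>The pencil comes from the irreducible X^2 - X - 1. The extra commutator in
    central coordinate 2 leaves the last two quotient coordinates isotropic, so labels with odd a_0
    or a_1 keep weight 4; it lifts (0,0,1) from weight 1 to weight 2.\<close>
  interpret rec_group 2 2 3 1 1 2 True
    by (intro rec_group.intro ext_group.intro root_exp.intro rec_group_axioms.intro prime2) simp
  show ?thesis
  proof (rule has_lowerI)
    fix m \<rho> assume rho: "\<rho> \<in> hom E (GL m)" "inj_on \<rho> (carrier E)"
    show "10 \<le> m"
    proof (rule degree_ge_10[OF refl refl rho])
      fix a :: "nat \<Rightarrow> int" assume a: "\<exists>s<3. \<not> int 2 dvd a s"
      show "\<exists>A S. good a A S \<and> (if int 2 dvd a 0 \<and> int 2 dvd a 1 then 2 else 4) \<le> card S"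
      proof (cases "int 2 dvd a 0 \<and> int 2 dvd a 1")
        case False
        then obtain A S where "good a A S" "card S = 2 ^ 2"
          by (rule good_2[OF refl order_refl refl no_root_quadratic])
        then show ?thesis using False by (intro exI[of _ A] exI[of _ S]) simp
      next
        case True
        obtain s where s: "s < 3" "\<not> int 2 dvd a s" using a by blast
        then have "s = 2" using True by (auto simp: less_Suc_eq numeral_3_eq_3 numeral_2_eq_2)
        then have "\<not> int 2 dvd a 2" using s by simp
        then obtain A S where "good a A S" "card S = 2" 
          by (rule good_degenerate[OF TrueI order_refl lt])
        then show ?thesis using True by (intro exI[of _ A] exI[of _ S]) simp
      qed
    qed
  qed simp
qed

section \<open>The maximum over all groups of order a given prime power\<close>

text \<open>\<open>M\<close> ranges over groups on natural numbers, so the group is transported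
  along a bijection onto an initial segment. A faithful representation of degree
  \<open>rdim G\<close>, pulled back, is subject to the lower bound.\<close>

lemma has_lower_rdim:
  assumes lower: "has_lower p n v" and p: "prime p" and n: "n \<ge> 1"
  obtains G :: "nat monoid" where "group G" "finite (carrier G)" "card (carrier G) = p ^ n" "v \<le> rdim G"
proof -
  obtain H :: "(nat \<Rightarrow> int) monoid" where H: "group H" "finite (carrier H)" "card (carrier H) = p ^ n"
    and low: "\<And>m \<rho>. \<rho> \<in> hom H (GL m) \<Longrightarrow> inj_on \<rho> (carrier H) \<Longrightarrow> v \<le> m"
    using lower unfolding has_lower_def by blast
  interpret H: group H by (rule H(1))
  obtain h where h: "bij_betw h (carrier H) {0..<p ^ n}" using ex_bij_betw_finite_nat[OF H(2)] H(3) by auto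
  define hi where "hi = inv_into (carrier H) h"
  have hi: "bij_betw hi {0..<p ^ n} (carrier H)" unfolding hi_def by (rule bij_betw_inv_into[OF h])
  have hc: "h x \<in> {0..<p ^ n}" if "x \<in> carrier H" for x using that h by (auto simp: bij_betw_def)
  have hic: "hi a \<in> carrier H" if "a \<in> {0..<p ^ n}" for a using that hi by (auto simp: bij_betw_def)
  have hih: "hi (h x) = x" if "x \<in> carrier H" for x unfolding hi_def using bij_betw_inv_into_left[OF h that] .
  have hhi: "h (hi a) = a" if "a \<in> {0..<p ^ n}" for a unfolding hi_def using bij_betw_inv_into_right[OF h that] .
  define G where "G = \<lparr>carrier = {0..<p ^ n}, monoid.mult = (\<lambda>a b. h (hi a \<otimes>\<^bsub>H\<^esub> hi b)), one = h \<one>\<^bsub>H\<^esub>\<rparr>"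
  have Gs: "carrier G = {0..<p ^ n}" "\<And>a b. a \<otimes>\<^bsub>G\<^esub> b = h (hi a \<otimes>\<^bsub>H\<^esub> hi b)" "\<one>\<^bsub>G\<^esub> = h \<one>\<^bsub>H\<^esub>"
    by (simp_all add: G_def)
  have grp: "group G"
  proof (rule groupI; unfold Gs)
    show "h (hi a \<otimes>\<^bsub>H\<^esub> hi b) \<in> {0..<p ^ n}" if "a \<in> {0..<p ^ n}" "b \<in> {0..<p ^ n}" for a b
      using hic[OF that(1)] hic[OF that(2)] by (intro hc) simp
    show "h \<one>\<^bsub>H\<^esub> \<in> {0..<p ^ n}" by (rule hc) simp
    show "h (hi (h (hi a \<otimes>\<^bsub>H\<^esub> hi b)) \<otimes>\<^bsub>H\<^esub> hi c) = h (hi a \<otimes>\<^bsub>H\<^esub> hi (h (hi b \<otimes>\<^bsub>H\<^esub> hi c)))"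
      if "a \<in> {0..<p ^ n}" "b \<in> {0..<p ^ n}" "c \<in> {0..<p ^ n}" for a b c
      using hic[OF that(1)] hic[OF that(2)] hic[OF that(3)] by (simp add: hih H.m_assoc)
    fix a assume a: "a \<in> {0..<p ^ n}"
    show "h (hi (h \<one>\<^bsub>H\<^esub>) \<otimes>\<^bsub>H\<^esub> hi a) = a" using hic[OF a] hhi[OF a] by (simp add: hih)
    have "h (hi (h (inv\<^bsub>H\<^esub> (hi a))) \<otimes>\<^bsub>H\<^esub> hi a) = h \<one>\<^bsub>H\<^esub>" using hic[OF a] by (simp add: hih)
    moreover have "h (inv\<^bsub>H\<^esub> (hi a)) \<in> {0..<p ^ n}" using hic[OF a] by (intro hc) simp
    ultimately show "\<exists>b\<in>{0..<p ^ n}. h (hi b \<otimes>\<^bsub>H\<^esub> hi a) = h \<one>\<^bsub>H\<^esub>" by blast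
  qed
  have pg: "p_group G p n"
    by (intro p_group.intro grp p_group_axioms.intro p) (simp add: Gs)
  let ?P = "\<lambda>m. m \<ge> 1 \<and> (\<exists>\<rho>. \<rho> \<in> hom G (GL m) \<and> inj_on \<rho> (carrier G))"
  have "\<exists>m. ?P m" using p_group.faithful_rep_exists[OF pg n] by blast
  then have "?P (rdim G)" unfolding rdim_def by (rule LeastI_ex)
  then obtain \<rho> where \<rho>: "\<rho> \<in> hom G (GL (rdim G))" "inj_on \<rho> (carrier G)" by blast
  have "\<rho> \<circ> h \<in> hom H (GL (rdim G))"
  proof (rule homI)
    show "(\<rho> \<circ> h) x \<in> carrier (GL (rdim G))" if "x \<in> carrier H" for x
      using hom_in_carrier[OF \<rho>(1), of "h x"] hc[OF that] by (simp add: Gs)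
    show "(\<rho> \<circ> h) (x \<otimes>\<^bsub>H\<^esub> y) = (\<rho> \<circ> h) x \<otimes>\<^bsub>GL (rdim G)\<^esub> (\<rho> \<circ> h) y" if "x \<in> carrier H" "y \<in> carrier H" for x y
    proof -
      have "h x \<otimes>\<^bsub>G\<^esub> h y = h (x \<otimes>\<^bsub>H\<^esub> y)" using that by (simp add: Gs hih)
      then show ?thesis using hom_mult[OF \<rho>(1), of "h x" "h y"] hc[OF that(1)] hc[OF that(2)] by (simp add: Gs(1))
    qed
  qed
  moreover have "inj_on (\<rho> \<circ> h) (carrier H)"
    using \<rho>(2) h by (intro comp_inj_on) (auto simp: bij_betw_def Gs)
  ultimately have "v \<le> rdim G" by (rule low)
  then show ?thesis using that[OF grp] by (simp add: Gs)
qed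

lemma M_eqI:
  assumes p: "prime p" and n: "n \<ge> 1" and lower: "has_lower p n v"
    and upper: "\<And>G :: nat monoid. p_group G p n \<Longrightarrow> rdim G \<le> v"
  shows "M p n = v"
proof -
  let ?S = "{rdim G | G :: nat monoid. group G \<and> finite (carrier G) \<and> card (carrier G) = p ^ n}"
  have up: "rdim G \<le> v" if "group G" "card (carrier G) = p ^ n" for G :: "nat monoid"
    using that p by (intro upper p_group.intro p_group_axioms.intro)
  obtain G :: "nat monoid" where G: "group G" "finite (carrier G)" "card (carrier G) = p ^ n" "v \<le> rdim G"
    by (rule has_lower_rdim[OF lower p n])
  have "rdim G = v" using up[OF G(1,3)] G(4) by (rule antisym)
  then have vS: "v \<in> ?S" using G by blast
  have le: "x \<le> v" if "x \<in> ?S" for x using that up by blast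
  \<comment> \<open>Infinitely many groups are in play; finiteness, which \<open>Max\<close>
    requires, comes from the upper bound.\<close>
  then have "finite ?S" by (intro finite_subset[of ?S "{..v}"]) auto
  then show ?thesis unfolding M_def using le vS by (intro Max_eqI)
qed

lemma f_eqI:
  assumes "1 \<le> r" "r \<le> n" "r * p ^ ((n - r) div 2) = v"
    and "\<And>r. 1 \<le> r \<Longrightarrow> r \<le> n \<Longrightarrow> r * p ^ ((n - r) div 2) \<le> v"
  shows "f p n = v"
proof -
  let ?S = "{r * p ^ ((n - r) div 2) | r. 1 \<le> r \<and> r \<le> n}"
  have "?S = (\<lambda>r. r * p ^ ((n - r) div 2)) ` {1..n}" by auto
  then have "finite ?S" by simp
  moreover have "v \<in> ?S" using assms(1-3) by blast
  ultimately show ?thesis unfolding f_def using assms(4) by (intro Max_eqI) auto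
qed

lemma M_eq_f:
  assumes p: "prime p" and n: "n \<ge> 1" and lower: "has_lower p n v"
    and r: "1 \<le> r" "r \<le> n" "r * p ^ ((n - r) div 2) = v"
    and le: "\<And>r. 1 \<le> r \<Longrightarrow> r \<le> n \<Longrightarrow> r * p ^ ((n - r) div 2) \<le> v"
  shows "M p n = f p n"
proof -
  have "M p n = v"
  proof (rule M_eqI[OF p n lower])
    fix G :: "nat monoid" assume "p_group G p n"
    then interpret p_group G p n .
    obtain r where r: "card omega = p ^ r" "1 \<le> r" "r \<le> n" using card_omega[OF n] .
    show "rdim G \<le> v" using rdim_le[OF n r(1)] le[OF r(2,3)] by linarith
  qed
  moreover have "f p n = v" by (rule f_eqI[OF r le])
  ultimately show ?thesis by simp
qed

section \<open>Arithmetic of the maximum defining \<open>f\<close>\<close>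

lemma mult_power_diff_le:
  fixes p :: nat
  assumes "c \<le> C * p ^ j" "j \<le> k" shows "c * p ^ (k - j) \<le> C * p ^ k"
proof -
  have "c * p ^ (k - j) \<le> (C * p ^ j) * p ^ (k - j)" using assms(1) by (rule mult_le_mono1)
  also have "\<dots> = C * p ^ k" using assms(2) by (simp add: mult.assoc flip: power_add)
  finally show ?thesis .
qed

lemma odd_le_power: fixes p :: nat assumes "p \<ge> 3" shows "2 * i + 1 \<le> p ^ i"
proof (induction i)
  case (Suc i)
  have "2 * Suc i + 1 \<le> 3 * (2 * i + 1)" by simp
  also have "\<dots> \<le> p * p ^ i" using assms Suc by (rule mult_le_mono)
  finally show ?case by simp
qed simp

lemma Suc_le_power2: "i + 1 \<le> 2 ^ i"
  by (induction i) auto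

lemma add_three_le_power2: "2 * i + 3 \<le> 3 * 2 ^ i"
  using Suc_le_power2[of i] by simp

text \<open>The values r = 2i and r = 2i + 1 share the exponent k - i, so only the larger one has to
  be compared with p^i.\<close>

lemma f_bound_odd_odd:
  assumes "p \<ge> 3" "1 \<le> r" "r \<le> 2 * k + 1" shows "r * p ^ ((2 * k + 1 - r) div 2) \<le> p ^ k"
proof -
  define i where "i = r div 2"
  have ik: "i \<le> k" and e: "(2 * k + 1 - r) div 2 = k - i" and ri: "r \<le> 2 * i + 1"
    using assms by (auto simp: i_def)
  have "r \<le> 1 * p ^ i" using ri odd_le_power[OF assms(1), of i] by simp
  from mult_power_diff_le[OF this ik] show ?thesis unfolding e by simp
qed

lemma f_bound_odd_even:
  assumes "p \<ge> 3" "1 \<le> r" "r \<le> 2 * k + 2" shows "r * p ^ ((2 * k + 2 - r) div 2) \<le> 2 * p ^ k"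
proof -
  define i where "i = (r - 1) div 2"
  have ik: "i \<le> k" and e: "(2 * k + 2 - r) div 2 = k - i" and ri: "r \<le> 2 * i + 2"
    using assms by (auto simp: i_def)
  have "r \<le> 2 * p ^ i" using ri odd_le_power[OF assms(1), of i] by simp
  from mult_power_diff_le[OF this ik] show ?thesis unfolding e by simp
qed

lemma f_bound_two_even:
  assumes "1 \<le> r" "r \<le> 2 * k + 2" shows "r * 2 ^ ((2 * k + 2 - r) div 2) \<le> (2 * 2 ^ k :: nat)"
proof -
  define i where "i = (r - 1) div 2"
  have ik: "i \<le> k" and e: "(2 * k + 2 - r) div 2 = k - i" and ri: "r \<le> 2 * i + 2"
    using assms by (auto simp: i_def)
  have "r \<le> 2 * 2 ^ i" using ri Suc_le_power2[of i] by simp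
  from mult_power_diff_le[OF this ik] show ?thesis unfolding e by simp
qed

lemma f_bound_two_odd:
  assumes "1 \<le> r" "r \<le> 2 * k + 3" shows "r * 2 ^ ((2 * k + 3 - r) div 2) \<le> (3 * 2 ^ k :: nat)"
\<comment> \<open>For r = 1 the exponent is k + 1, outside the pairing of 2i + 2 with 2i + 3 used
  otherwise.\<close>
proof (cases "r = 1")
  case True then show ?thesis by simp
next
  case False
  define i where "i = (r - 2) div 2"
  have ik: "i \<le> k" and e: "(2 * k + 3 - r) div 2 = k - i" and ri: "r \<le> 2 * i + 3"
    using assms False by (auto simp: i_def)
  have "r \<le> 3 * 2 ^ i" using ri add_three_le_power2[of i] by simp
  from mult_power_diff_le[OF this ik] show ?thesis unfolding e by simp
qed

section \<open>Exceptional values and the generic case\<close>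

lemma M_2_5: "M 2 5 = 5"
proof (rule M_eqI)
  show "has_lower 2 5 5" by (rule has_lower_elementary) simp_all
  fix G :: "nat monoid" assume "p_group G 2 5"
  then interpret p_group G 2 5 .
  obtain r where r: "card omega = 2 ^ r" "1 \<le> r" "r \<le> 5" using card_omega by auto
  have le: "rdim G \<le> r * 2 ^ ((5 - r) div 2)" using rdim_le[OF _ r(1)] by simp
  \<comment> \<open>The general bounds are 4, 4, 6, 4, 5. Only r = 3 exceeds 5, and there \<Omega>
    has index 4, which improves 6 to 2 + 2.\<close>
  consider "r = 1" | "r = 2" | "r = 3" | "r = 4" | "r = 5" using r by linarith
  then show "rdim G \<le> 5"
  proof cases
    case 3 then show ?thesis using rdim_le_index_p2[OF r(1)] by simp
  qed (use le in auto)
qed auto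

lemma M_2_7: "M 2 7 = 10"
proof (rule M_eqI)
  show "has_lower 2 7 10" by (rule has_lower_2_7)
  fix G :: "nat monoid" assume "p_group G 2 7"
  then interpret p_group G 2 7 .
  obtain r where r: "card omega = 2 ^ r" "1 \<le> r" "r \<le> 7" using card_omega by auto
  have le: "rdim G \<le> r * 2 ^ ((7 - r) div 2)" using rdim_le[OF _ r(1)] by simp
  \<comment> \<open>The general bounds are 8, 8, 12, 8, 10, 6, 7, so only r = 3 needs the special
    argument.\<close>
  consider "r = 1" | "r = 2" | "r = 3" | "r = 4" | "r = 5" | "r = 6" | "r = 7" using r by linarith
  then show "rdim G \<le> 10"
  proof cases
    case 3 then show ?thesis using rdim_le_128 r(1) by simp
  qed (use le in auto)
qed auto

lemma M_odd_4:
  assumes p: "prime p" "odd p" shows "M p 4 = p + 1"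
proof (rule M_eqI[OF p(1)])
  show "has_lower p 4 (p + 1)" by (rule has_lower_4[OF p(1)])
  have p3: "p \<ge> 3" using p prime_ge_2_nat[OF p(1)] by (cases "p = 2") auto
  fix G :: "nat monoid" assume "p_group G p 4"
  then interpret p_group G p 4 .
  obtain r where r: "card omega = p ^ r" "1 \<le> r" "r \<le> 4" using card_omega by auto
  have le: "rdim G \<le> r * p ^ ((4 - r) div 2)" using rdim_le[OF _ r(1)] by simp
  \<comment> \<open>The general bounds are p, 2p, 3, 4; for r = 2 the index of \<Omega> is p^2, and
    4 \<le> p + 1 uses that p is odd.\<close>
  consider "r = 1" | "r = 2" | "r = 3" | "r = 4" using r by linarith
  then show "rdim G \<le> p + 1"
  proof cases
    case 2 then show ?thesis using rdim_le_index_p2[OF r(1)] by simp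
  qed (use le p3 in auto)
qed simp

lemma even_eq_double_plus_2: "even n \<Longrightarrow> n \<ge> 1 \<Longrightarrow> \<exists>k. n = 2 * k + (2::nat)"
  by (intro exI[of _ "n div 2 - 1"]) (auto elim!: evenE)

lemma odd_eq_double_plus_3: "odd n \<Longrightarrow> n \<noteq> 1 \<Longrightarrow> \<exists>k. n = 2 * k + (3::nat)"
  by (intro exI[of _ "n div 2 - 1"]) (auto elim!: oddE)

lemma M_generic:
  assumes p: "prime p" and n: "n \<ge> 1" and ne: "\<not> ((p = 2 \<and> n = 5) \<or> (p = 2 \<and> n = 7) \<or> (odd p \<and> n = 4))"
  shows "M p n = f p n"
proof (cases "p = 2")
  case False
  then have "odd p" using p prime_odd_nat prime_ge_2_nat[OF p] by force
  then have p3: "p \<ge> 3" using prime_ge_2_nat[OF p] False by simp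
  show ?thesis
  proof (cases "odd n")
    case True
    then obtain k where k: "n = 2 * k + 1" by (rule oddE)
    show ?thesis unfolding k
      by (rule M_eq_f[OF p _ has_lower_1[OF p], of _ 1]) (use f_bound_odd_odd[OF p3] in auto)
  next
    case False
    then obtain k where k: "n = 2 * k + 2" using even_eq_double_plus_2[OF _ n] by blast
    have "k \<noteq> 1" using ne \<open>odd p\<close> k by auto
    then consider "k = 0" | "k \<ge> 2" by linarith
    then have "has_lower p (2 * k + 2) (2 * p ^ k)"
    proof cases
      case 1 then show ?thesis by (intro has_lower_elementary[OF p]) simp
    next
      case 2 then show ?thesis by (rule has_lower_2[OF p])
    qed
    then show ?thesis unfolding k
      by (rule M_eq_f[OF p, rotated, of _ _ 2]) (use f_bound_odd_even[OF p3] in auto)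
  qed
next
  case True
  note p2 = True
  have pr: "prime (2::nat)" by simp
  show ?thesis
  proof (cases "odd n")
    case False
    then obtain k where k: "n = 2 * k + 2" using even_eq_double_plus_2[OF _ n] by blast
    have "has_lower 2 (2 * k + 2) (2 * 2 ^ k)"
    proof (cases "k \<ge> 2")
      case True then show ?thesis by (rule has_lower_2[OF pr])
    next
      case False
      \<comment> \<open>In both cases 2 * 2^k = 2k + 2, so elementary abelian groups of rank 2 and 4
        attain the value.\<close>
      then have "k = 0 \<or> k = 1" by linarith
      then show ?thesis by (intro has_lower_elementary[OF pr]) auto
    qed
    then show ?thesis unfolding k p2
      by (rule M_eq_f[OF pr, rotated, of _ _ 2]) (use f_bound_two_even in auto)
  next
    case True
    show ?thesis
    proof (cases "n = 1")
      case n1: True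
      have "has_lower 2 1 1" by (rule has_lower_elementary[OF pr refl])
      then show ?thesis unfolding n1 p2 by (rule M_eq_f[OF pr, rotated, of _ _ 1]) auto
    next
      case False
      then obtain k where k: "n = 2 * k + 3" using odd_eq_double_plus_3[OF True] by blast
      \<comment> \<open>These are the excluded orders 2^5 and 2^7; k = 0 is the elementary abelian
        group of order 8.\<close>
      have "k \<noteq> 1" "k \<noteq> 2" using ne k p2 by auto
      then consider "k = 0" | "k \<ge> 3" by linarith
      then have "has_lower 2 (2 * k + 3) (3 * 2 ^ k)"
      proof cases
        case 1 then show ?thesis by (intro has_lower_elementary[OF pr]) simp
      next
        case 2 then show ?thesis by (rule has_lower_3)
      qed
      then show ?thesis unfolding k p2
        by (rule M_eq_f[OF pr, rotated, of _ _ 3]) (use f_bound_two_odd in auto)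
    qed
  qed
qed

theorem theorem1p1:
  fixes p n :: nat
  assumes "prime p" and "n \<ge> 1"
  shows "(\<not> ((p = 2 \<and> n = 5) \<or> (p = 2 \<and> n = 7) \<or> (odd p \<and> n = 4)) \<longrightarrow> M p n = f p n)
       \<and> (p = 2 \<and> n = 5 \<longrightarrow> M p n = 5)
       \<and> (p = 2 \<and> n = 7 \<longrightarrow> M p n = 10)
       \<and> (odd p \<and> n = 4 \<longrightarrow> M p n = p + 1)"
  using M_generic[OF assms] M_2_5 M_2_7 M_odd_4[OF assms(1)] by auto

end
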